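(* Let $T>0$ be fixed and $h_n=T/n$. Let the observations be generated by model $m$ on $[0,T]$ with true parameter $\theta_{m,0}\in\Theta_m$, and let $m^*$ be a model number whose covariance structure is to be tested. Assume: (a) each drift $B\in\{B_{1,m},B_{2,m},B_{3,m},B_{4,m}\}$ is globally Lipschitz and belongs to $C^4_{\uparrow}$, and each process $Y\in\{\xi_m,\delta_m,\varepsilon_m,\zeta_m\}$ satisfies $\sup_t \mathbb{E}[|Y_t|^{\ell}]<\infty$ for all $\ell\ge 0$; (b) for $\mu\in\{m,m^*\}$ and all $\theta_\mu\in\Theta_\mu$: $\Sigma_{\delta\delta,\mu}>0$, $\Sigma_{\varepsilon\varepsilon,\mu}>0$, $\Psi_\mu$ is non-singular, and $\operatorname{rank}\Lambda_{x_1,\mu}=k_{1,\mu}$; (c) for $\theta,\tilde\theta\in\Theta_{m^*}$, $\Sigma_{m^*}(\theta)=\Sigma_{m^*}(\tilde\theta)$ implies $\theta=\tilde\theta$; (d) the null hypothesis $H_0$ holds: there is $\theta_{m^*,0}\in\Theta_{m^*}$ with $\Sigma_m(\theta_{m,0})=\Sigma_{m^*}(\theta_{m^*,0})$; (e) $\operatorname{rank}\Delta_{m^*}=q_{m^*}$. Then, as $h_n\to0$ (i.e. $n\to\infty$), $$\mathbb{T}_{m^*,n}\xrightarrow{d}\chi^2_{\bar p-q_{m^*}},$$ where $\chi^2_r$ is the chi-squared distribution with $r$ degrees of freedom.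
   Context: Notation. $p=p_1+p_2$, $\bar p=p(p+1)/2$. $|\cdot|$ is the Euclidean norm; $A>0$ means positive definite. For symmetric $A\in\mathbb{R}^{p\times p}$, $\operatorname{vec}A$ and $\operatorname{vech}A$ are the vectorization and half-vectorization, $\mathbb{D}_p$ is the $p^2\times\bar p$ duplication matrix ($\operatorname{vec}A=\mathbb{D}_p\operatorname{vech}A$). $C^4_{\uparrow}(\mathbb{R}^d)$ is the set of functions on $\mathbb{R}^d$ that are four times continuously differentiable and which, together with all these derivatives, are of polynomial growth. Model ($m$ is a model number). $p_1,p_2\ge1$, $k_{1,m}\le p_1$, $k_{2,m}\le p_2$ are fixed integers independent of $n$; $p_1,p_2$ do not depend on the model number. The observable process is $X_t=(X_{1,t}^\top,X_{2,t}^\top)^\top\in\mathbb{R}^{p_1+p_2}$ with $$X_{1,t}=\Lambda_{x_1,m}\xi_{m,t}+\delta_{m,t},\quad X_{2,t}=\Lambda_{x_2,m}\eta_{m,t}+\varepsilon_{m,t},\quad \eta_{m,t}=B_{0,m}\eta_{m,t}+\Gamma_m\xi_{m,t}+\zeta_{m,t},$$ where $\Lambda_{x_1,m}\in\mathbb{R}^{p_1\times k_{1,m}}$, $\Lambda_{x_2,m}\in\mathbb{R}^{p_2\times k_{2,m}}$, $\Gamma_m\in\mathbb{R}^{k_{2,m}\times k_{1,m}}$, $B_{0,m}\in\mathbb{R}^{k_{2,m}\times k_{2,m}}$ (zero diagonal) are constant, and $\Psi_m=\mathbb{I}_{k_{2,m}}-B_{0,m}$. The latent processes (dimensions $k_{1,m},p_1,p_2,k_{2,m}$)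 solve $$d\xi_{m,t}=B_{1,m}(\xi_{m,t})dt+S_{1,m}dW_{1,t},\quad d\delta_{m,t}=B_{2,m}(\delta_{m,t})dt+S_{2,m}dW_{2,t},$$ $$d\varepsilon_{m,t}=B_{3,m}(\varepsilon_{m,t})dt+S_{3,m}dW_{3,t},\quad d\zeta_{m,t}=B_{4,m}(\zeta_{m,t})dt+S_{4,m}dW_{4,t},$$ with deterministic initial values, constant matrices $S_{i,m}$, and independent standard Wiener processes $W_1,\dots,W_4$ of dimensions $r_1,\dots,r_4$. Put $\Sigma_{\xi\xi,m}=S_{1,m}S_{1,m}^\top$, $\Sigma_{\delta\delta,m}=S_{2,m}S_{2,m}^\top$, $\Sigma_{\varepsilon\varepsilon,m}=S_{3,m}S_{3,m}^\top$, $\Sigma_{\zeta\zeta,m}=S_{4,m}S_{4,m}^\top$. Parameter. $\theta_m\in\Theta_m$, with $\Theta_m\subset\mathbb{R}^{q_m}$ convex and compact, collects the unknown, non-duplicated entries of $\Lambda_{x_1,m},\Lambda_{x_2,m},\Gamma_m,\Psi_m,\Sigma_{\xi\xi,m},\Sigma_{\delta\delta,m},\Sigma_{\varepsilon\varepsilon,m},\Sigma_{\zeta\zeta,m}$ (all other entries are known constants or equal to other entries), so these matrices are functions of $\theta_m$. The covariance structure is $$\Sigma_m(\theta_m)=\begin{pmatrix}\Sigma_{X_1X_1,m}&\Sigma_{X_1X_2,m}\\ \Sigma_{X_1X_2,m}^\top&\Sigma_{X_2X_2,m}\end{pmatrix},$$ $\Sigma_{X_1X_1,m}=\Lambda_{x_1,m}\Sigma_{\xi\xi,m}\Lambda_{x_1,m}^\top+\Sigma_{\delta\delta,m}$,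 $\Sigma_{X_1X_2,m}=\Lambda_{x_1,m}\Sigma_{\xi\xi,m}\Gamma_m^\top\Psi_m^{-1\top}\Lambda_{x_2,m}^\top$, $\Sigma_{X_2X_2,m}=\Lambda_{x_2,m}\Psi_m^{-1}(\Gamma_m\Sigma_{\xi\xi,m}\Gamma_m^\top+\Sigma_{\zeta\zeta,m})\Psi_m^{-1\top}\Lambda_{x_2,m}^\top+\Sigma_{\varepsilon\varepsilon,m}$. The model $m^*$ has its own dimensions $k_{1,m^*},k_{2,m^*}$, matrices, parameter set $\Theta_{m^*}\subset\mathbb{R}^{q_{m^*}}$ (convex compact) and covariance structure $\Sigma_{m^*}(\theta_{m^*})$, defined in the same way with $m$ replaced by $m^*$. Observations. $X_{t_i^n}$ with $t_i^n=ih_n$, $0\le i\le n$, $T=nh_n$, and $Q_{XX}=\frac1T\sum_{i=1}^n(X_{t_i^n}-X_{t_{i-1}^n})(X_{t_i^n}-X_{t_{i-1}^n})^\top$. Further definitions. $\Delta_{m^*}=\partial\operatorname{vech}\Sigma_{m^*}(\theta)/\partial\theta^\top\big|_{\theta=\theta_{m^*,0}}\in\mathbb{R}^{\bar p\times q_{m^*}}$ (Jacobian). For positive definite $X,Y\in\mathbb{R}^{p\times p}$, $$V(X,Y)=\mathbb{D}_p^\top\int_0^1\!\!\int_0^1\lambda_2\,(Y+\lambda_1\lambda_2(X-Y))^{-1}\otimes(Y+\lambda_1\lambda_2(X-Y))^{-1}\,d\lambda_1d\lambda_2\,\mathbb{D}_p.$$ Set $\tilde V(Q_{XX},\Sigma)=V(Q_{XX},\Sigma)$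 if $Q_{XX}$ is non-singular and $\mathbb{I}_{\bar p}$ otherwise, and $$\mathbb{F}_{m^*,n}(\theta)=(\operatorname{vech}Q_{XX}-\operatorname{vech}\Sigma_{m^*}(\theta))^\top\tilde V(Q_{XX},\Sigma_{m^*}(\theta))(\operatorname{vech}Q_{XX}-\operatorname{vech}\Sigma_{m^*}(\theta)),\quad\theta\in\Theta_{m^*}.$$ (When $Q_{XX}>0$, $\mathbb{F}_{m^*,n}(\theta)=\log\det\Sigma_{m^*}(\theta)-\log\det Q_{XX}+\operatorname{tr}\{\Sigma_{m^*}(\theta)^{-1}Q_{XX}\}-p$.) The estimator $\hat\theta_{m^*,n}\in\Theta_{m^*}$ satisfies $\mathbb{F}_{m^*,n}(\hat\theta_{m^*,n})=\inf_{\theta\in\Theta_{m^*}}\mathbb{F}_{m^*,n}(\theta)$, and the quasi-likelihood ratio test statistic is $\mathbb{T}_{m^*,n}=n\,\mathbb{F}_{m^*,n}(\hat\theta_{m^*,n})$.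
   Formalization: The formal theorem additionally assumes that θ_{m*,0} lies in the interior of Θ_{m*}; at a boundary point of the convex set the limit is not χ² with p̄−q degrees of freedom (e.g. Γ=θ∈[0,1], θ_0=0 gives a mixture of χ²_2 and χ²_3). *)

theory Defs
  imports "HOL-Probability.Probability" "HOL-Library.Uprod"
begin

section \<open>Symmetric matrices, half-vectorization, duplication matrix\<close>

definition pos_def :: "real^'a^'a \<Rightarrow> bool" where
  "pos_def A \<longleftrightarrow> transpose A = A \<and> (\<forall>x. x \<noteq> 0 \<longrightarrow> 0 < x \<bullet> (A *v x))"

text \<open>A matrix of the form \<open>S S\<^sup>T\<close>. Square \<open>S\<close> suffice: every \<open>S S\<^sup>T\<close> with another number of
  columns is also of this form.\<close>

definition gram :: "real^'a^'a \<Rightarrow> bool" where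
  "gram A \<longleftrightarrow> (\<exists>S :: real^'a^'a. A = S ** transpose S)"

definition outer :: "real^'a \<Rightarrow> real^'b \<Rightarrow> real^'b^'a" where
  "outer v w = (\<chi> i j. v $ i * w $ j)"

definition block_matrix ::
  "real^'a::finite^'a \<Rightarrow> real^'b::finite^'a \<Rightarrow> real^'a^'b \<Rightarrow> real^'b^'b \<Rightarrow> real^('a+'b)^('a+'b)" where
  "block_matrix A B C D = (\<chi> i j.
     case i of
       Inl a \<Rightarrow> (case j of Inl a' \<Rightarrow> A $ a $ a' | Inr b' \<Rightarrow> B $ a $ b')
     | Inr b \<Rightarrow> (case j of Inl a' \<Rightarrow> C $ b $ a' | Inr b' \<Rightarrow> D $ b $ b'))"

definition stack :: "real^'a::finite \<Rightarrow> real^'b::finite \<Rightarrow> real^('a+'b)" where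
  "stack v w = (\<chi> i. case i of Inl a \<Rightarrow> v $ a | Inr b \<Rightarrow> w $ b)"

text \<open>Entries of the half-vectorization are indexed by unordered pairs \<open>Upair i j\<close>, of which there are
  \<open>p (p + 1) / 2\<close> (lemma \<open>card_UNIV_uprod\<close>). Entries of the vectorization are indexed by
  (column, row), in accordance with the column-stacking convention and the index order of
  the Kronecker product.\<close>

instance uprod :: (finite) finite
  by standard simp

definition vectorize :: "real^'a::finite^'a \<Rightarrow> real^('a \<times> 'a)" where
  "vectorize A = (\<chi> ji. A $ snd ji $ fst ji)"

text \<open>For each unordered pair one of the two entries is selected; on symmetric matrices the choice is
  immaterial (lemma \<open>vech_nth\<close>).\<close>

definition vech :: "real^'a::finite^'a \<Rightarrow> real^('a uprod)" where
  "vech A = (\<chi> u. let ij = (SOME ij. u = Upair (fst ij) (snd ij)) in A $ fst ij $ snd ij)"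

definition duplication_matrix :: "real^('a::finite uprod)^('a \<times> 'a)" where
  "duplication_matrix = (\<chi> ji u. if u = Upair (snd ji) (fst ji) then 1 else 0)"

definition kron :: "real^'b::finite^'a::finite \<Rightarrow> real^'d::finite^'c::finite \<Rightarrow> real^('b \<times> 'd)^('a \<times> 'c)" where
  "kron A B = (\<chi> i j. A $ fst i $ fst j * B $ snd i $ snd j)"

lemma vech_nth:
  assumes "transpose A = A"
  shows "vech A $ Upair i j = A $ i $ j"
proof -
  define ij where "ij = (SOME ij. Upair i j = Upair (fst ij) (snd ij))"
  have "Upair i j = Upair (fst ij) (snd ij)"
    unfolding ij_def by (rule someI[of _ "(i, j)"]) simp
  moreover have "A $ j $ i = A $ i $ j"
    using assms by (metis transpose_def vec_lambda_beta)
  ultimately have "A $ fst ij $ snd ij = A $ i $ j"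
    by auto
  moreover have "vech A $ Upair i j = A $ fst ij $ snd ij"
    by (simp only: vech_def Let_def vec_lambda_beta ij_def)
  ultimately show ?thesis by simp
qed

lemma vectorize_eq_duplication_vech:
  fixes A :: "real^'a::finite^'a"
  assumes "transpose A = A"
  shows "vectorize A = duplication_matrix *v vech A"
  by (simp add: vec_eq_iff vectorize_def duplication_matrix_def matrix_vector_mult_def
      vech_nth[OF assms] if_distrib[where f = "\<lambda>x. x * _"] cong: if_cong)

section \<open>The contrast function\<close>

definition V_mat :: "real^'p::finite^'p \<Rightarrow> real^'p^'p \<Rightarrow> real^('p uprod)^('p uprod)" where
  "V_mat X Y = transpose duplication_matrix **
     integral {0..1} (\<lambda>l2. integral {0..1} (\<lambda>l1.
       l2 *\<^sub>R kron (matrix_inv (Y + (l1 * l2) *\<^sub>R (X - Y)))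
                (matrix_inv (Y + (l1 * l2) *\<^sub>R (X - Y)))))
     ** duplication_matrix"

definition V_tilde :: "real^'p::finite^'p \<Rightarrow> real^'p^'p \<Rightarrow> real^('p uprod)^('p uprod)" where
  "V_tilde Q S = (if invertible Q then V_mat Q S else mat 1)"

definition contrast :: "real^'p^'p \<Rightarrow> real^'p^'p \<Rightarrow> real" where
  "contrast Q S = (vech Q - vech S) \<bullet> (V_tilde Q S *v (vech Q - vech S))"

definition realized_cov :: "real \<Rightarrow> (real \<Rightarrow> 'w \<Rightarrow> real^'p) \<Rightarrow> nat \<Rightarrow> 'w \<Rightarrow> real^'p^'p" where
  "realized_cov T X n \<omega> = (let h = T / real n;
      dX = (\<lambda>i. X (real i * h) \<omega> - X (real (i - 1) * h) \<omega>)
    in (1 / T) *\<^sub>R (\<Sum>i = 1..n. outer (dX i) (dX i)))"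

section \<open>Structural equation models\<close>

text \<open>The parameter set together with the model matrices as functions of the parameter.
  The model dimensions are the cardinalities of the index types.\<close>

record ('q::finite, 'p1::finite, 'p2::finite, 'k1::finite, 'k2::finite) sem =
  params :: "(real^'q) set"
  Lx1 :: "real^'q \<Rightarrow> real^'k1^'p1"
  Lx2 :: "real^'q \<Rightarrow> real^'k2^'p2"
  Gam :: "real^'q \<Rightarrow> real^'k1^'k2"
  B0 :: "real^'q \<Rightarrow> real^'k2^'k2"
  Sxi :: "real^'q \<Rightarrow> real^'k1^'k1"
  Sdelta :: "real^'q \<Rightarrow> real^'p1^'p1"
  Seps :: "real^'q \<Rightarrow> real^'p2^'p2"
  Szeta :: "real^'q \<Rightarrow> real^'k2^'k2"

definition Psi :: "('q::finite,'p1::finite,'p2::finite,'k1::finite,'k2::finite) sem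
    \<Rightarrow> real^'q \<Rightarrow> real^'k2^'k2" where
  "Psi m \<theta> = mat 1 - B0 m \<theta>"

definition Sigma_cov :: "('q::finite,'p1::finite,'p2::finite,'k1::finite,'k2::finite) sem
    \<Rightarrow> real^'q \<Rightarrow> real^('p1+'p2)^('p1+'p2)" where
  "Sigma_cov m \<theta> =
    (let \<Lambda>1 = Lx1 m \<theta>; \<Lambda>2 = Lx2 m \<theta>; \<Gamma> = Gam m \<theta>; \<Psi>i = matrix_inv (Psi m \<theta>);
         S11 = \<Lambda>1 ** Sxi m \<theta> ** transpose \<Lambda>1 + Sdelta m \<theta>;
         S12 = \<Lambda>1 ** Sxi m \<theta> ** transpose \<Gamma> ** transpose \<Psi>i ** transpose \<Lambda>2;
         S22 = \<Lambda>2 ** \<Psi>i ** (\<Gamma> ** Sxi m \<theta> ** transpose \<Gamma> + Szeta m \<theta>)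
                 ** transpose \<Psi>i ** transpose \<Lambda>2 + Seps m \<theta>
     in block_matrix S11 S12 (transpose S12) S22)"

definition entries :: "(real^'q \<Rightarrow> real^'b^'a) \<Rightarrow> (real^'q \<Rightarrow> real) set" where
  "entries A = {\<lambda>\<theta>. A \<theta> $ i $ j | i j. True}"

definition sem_entries :: "('q::finite,'p1::finite,'p2::finite,'k1::finite,'k2::finite) sem
    \<Rightarrow> (real^'q \<Rightarrow> real) set" where
  "sem_entries m = entries (Lx1 m) \<union> entries (Lx2 m) \<union> entries (Gam m) \<union> entries (Psi m) \<union>
     entries (Sxi m) \<union> entries (Sdelta m) \<union> entries (Seps m) \<union> entries (Szeta m)"

text \<open>The last three conditions: every entry of the model matrices is a known constant or
  one of the parameter coordinates (possibly the same coordinate for several entries), every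
  parameter coordinate occurs as an entry, and the covariance parameters are
  values of \<open>S S\<^sup>T\<close>.\<close>

definition sem_model ::
  "('q::finite,'p1::finite,'p2::finite,'k1::finite,'k2::finite) sem \<Rightarrow> bool" where
  "sem_model m \<longleftrightarrow>
     CARD('k1) \<le> CARD('p1) \<and> CARD('k2) \<le> CARD('p2) \<and>
     convex (params m) \<and> compact (params m) \<and>
     (\<forall>\<theta> i. B0 m \<theta> $ i $ i = 0) \<and>
     sem_entries m \<subseteq> {\<lambda>\<theta>. c | c. True} \<union> {\<lambda>\<theta>. \<theta> $ k | k. True} \<and>
     {\<lambda>\<theta>. \<theta> $ k | k. True} \<subseteq> sem_entries m \<and>
     (\<forall>\<theta>\<in>params m. gram (Sxi m \<theta>) \<and> gram (Sdelta m \<theta>) \<and> gram (Seps m \<theta>) \<and> gram (Szeta m \<theta>))"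

section \<open>Stochastic processes on \<open>[0,T]\<close>\<close>

definition wiener_process :: "'w measure \<Rightarrow> real \<Rightarrow> (real \<Rightarrow> 'w \<Rightarrow> real^'r) \<Rightarrow> bool" where
  "wiener_process M T W \<longleftrightarrow>
     (\<forall>t\<in>{0..T}. W t \<in> borel_measurable M) \<and>
     (AE \<omega> in M. W 0 \<omega> = 0) \<and>
     (AE \<omega> in M. continuous_on {0..T} (\<lambda>t. W t \<omega>)) \<and>
     (\<forall>N s. 0 \<le> s 0 \<and> (\<forall>j<N. s j \<le> s (Suc j)) \<and> s N \<le> T \<longrightarrow>
        prob_space.indep_vars M (\<lambda>_. borel) (\<lambda>j \<omega>. W (s (Suc j)) \<omega> - W (s j) \<omega>) {..<N::nat}) \<and>
     (\<forall>s t. 0 \<le> s \<and> s < t \<and> t \<le> T \<longrightarrow>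
        prob_space.indep_vars M (\<lambda>_. borel) (\<lambda>i \<omega>. (W t \<omega> - W s \<omega>) $ i) UNIV \<and>
        (\<forall>i. distributed M lborel (\<lambda>\<omega>. (W t \<omega> - W s \<omega>) $ i) (normal_density 0 (sqrt (t - s)))))"

definition process_events :: "'w measure \<Rightarrow> real \<Rightarrow> (real \<Rightarrow> 'w \<Rightarrow> real^'r) \<Rightarrow> 'w set set" where
  "process_events M T W =
     sigma_sets (space M) {W t -` A \<inter> space M | t A. t \<in> {0..T} \<and> A \<in> sets borel}"

definition indep_processes4 :: "'w measure \<Rightarrow> real \<Rightarrow> (real \<Rightarrow> 'w \<Rightarrow> real^'r1) \<Rightarrow>
    (real \<Rightarrow> 'w \<Rightarrow> real^'r2) \<Rightarrow> (real \<Rightarrow> 'w \<Rightarrow> real^'r3) \<Rightarrow> (real \<Rightarrow> 'w \<Rightarrow> real^'r4) \<Rightarrow> bool" where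
  "indep_processes4 M T W1 W2 W3 W4 \<longleftrightarrow>
     prob_space.indep_sets M
       (\<lambda>i::nat. [process_events M T W1, process_events M T W2,
                  process_events M T W3, process_events M T W4] ! i) {..<4}"

text \<open>\<open>dY = B(Y) dt + S dW\<close> with a constant matrix \<open>S\<close> and deterministic initial value. Because \<open>S\<close> is
  constant and \<open>W 0 = 0\<close>, the stochastic integral of \<open>S\<close> over \<open>[0,t]\<close> is \<open>S (W t)\<close>.\<close>

definition sde_solution :: "'w measure \<Rightarrow> real \<Rightarrow> (real^'d \<Rightarrow> real^'d) \<Rightarrow> real^'r^'d \<Rightarrow>
    (real \<Rightarrow> 'w \<Rightarrow> real^'r) \<Rightarrow> (real \<Rightarrow> 'w \<Rightarrow> real^'d) \<Rightarrow> bool" where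
  "sde_solution M T B S W Y \<longleftrightarrow>
     (\<forall>t\<in>{0..T}. Y t \<in> borel_measurable M) \<and>
     (AE \<omega> in M. continuous_on {0..T} (\<lambda>t. Y t \<omega>)) \<and>
     (\<exists>y0. AE \<omega> in M. \<forall>t\<in>{0..T}.
        Y t \<omega> = y0 + integral {0..t} (\<lambda>s. B (Y s \<omega>)) + S *v W t \<omega>)"

definition bounded_moments :: "'w measure \<Rightarrow> real \<Rightarrow> (real \<Rightarrow> 'w \<Rightarrow> real^'d) \<Rightarrow> bool" where
  "bounded_moments M T Y \<longleftrightarrow>
     (\<forall>l\<ge>0. (SUP t\<in>{0..T}. \<integral>\<^sup>+ \<omega>. ennreal (norm (Y t \<omega>) powr l) \<partial>M) < \<infinity>)"

definition poly_growth :: "(real^'d \<Rightarrow> real^'e) \<Rightarrow> bool" where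
  "poly_growth f \<longleftrightarrow> (\<exists>C k. \<forall>x. norm (f x) \<le> C * (1 + norm x) ^ k)"

text \<open>\<open>k\<close> times continuously differentiable, with all partial derivatives of order at most \<open>k\<close>
  of polynomial growth.\<close>

primrec C_up :: "nat \<Rightarrow> (real^'d \<Rightarrow> real^'e) \<Rightarrow> bool" where
  "C_up 0 f \<longleftrightarrow> continuous_on UNIV f \<and> poly_growth f"
| "C_up (Suc k) f \<longleftrightarrow> poly_growth f \<and> (\<forall>x. f differentiable (at x)) \<and>
     (\<forall>i. C_up k (\<lambda>x. frechet_derivative f (at x) (axis i 1)))"

definition regular_drift :: "(real^'d \<Rightarrow> real^'d) \<Rightarrow> bool" where
  "regular_drift B \<longleftrightarrow> (\<exists>L. L-lipschitz_on UNIV B) \<and> C_up 4 B"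

section \<open>Chi-squared distribution\<close>

text \<open>The law of the sum of squares of \<open>r\<close> independent standard normal variables
  (for \<open>r = 0\<close> the point mass at 0).\<close>

definition chi_squared :: "nat \<Rightarrow> real measure" where
  "chi_squared r = distr (\<Pi>\<^sub>M i\<in>{..<r}. density lborel std_normal_density) borel
                     (\<lambda>x. \<Sum>i<r. (x i)\<^sup>2)"

end

theory Submission
  imports Defs
begin

text \<open>For positive definite arguments the contrast is a quadratic form in \<open>vech Q - vech \<Sigma>(\<theta>)\<close> whose
  matrix is continuous and positive definite. At \<open>\<Sigma>0\<close> the form is half the squared Frobenius norm of
  \<open>\<Phi> v = A\<^sup>T \<Sigma>0\<^sup>-\<^sup>1 (unvech v) \<Sigma>0\<^sup>-\<^sup>1 A\<close>, where \<open>\<Sigma>0 = A A\<^sup>T\<close> and \<open>X\<close> is \<open>A W\<close> plus a path with a continuous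
  derivative. Identifiability and the full rank of the Jacobian force the minimizer to stay within
  \<open>O(|vech Q - vech \<Sigma>0|)\<close> of the true parameter, so up to \<open>o(|vech Q - vech \<Sigma>0|\<^sup>2)\<close> the minimal contrast is
  half the squared distance of \<open>\<Phi> (vech Q - vech \<Sigma>0)\<close> from the image of the tangent space. The smooth
  part of \<open>X\<close> is pathwise negligible. What remains is the squared length of a projection, of rank \<open>p (p + 1) / 2 - q\<close>,
  of a normalized sum of independent quadratic forms in Gaussian vectors; by the central limit theorem the
  characteristic functions of its coordinates converge, and averaging them over a Gaussian argument
  gives the Laplace transform of the squared length.\<close>

text \<open>The smooth part of \<open>X\<close> depends on \<open>W\<close>, and Cauchy-Schwarz
  alone bounds its cross variation with the noise only by O(1 / sqrt n), the very size of the
  fluctuations that survive in the limit. The missing o(1) is gained path by path. To reach almost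
  sure convergence without following the quadratic variation of each path, the residual is divided
  by one plus the discrete variation of the noise; tightness of the Gaussian array undoes the
  division later. The factor \<open>A\<close> is read off from the loadings and the diffusion
  matrices and is in general not square, so no matrix square root is taken. The matrix
  \<open>A\<^sup>T \<Sigma>0\<^sup>-\<^sup>1 A\<close> is then only a projection, but conjugation by
  it fixes every matrix in the range of \<open>\<Phi>\<close>. Two constants cancel: the weight
  \<open>l2\<close> in \<open>V_mat\<close> integrates to 1/2, and a centred Gaussian quadratic form
  with symmetric matrix C has variance 2 |C|^2. The grids for different n sample the same path, so
  only the law for each fixed n enters. The estimator itself carries no measurability; its minimal
  value is measurable as an infimum over a countable dense set.\<close>

section \<open>Inverse matrices\<close>

lemma matrix_inv_works:
  fixes A :: "real^'n^'n"
  assumes "invertible A"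
  shows "A ** matrix_inv A = mat 1" "matrix_inv A ** A = mat 1"
proof -
  have "A ** matrix_inv A = mat 1 \<and> matrix_inv A ** A = mat 1"
    unfolding matrix_inv_def using assms[unfolded invertible_def] by (rule someI_ex)
  then show "A ** matrix_inv A = mat 1" "matrix_inv A ** A = mat 1" by auto
qed

text \<open>Cramer's rule, solved for the columns of the identity. It exhibits the entries of the
  inverse as quotients of polynomials in the entries of \<open>A\<close>, which is how
  \<open>matrix_inv\<close> becomes differentiable.\<close>

lemma matrix_inv_entry:
  fixes A :: "real^'n^'n"
  assumes "det A \<noteq> 0"
  shows "matrix_inv A $ i $ j = det (\<chi> a b. if b = i then axis j 1 $ a else A $ a $ b) / det A"
proof -
  have "A *v (matrix_inv A *v axis j 1) = axis j 1"
    using matrix_inv_works(1)[of A] assms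
    by (simp add: matrix_vector_mul_assoc invertible_det_nz)
  then have "matrix_inv A *v axis j 1 =
      (\<chi> k. det (\<chi> a b. if b = k then axis j 1 $ a else A $ a $ b) / det A)"
    using cramer[OF assms] by blast
  then have "(matrix_inv A *v axis j 1) $ i =
      det (\<chi> a b. if b = i then axis j 1 $ a else A $ a $ b) / det A"
    by simp
  then show ?thesis
    by (simp add: matrix_vector_mult_basis column_def)
qed

section \<open>Differentiability and continuity of matrix operations\<close>

lemma differentiable_prod:
  fixes f :: "'i \<Rightarrow> 'a::real_normed_vector \<Rightarrow> real"
  assumes "\<And>i. i \<in> I \<Longrightarrow> f i differentiable (at x within S)"
  shows "(\<lambda>x. \<Prod>i\<in>I. f i x) differentiable (at x within S)"
  using assms by (induction I rule: infinite_finite_induct) auto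

lemma differentiable_det:
  fixes f :: "'a::real_normed_vector \<Rightarrow> real^'n^'n"
  assumes "\<And>i j. (\<lambda>x. f x $ i $ j) differentiable (at x within S)"
  shows "(\<lambda>x. det (f x)) differentiable (at x within S)"
  unfolding det_def using assms
  by (intro differentiable_sum differentiable_mult differentiable_const differentiable_prod ballI)
     (auto simp: finite_permutations)

lemma vec_eq_sum_axis:
  fixes v :: "'b::euclidean_space^'n"
  shows "v = (\<Sum>i\<in>UNIV. axis i (v $ i))"
  by (simp add: vec_eq_iff axis_def if_distrib cong: if_cong)

lemma linear_axis: "linear (axis i :: 'b::real_vector \<Rightarrow> 'b^'n)"
  by (rule linearI) (simp_all add: vec_eq_iff axis_def)

lemma differentiable_vec:
  fixes f :: "'a::real_normed_vector \<Rightarrow> 'b::euclidean_space^'n"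
  assumes "\<And>i. (\<lambda>x. f x $ i) differentiable (at x within S)"
  shows "f differentiable (at x within S)"
proof -
  have "(\<lambda>x. axis i (f x $ i) :: 'b^'n) differentiable (at x within S)" for i
    by (rule differentiable_compose[OF linear_imp_differentiable[OF linear_axis] assms])
  then have "(\<lambda>x. \<Sum>i\<in>UNIV. axis i (f x $ i)) differentiable (at x within S)"
    by (intro differentiable_sum) auto
  then show ?thesis
    by (simp add: vec_eq_sum_axis[symmetric])
qed

lemma differentiable_nth:
  fixes f :: "'a::real_normed_vector \<Rightarrow> 'b::euclidean_space^'n"
  assumes "f differentiable (at x within S)"
  shows "(\<lambda>x. f x $ i) differentiable (at x within S)"
  by (rule differentiable_compose[OF bounded_linear_imp_differentiable[OF bounded_linear_vec_nth] assms])

lemma differentiable_matrix_mult: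
  fixes f :: "'a::real_normed_vector \<Rightarrow> real^'n^'m" and g :: "'a \<Rightarrow> real^'k^'n"
  assumes "f differentiable (at x within S)" "g differentiable (at x within S)"
  shows "(\<lambda>x. f x ** g x) differentiable (at x within S)"
  unfolding matrix_matrix_mult_def using assms
  by (intro differentiable_vec) (auto intro!: differentiable_sum differentiable_mult differentiable_nth)

lemma differentiable_transpose:
  fixes f :: "'a::real_normed_vector \<Rightarrow> real^'n^'m"
  assumes "f differentiable (at x within S)"
  shows "(\<lambda>x. transpose (f x)) differentiable (at x within S)"
  unfolding transpose_def using assms
  by (intro differentiable_vec) (auto intro!: differentiable_nth)

text \<open>The Cramer quotient equals the inverse only where \<open>f\<close> is invertible.
  Invertibility is available on \<open>S\<close> alone, so the two are compared there and the
  derivative is taken within \<open>S\<close>.\<close>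

lemma differentiable_matrix_inv:
  fixes f :: "'a::real_normed_vector \<Rightarrow> real^'n^'n"
  assumes f: "f differentiable (at x within S)" and "x \<in> S"
    and inv: "\<And>y. y \<in> S \<Longrightarrow> invertible (f y)"
  shows "(\<lambda>x. matrix_inv (f x)) differentiable (at x within S)"
proof (intro differentiable_vec)
  fix i j
  have nz: "det (f y) \<noteq> 0" if "y \<in> S" for y
    using inv[OF that] by (simp add: invertible_det_nz)
  have num: "(\<lambda>y. det (\<chi> a b. if b = i then axis j 1 $ a else f y $ a $ b)) differentiable (at x within S)"
  proof (intro differentiable_det)
    fix k l
    show "(\<lambda>y. (\<chi> a b. if b = i then axis j 1 $ a else f y $ a $ b) $ k $ l) differentiable (at x within S)"
      using f by (cases "l = i") (auto intro!: differentiable_nth)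
  qed
  have "(\<lambda>y. det (\<chi> a b. if b = i then axis j 1 $ a else f y $ a $ b) / det (f y))
      differentiable (at x within S)"
    using f nz[OF \<open>x \<in> S\<close>] by (intro differentiable_divide[OF num] differentiable_det differentiable_nth)
  then show "(\<lambda>y. matrix_inv (f y) $ i $ j) differentiable (at x within S)"
    by (rule differentiable_transform_within[OF _ zero_less_one \<open>x \<in> S\<close>])
       (simp add: matrix_inv_entry nz)
qed

lemma continuous_on_matrix_inv:
  fixes f :: "'a::topological_space \<Rightarrow> real^'n^'n"
  assumes "continuous_on S f" "\<And>y. y \<in> S \<Longrightarrow> invertible (f y)"
  shows "continuous_on S (\<lambda>x. matrix_inv (f x))"
proof -
  have "(\<lambda>A. matrix_inv A) differentiable_on {A::real^'n^'n. invertible A}"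
    unfolding differentiable_on_def by (auto intro!: differentiable_matrix_inv)
  then have "continuous_on {A::real^'n^'n. invertible A} matrix_inv"
    by (simp add: differentiable_imp_continuous_on)
  then show ?thesis
    by (rule continuous_on_compose2[OF _ assms(1)]) (use assms(2) in auto)
qed

section \<open>Positive definite matrices\<close>

lemma inner_transpose: "x \<bullet> (A *v y) = (transpose A *v x) \<bullet> (y::real^'n)"
  by (metis dot_lmul_matrix transpose_matrix_vector)

lemma inner_symmetric: "transpose A = A \<Longrightarrow> x \<bullet> (A *v y) = y \<bullet> (A *v (x::real^'n))"
  by (metis inner_transpose inner_commute)

lemma pos_def_invertible:
  assumes "pos_def A" shows "invertible A"
proof -
  have "x = 0" if "A *v x = 0" for x
  proof (rule ccontr)
    assume "x \<noteq> 0"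
    with assms have "0 < x \<bullet> (A *v x)"
      by (simp add: pos_def_def)
    with that show False by simp
  qed
  then show ?thesis
    unfolding invertible_left_inverse matrix_left_invertible_ker by blast
qed

lemma symmetric_matrix_inv:
  fixes A :: "real^'n^'n"
  assumes "transpose A = A" "invertible A"
  shows "transpose (matrix_inv A) = matrix_inv A"
proof -
  have "transpose (matrix_inv A) = transpose (matrix_inv A) ** (A ** matrix_inv A)"
    by (simp add: matrix_inv_works[OF assms(2)])
  also have "\<dots> = transpose (A ** matrix_inv A) ** matrix_inv A"
    by (simp add: matrix_transpose_mul assms(1) matrix_mul_assoc)
  also have "\<dots> = matrix_inv A"
    by (simp add: matrix_inv_works[OF assms(2)] transpose_mat)
  finally show ?thesis .
qed

lemma pos_def_matrix_inv:
  assumes "pos_def A" shows "pos_def (matrix_inv A)"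
proof -
  note inv = pos_def_invertible[OF assms]
  have "0 < x \<bullet> (matrix_inv A *v x)" if "x \<noteq> 0" for x
  proof -
    let ?y = "matrix_inv A *v x"
    have x: "A *v ?y = x"
      by (simp add: matrix_vector_mul_assoc matrix_inv_works[OF inv])
    with that have "?y \<noteq> 0" by auto
    with assms have "0 < ?y \<bullet> (A *v ?y)"
      by (simp add: pos_def_def)
    then show ?thesis by (simp add: x inner_commute)
  qed
  moreover have "transpose (matrix_inv A) = matrix_inv A"
    using assms inv by (simp add: symmetric_matrix_inv pos_def_def)
  ultimately show ?thesis by (simp add: pos_def_def)
qed

lemma convex_pos_def: "convex {A. pos_def A}"
proof (rule convexI, simp)
  fix A B :: "real^'n^'n" and u v :: real
  assume AB: "pos_def A" "pos_def B" and uv: "0 \<le> u" "0 \<le> v" "u + v = 1"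
  have "0 < x \<bullet> ((u *\<^sub>R A + v *\<^sub>R B) *v x)" if "x \<noteq> 0" for x
  proof -
    have "0 < x \<bullet> (A *v x)" "0 < x \<bullet> (B *v x)" using AB that by (auto simp: pos_def_def)
    moreover have "x \<bullet> ((u *\<^sub>R A + v *\<^sub>R B) *v x) = u * (x \<bullet> (A *v x)) + v * (x \<bullet> (B *v x))"
      by (simp add: matrix_vector_mult_add_rdistrib inner_add_right scaleR_matrix_vector_assoc[symmetric])
    moreover have "u > 0 \<or> v > 0" using uv by auto
    ultimately show ?thesis
      using uv by (metis add_nonneg_pos add_pos_nonneg less_imp_le mult_nonneg_nonneg mult_pos_pos)
  qed
  moreover have "transpose (u *\<^sub>R A + v *\<^sub>R B) = u *\<^sub>R A + v *\<^sub>R B"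
    using AB by (auto simp: pos_def_def transpose_def vec_eq_iff)
  ultimately show "pos_def (u *\<^sub>R A + v *\<^sub>R B)" by (simp add: pos_def_def)
qed

lemma outer_mult_vec: "outer v w *v x = (w \<bullet> x) *\<^sub>R v"
  by (simp add: vec_eq_iff outer_def matrix_vector_mult_def inner_vec_def sum_distrib_left ac_simps)

lemma transpose_outer: "transpose (outer v w) = outer w v"
  by (simp add: vec_eq_iff outer_def transpose_def)

lemma transpose_diff: "transpose (A - B) = transpose A - transpose (B::real^'n^'m)"
  by (simp add: vec_eq_iff transpose_def)

lemma transpose_scaleR: "transpose (c *\<^sub>R A) = c *\<^sub>R transpose (A::real^'n^'m)"
  by (simp add: vec_eq_iff transpose_def)

lemma transpose_sum: "transpose (\<Sum>k\<in>I. f k) = (\<Sum>k\<in>I. transpose (f k::real^'n^'m))"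
  by (simp add: vec_eq_iff transpose_def)

text \<open>Cholesky elimination: subtracting the outer square of a column clears one more diagonal entry.\<close>

lemma psd_sum_outer:
  fixes A :: "real^'n^'n"
  assumes "transpose A = A" "\<And>x. 0 \<le> x \<bullet> (A *v x)"
  shows "\<exists>(N::nat) v. A = (\<Sum>k<N. outer (v k) (v k))"
  using assms
\<comment> \<open>Elimination at \<open>i\<close> clears that diagonal entry, and since the
  remainder stays semidefinite it creates no new nonzero one.\<close>
proof (induction "card {i. A $ i $ i \<noteq> 0}" arbitrary: A rule: less_induct)
  case less
  have Aaxis: "axis i 1 \<bullet> (A *v axis j 1) = A $ i $ j" for i j
    by (simp add: inner_axis' matrix_vector_mult_basis column_def)
  have expand: "(x + t *\<^sub>R y) \<bullet> (A *v (x + t *\<^sub>R y)) =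
      x \<bullet> (A *v x) + 2 * t * (x \<bullet> (A *v y)) + t\<^sup>2 * (y \<bullet> (A *v y))" for x y t
    by (simp add: matrix_vector_right_distrib inner_add_left inner_add_right matrix_vector_mult_scaleR
        inner_symmetric[OF less.prems(1), of y x] power2_eq_square algebra_simps)
  show ?case
  proof (cases "\<exists>i. A $ i $ i \<noteq> 0")
    case False
    \<comment> \<open>With zero diagonal the form takes the values \<open>2 * A $ i $ j\<close> and
      \<open>- 2 * A $ i $ j\<close> at e_i + e_j and e_i - e_j; both are nonnegative.\<close>
    have "A $ i $ j = 0" for i j
      using less.prems(2)[of "axis i 1 + 1 *\<^sub>R axis j 1"] less.prems(2)[of "axis i 1 + (-1) *\<^sub>R axis j 1"] False
      unfolding expand Aaxis by simp
    then have "A = (\<Sum>k<(0::nat). outer 0 0)"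
      by (simp add: vec_eq_iff)
    then show ?thesis by (intro exI[of _ 0]) simp
  next
    case True
    then obtain i where i: "A $ i $ i \<noteq> 0" by blast
    define d where "d = A $ i $ i"
    have d: "d > 0"
      using less.prems(2)[of "axis i 1"] i by (simp add: Aaxis d_def)
    define u where "u = A *v axis i 1"
    have u: "u $ j = A $ j $ i" for j
      by (simp add: u_def matrix_vector_mult_basis column_def)
    define A' where "A' = A - outer ((1 / sqrt d) *\<^sub>R u) ((1 / sqrt d) *\<^sub>R u)"
    have outer: "outer ((1 / sqrt d) *\<^sub>R u) ((1 / sqrt d) *\<^sub>R u) $ j $ k = u $ j * u $ k / d" for j k
      using d by (simp add: outer_def)
    have ui: "axis i 1 \<bullet> u = d"
      by (simp add: u_def Aaxis d_def)
    have sym: "transpose A' = A'"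
      by (simp add: A'_def transpose_diff transpose_outer less.prems(1))
    have psd: "0 \<le> x \<bullet> (A' *v x)" for x
    proof -
      have "x \<bullet> (A' *v x) = x \<bullet> (A *v x) - (x \<bullet> u)\<^sup>2 / d"
        using d by (simp add: A'_def matrix_vector_mult_diff_rdistrib outer_mult_vec inner_diff_right
          inner_commute power2_eq_square)
      \<comment> \<open>Completing the square: the shift along \<open>axis i 1\<close> is the one
        that minimizes the form of \<open>A\<close> in that direction.\<close>
      also have "\<dots> = (x + (- (x \<bullet> u) / d) *\<^sub>R axis i 1) \<bullet> (A *v (x + (- (x \<bullet> u) / d) *\<^sub>R axis i 1))"
        unfolding expand Aaxis d_def[symmetric] u_def[symmetric]
        using d ui by (simp add: field_simps power2_eq_square)
      finally show ?thesis using less.prems(2) by simp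
    qed
    have "{j. A' $ j $ j \<noteq> 0} \<subset> {j. A $ j $ j \<noteq> 0}"
    proof
      show "{j. A' $ j $ j \<noteq> 0} \<subseteq> {j. A $ j $ j \<noteq> 0}"
      proof safe
        fix j assume j: "A' $ j $ j \<noteq> 0" "A $ j $ j = 0"
        have "A' $ j $ j \<ge> 0"
          using psd[of "axis j 1"] by (simp add: inner_axis' matrix_vector_mult_basis column_def)
        moreover have "A' $ j $ j = - (u $ j * u $ j / d)"
          using j by (simp add: A'_def outer)
        ultimately show False using d j(1)
          by (metis divide_nonneg_pos neg_0_le_iff_le order_antisym zero_le_square neg_equal_0_iff_equal)
      qed
      have "A' $ i $ i = 0"
        using d by (simp add: A'_def outer u d_def[symmetric])
      with i show "{j. A' $ j $ j \<noteq> 0} \<noteq> {j. A $ j $ j \<noteq> 0}" by blast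
    qed
    then have "card {j. A' $ j $ j \<noteq> 0} < card {j. A $ j $ j \<noteq> 0}"
      by (intro psubset_card_mono) auto
    from less.hyps[OF this sym psd] obtain N v where v: "A' = (\<Sum>k<(N::nat). outer (v k) (v k))"
      by blast
    let ?w = "\<lambda>k. if k < N then v k else (1 / sqrt d) *\<^sub>R u"
    have "A = (\<Sum>k<Suc N. outer (?w k) (?w k))"
      using v by (simp add: A'_def algebra_simps)
    then show ?thesis by (intro exI[of _ "Suc N"] exI[of _ ?w])
  qed
qed

lemma matrix_add_rdistrib: "(A + B) ** C = A ** C + B ** (C::real^'k^'n)"
  by (simp add: matrix_matrix_mult_def vec_eq_iff sum.distrib algebra_simps)

lemma matrix_sum_left: "(\<Sum>k\<in>I. f k) ** B = (\<Sum>k\<in>I. f k ** (B::real^'k^'n))"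
  for f :: "_ \<Rightarrow> real^'n^'m"
  by (induction I rule: infinite_finite_induct) (simp_all add: matrix_add_rdistrib)

lemma matrix_sum_right: "(B::real^'n^'m) ** (\<Sum>k\<in>I. f k) = (\<Sum>k\<in>I. B ** (f k::real^'k^'n))"
  by (induction I rule: infinite_finite_induct) (simp_all add: matrix_add_ldistrib)

lemma outer_sandwich: "outer v v ** D ** outer w w = (v \<bullet> (D *v w)) *\<^sub>R outer v w"
proof -
  have "outer v v ** D ** outer w w *v x = (v \<bullet> (D *v w)) *\<^sub>R outer v w *v x" for x
    by (simp add: matrix_vector_mul_assoc[symmetric] outer_mult_vec matrix_vector_mult_scaleR
        scaleR_matrix_vector_assoc[symmetric])
  then show ?thesis by (simp add: matrix_eq)
qed

lemma inner_outer: "D \<bullet> outer v w = v \<bullet> (D *v w)"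
  by (simp add: inner_vec_def outer_def matrix_vector_mult_def sum_distrib_left ac_simps)

text \<open>Writing the inverse as a sum of outer squares of vectors v_k turns the expression into
  the sum of the squares of v_k . D v_l. If all of them vanish, then
  \<open>matrix_inv A ** D ** matrix_inv A\<close> is 0 and multiplying by \<open>A\<close> on both
  sides gives D = 0.\<close>

lemma sandwich_pos:
  fixes A D :: "real^'n^'n"
  assumes "pos_def A" "D \<noteq> 0"
  shows "0 < D \<bullet> (matrix_inv A ** D ** matrix_inv A)"
proof -
  let ?N = "matrix_inv A"
  note inv = pos_def_invertible[OF assms(1)] and N = pos_def_matrix_inv[OF assms(1)]
  have "0 \<le> x \<bullet> (?N *v x)" for x
    using N by (cases "x = 0") (auto simp: pos_def_def less_imp_le)
  then obtain n v where v: "?N = (\<Sum>k<(n::nat). outer (v k) (v k))"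
    using psd_sum_outer[of ?N] N by (auto simp: pos_def_def)
  have NDN: "?N ** D ** ?N = (\<Sum>k<n. \<Sum>l<n. (v k \<bullet> (D *v v l)) *\<^sub>R outer (v k) (v l))"
    unfolding v by (simp add: matrix_sum_left matrix_sum_right outer_sandwich del: sum.lessThan_Suc)
      (rule sum.swap)
  have eq: "D \<bullet> (?N ** D ** ?N) = (\<Sum>k<n. \<Sum>l<n. (v k \<bullet> (D *v v l))\<^sup>2)"
    by (simp add: NDN inner_sum_right inner_outer power2_eq_square)
  have "D \<bullet> (?N ** D ** ?N) \<noteq> 0"
  proof
    assume "D \<bullet> (?N ** D ** ?N) = 0"
    then have "\<forall>k\<in>{..<n}. \<forall>l\<in>{..<n}. v k \<bullet> (D *v v l) = 0"
      by (simp add: eq sum_nonneg_eq_0_iff sum_nonneg)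
    then have "?N ** D ** ?N = 0"
      by (simp add: NDN)
    then have "A ** (?N ** D ** ?N) ** A = 0"
      by (simp add: matrix_matrix_mult_def zero_vec_def)
    then have "(A ** ?N) ** D ** (?N ** A) = 0"
      by (simp only: matrix_mul_assoc)
    then show False
      using assms(2) by (simp add: matrix_inv_works[OF inv])
  qed
  moreover have "0 \<le> D \<bullet> (?N ** D ** ?N)"
    unfolding eq by (intro sum_nonneg) auto
  ultimately show ?thesis by simp
qed

section \<open>Half-vectorization\<close>

text \<open>Takes symmetric values only. In these coordinates the positive definite matrices become
  an open subset of a Euclidean space.\<close>

definition unvech :: "real^('a::finite uprod) \<Rightarrow> real^'a^'a" where
  "unvech x = (\<chi> i j. x $ Upair i j)"

lemma unvech_symmetric: "transpose (unvech x) = unvech x"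
proof -
  have "Upair j i = Upair i j" for i j :: 'a by simp
  then show ?thesis
    by (simp only: unvech_def transpose_def vec_eq_iff vec_lambda_beta) simp
qed

lemma vech_unvech [simp]: "vech (unvech x) = x"
proof -
  have "vech (unvech x) $ u = x $ u" for u
    by (cases u) (simp add: vech_nth[OF unvech_symmetric], simp add: unvech_def)
  then show ?thesis by (simp add: vec_eq_iff)
qed

lemma unvech_vech: "transpose A = A \<Longrightarrow> unvech (vech A) = A"
  by (simp add: vec_eq_iff unvech_def vech_nth)

lemma linear_unvech: "linear unvech"
  by (rule linearI) (simp_all add: unvech_def vec_eq_iff)

lemma linear_vech: "linear vech"
  by (rule linearI) (simp_all add: vech_def Let_def vec_eq_iff)

lemma inj_unvech: "inj unvech"
  by (metis injI vech_unvech)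

lemma unvech_eq_0_iff: "unvech x = 0 \<longleftrightarrow> x = 0"
  by (metis inj_unvech linear_unvech linear_injective_0 linear_0)

lemma continuous_on_unvech: "continuous_on S f \<Longrightarrow> continuous_on S (\<lambda>x. unvech (f x))"
  by (rule bounded_linear.continuous_on[OF linear_unvech[unfolded linear_conv_bounded_linear]])

text \<open>\<open>pos_def\<close> contains symmetry, so openness holds in half-vectorized
  coordinates but in general not among all matrices. The minimum \<open>c\<close> of the form over
  the unit sphere is positive, and a perturbation of norm below \<open>c\<close> changes the form
  there by less than \<open>c\<close>, because \<open>outer v v\<close> has norm 1 for a unit vector
  \<open>v\<close>.\<close>

lemma open_pos_def_unvech: "open {x :: real^('a::finite uprod). pos_def (unvech x)}"
  unfolding open_dist mem_Collect_eq
proof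
  fix x :: "real^('a uprod)" assume "x \<in> {x. pos_def (unvech x)}"
  then have x: "pos_def (unvech x)" by simp
  let ?S = "sphere 0 1 :: (real^'a) set"
  have "compact ?S" by simp
  moreover have "?S \<noteq> {}" using vector_choose_size[of 1] by (auto simp: sphere_def)
  moreover have "continuous_on ?S (\<lambda>v. v \<bullet> (unvech x *v v))"
    by (intro continuous_intros matrix_vector_mult_linear_continuous_on)
  ultimately obtain v0 where v0: "v0 \<in> ?S" "\<And>v. v \<in> ?S \<Longrightarrow> v0 \<bullet> (unvech x *v v0) \<le> v \<bullet> (unvech x *v v)"
    by (meson continuous_attains_inf)
  define c where "c = v0 \<bullet> (unvech x *v v0)"
  have "c > 0"
    using x v0(1) unfolding c_def pos_def_def by (metis mem_sphere_0 norm_zero zero_neq_one)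
  obtain B where B: "B > 0" "\<And>y. norm (unvech y :: real^'a^'a) \<le> B * norm y"
    using linear_bounded_pos[OF linear_unvech] by auto
  have "pos_def (unvech y)" if y: "y \<in> ball x (c / B)" for y
  proof -
    have small: "norm (unvech (y - x) :: real^'a^'a) < c"
      using B(2)[of "y - x"] y B(1) by (simp add: dist_norm norm_minus_commute field_simps)
    have unit: "0 < v \<bullet> (unvech y *v v)" if "norm v = 1" for v
    proof -
      have "unvech y = unvech x + unvech (y - x)"
        by (simp add: linear_diff[OF linear_unvech])
      then have "v \<bullet> (unvech y *v v) = v \<bullet> (unvech x *v v) + unvech (y - x) \<bullet> outer v v"
        by (simp add: matrix_vector_mult_add_rdistrib inner_add_right inner_outer)
      moreover have "c \<le> v \<bullet> (unvech x *v v)"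
        using v0(2)[of v] that by (simp add: c_def)
      moreover have "norm (outer v v) = 1"
        using that by (simp add: norm_eq_sqrt_inner inner_outer outer_mult_vec)
      then have "\<bar>unvech (y - x) \<bullet> outer v v\<bar> < c"
        using Cauchy_Schwarz_ineq2[of "unvech (y - x)" "outer v v"] small by simp
      ultimately show ?thesis by linarith
    qed
    have "0 < v \<bullet> (unvech y *v v)" if "v \<noteq> 0" for v
    proof -
      have "v \<bullet> (unvech y *v v) = (norm v)\<^sup>2 * (sgn v \<bullet> (unvech y *v sgn v))"
        using that by (simp add: sgn_div_norm matrix_vector_mult_scaleR power2_eq_square field_simps)
      then show ?thesis
        using unit[of "sgn v"] that by (simp add: norm_sgn)
    qed
    then show ?thesis by (simp add: pos_def_def unvech_symmetric)
  qed
  then show "\<exists>e>0. \<forall>y. dist y x < e \<longrightarrow> pos_def (unvech y)"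
    using \<open>c > 0\<close> B(1) by (intro exI[of _ "c / B"]) (simp add: dist_commute)
qed

section \<open>The contrast as a quadratic form\<close>

abbreviation pd_set :: "(real^('a::finite uprod)) set" where
  "pd_set \<equiv> {x. pos_def (unvech x)}"

lemma inner_vectorize: "vectorize A \<bullet> vectorize B = A \<bullet> B"
proof -
  have "vectorize A \<bullet> vectorize B = (\<Sum>(j, i)\<in>UNIV \<times> UNIV. A $ i $ j * B $ i $ j)"
    by (simp add: inner_vec_def vectorize_def case_prod_unfold)
  also have "\<dots> = (\<Sum>j\<in>UNIV. \<Sum>i\<in>UNIV. A $ i $ j * B $ i $ j)"
    by (simp only: sum.cartesian_product)
  also have "\<dots> = A \<bullet> B"
    by (subst sum.swap) (simp add: inner_vec_def)
  finally show ?thesis .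
qed

text \<open>The classical rule for vec (N D N^T), in the (column, row) order of indices that
  \<open>vectorize\<close> uses.\<close>

lemma kron_vectorize:
  fixes N D :: "real^'n^'n"
  shows "kron N N *v vectorize D = vectorize (N ** D ** transpose N)"
proof -
  have "(kron N N *v vectorize D) $ (a, b) = vectorize (N ** D ** transpose N) $ (a, b)" for a b
  proof -
    have "(kron N N *v vectorize D) $ (a, b) =
        (\<Sum>(c, d)\<in>UNIV \<times> UNIV. N $ a $ c * N $ b $ d * D $ d $ c)"
      by (simp add: matrix_vector_mult_def kron_def vectorize_def case_prod_unfold)
    also have "\<dots> = (\<Sum>c\<in>UNIV. \<Sum>d\<in>UNIV. N $ a $ c * N $ b $ d * D $ d $ c)"
      by (simp only: sum.cartesian_product)
    also have "\<dots> = vectorize (N ** D ** transpose N) $ (a, b)"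
      by (simp add: vectorize_def matrix_matrix_mult_def transpose_def sum_distrib_left sum_distrib_right ac_simps)
    finally show ?thesis .
  qed
  then show ?thesis by (simp add: vec_eq_iff)
qed

text \<open>The integrand of \<open>V_mat\<close> in half-vectorized coordinates, with all four
  variables as arguments, so that continuity can be asserted jointly and both parameter integrals
  inherit it.\<close>

definition segment_kernel ::
  "(real^('a::finite uprod)) \<Rightarrow> real^('a uprod) \<Rightarrow> real \<Rightarrow> real \<Rightarrow> real^('a \<times> 'a)^('a \<times> 'a)" where
  "segment_kernel x y l2 l1 =
     l2 *\<^sub>R kron (matrix_inv (unvech y + (l1 * l2) *\<^sub>R (unvech x - unvech y)))
                (matrix_inv (unvech y + (l1 * l2) *\<^sub>R (unvech x - unvech y)))"

lemma pos_def_segment: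
  assumes "x \<in> pd_set" "y \<in> pd_set" "s \<in> {0..1}"
  shows "pos_def (unvech y + s *\<^sub>R (unvech x - unvech y))"
proof -
  have "(1 - s) *\<^sub>R unvech y + s *\<^sub>R unvech x \<in> {A. pos_def A}"
    using assms by (intro convexD[OF convex_pos_def]) auto
  then show ?thesis by (simp add: algebra_simps)
qed

lemma continuous_on_kron:
  assumes "continuous_on S f" "continuous_on S g"
  shows "continuous_on S (\<lambda>x. kron (f x) (g x))"
  unfolding kron_def using assms
  by (intro continuous_on_vec_lambda continuous_on_mult continuous_on_component)

lemma continuous_on_segment_kernel:
  "continuous_on (((pd_set \<times> pd_set) \<times> {0..1}) \<times> {0..1})
     (\<lambda>(((x, y), l2), l1). segment_kernel x y l2 l1)"
proof -
  have "l1 * l2 \<in> {0..1}" if "l1 \<in> {0..1}" "l2 \<in> {0..1}" for l1 l2 :: real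
    using that by (auto simp: mult_le_one)
  then show ?thesis
    unfolding segment_kernel_def case_prod_unfold
    by (intro continuous_intros continuous_on_kron continuous_on_matrix_inv continuous_on_unvech)
       (auto intro!: pos_def_invertible pos_def_segment simp: mem_Times_iff)
qed

lemma V_mat_unvech:
  "V_mat (unvech x) (unvech y) = transpose duplication_matrix **
     integral {0..1} (\<lambda>l2. integral {0..1} (segment_kernel x y l2)) ** duplication_matrix"
  unfolding V_mat_def segment_kernel_def ..

lemma continuous_on_segment_kernel_integral:
  "continuous_on ((pd_set \<times> pd_set) \<times> {0..1})
     (\<lambda>((x, y), l2). integral {0..1} (segment_kernel x y l2))"
  using integral_continuous_on_param[of "(pd_set \<times> pd_set) \<times> {0..1}" 0 "1::real"
      "\<lambda>((x, y), l2). segment_kernel x y l2"] continuous_on_segment_kernel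
  by (simp add: case_prod_unfold)

lemma continuous_on_matrix_mult:
  fixes f :: "'a::topological_space \<Rightarrow> real^'n^'m" and g :: "'a \<Rightarrow> real^'k^'n"
  assumes "continuous_on S f" "continuous_on S g"
  shows "continuous_on S (\<lambda>x. f x ** g x)"
  unfolding matrix_matrix_mult_def using assms
  by (intro continuous_on_vec_lambda continuous_on_sum continuous_on_mult continuous_on_component)

lemma continuous_on_V_mat:
  "continuous_on (pd_set \<times> pd_set) (\<lambda>(x, y). V_mat (unvech x) (unvech y))"
proof -
  have "continuous_on (pd_set \<times> pd_set)
      (\<lambda>(x, y). integral {0..1} (\<lambda>l2. integral {0..1} (segment_kernel x y l2)))"
    using integral_continuous_on_param[of "pd_set \<times> pd_set" 0 "1::real"
      "\<lambda>(x, y) l2. integral {0..1} (segment_kernel x y l2)"] continuous_on_segment_kernel_integral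
    by (simp add: case_prod_unfold)
  then show ?thesis
    unfolding V_mat_unvech case_prod_unfold
    by (intro continuous_on_matrix_mult continuous_on_const)
qed

lemma duplication_mult: "duplication_matrix *v v = vectorize (unvech v)"
  using vectorize_eq_duplication_vech[OF unvech_symmetric, of v] by simp

text \<open>Evaluating the form at a fixed vector is a bounded linear functional of the matrix, so
  it passes through both integrals. Since \<open>l1 * l2\<close> stays in the unit interval, every
  matrix met is positive definite, and \<open>kron_vectorize\<close> rewrites the integrand. The
  continuity claims allow the integrals to be compared afterwards.\<close>

lemma V_mat_quadratic_form:
  assumes x: "x \<in> pd_set" and y: "y \<in> pd_set"
  defines "N \<equiv> \<lambda>s. matrix_inv (unvech y + s *\<^sub>R (unvech x - unvech y))"
  shows "v \<bullet> (V_mat (unvech x) (unvech y) *v v) = integral {0..1} (\<lambda>l2. integral {0..1} (\<lambda>l1.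
      l2 * (unvech v \<bullet> (N (l1 * l2) ** unvech v ** N (l1 * l2)))))" (is "_ = integral _ (\<lambda>l2. integral _ (?f l2))")
    and "continuous_on {0..1} (\<lambda>l2. integral {0..1} (\<lambda>l1.
      l2 * (unvech v \<bullet> (N (l1 * l2) ** unvech v ** N (l1 * l2)))))"
    and "\<And>l2. l2 \<in> {0..1} \<Longrightarrow> continuous_on {0..1} (\<lambda>l1.
      l2 * (unvech v \<bullet> (N (l1 * l2) ** unvech v ** N (l1 * l2))))"
    and "continuous_on {0..1} (\<lambda>s. unvech v \<bullet> (N s ** unvech v ** N s))"
proof -
  define h where "h K = vectorize (unvech v) \<bullet> (K *v vectorize (unvech v))" for K :: "real^('a \<times> 'a)^('a \<times> 'a)"
  have h: "bounded_linear h"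
    unfolding h_def linear_conv_bounded_linear[symmetric]
    by (rule linearI) (simp_all add: matrix_vector_mult_add_rdistrib inner_add_right
      scaleR_matrix_vector_assoc[symmetric])
  have hV: "v \<bullet> (V_mat (unvech x) (unvech y) *v v) =
      h (integral {0..1} (\<lambda>l2. integral {0..1} (segment_kernel x y l2)))"
    unfolding V_mat_unvech h_def duplication_mult[symmetric]
    by (simp add: matrix_vector_mul_assoc[symmetric]) (metis dot_lmul_matrix inner_commute)
  have unit: "l1 * l2 \<in> {0..1}" if "l1 \<in> {0..1}" "l2 \<in> {0..1}" for l1 l2 :: real
    using that by (auto simp: mult_le_one)
  have hk: "h (segment_kernel x y l2 l1) = ?f l2 l1" if "l1 \<in> {0..1}" "l2 \<in> {0..1}" for l1 l2
  proof -
    have pd: "pos_def (unvech y + (l1 * l2) *\<^sub>R (unvech x - unvech y))"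
      by (rule pos_def_segment[OF x y unit[OF that]])
    have "transpose (N (l1 * l2)) = N (l1 * l2)"
      unfolding N_def using pd by (intro symmetric_matrix_inv pos_def_invertible) (auto simp: pos_def_def)
    moreover have "matrix_inv (unvech y + (l1 * l2) *\<^sub>R (unvech x - unvech y)) = N (l1 * l2)"
      by (simp add: N_def)
    ultimately show ?thesis
      by (simp add: h_def segment_kernel_def scaleR_matrix_vector_assoc[symmetric]
        kron_vectorize inner_vectorize)
  qed
  have cont: "continuous_on (({(x, y)} \<times> {0..1}) \<times> {0..1}) (\<lambda>(((x, y), l2), l1). segment_kernel x y l2 l1)"
    by (rule continuous_on_subset[OF continuous_on_segment_kernel]) (use x y in auto)
  have cont1: "continuous_on {0..1} (\<lambda>l1. segment_kernel x y l2 l1)" if "l2 \<in> {0..1}" for l2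
    by (rule continuous_on_compose2[OF cont, of _ "\<lambda>l1. (((x, y), l2), l1)", simplified])
       (use that in \<open>auto intro!: continuous_intros\<close>)
  have cont2: "continuous_on {0..1} (\<lambda>l2. integral {0..1} (segment_kernel x y l2))"
    by (rule continuous_on_compose2[OF continuous_on_segment_kernel_integral,
        of _ "\<lambda>l2. ((x, y), l2)", simplified])
       (use x y in \<open>auto intro!: continuous_intros\<close>)
  have inner: "h (integral {0..1} (segment_kernel x y l2)) = integral {0..1} (?f l2)" if "l2 \<in> {0..1}" for l2
  proof -
    have "h (integral {0..1} (segment_kernel x y l2)) = integral {0..1} (h \<circ> segment_kernel x y l2)"
      by (rule integral_linear[OF integrable_continuous_interval[OF cont1[OF that]] h, symmetric])
    also have "\<dots> = integral {0..1} (?f l2)"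
      using that by (intro integral_cong) (simp add: hk)
    finally show ?thesis .
  qed
  have "h (integral {0..1} (\<lambda>l2. integral {0..1} (segment_kernel x y l2))) =
      integral {0..1} (h \<circ> (\<lambda>l2. integral {0..1} (segment_kernel x y l2)))"
    by (rule integral_linear[OF integrable_continuous_interval[OF cont2] h, symmetric])
  also have "\<dots> = integral {0..1} (\<lambda>l2. integral {0..1} (?f l2))"
    by (intro integral_cong) (simp add: inner)
  finally show "v \<bullet> (V_mat (unvech x) (unvech y) *v v) = integral {0..1} (\<lambda>l2. integral {0..1} (?f l2))"
    by (simp add: hV)
  show "continuous_on {0..1} (\<lambda>l2. integral {0..1} (?f l2))"
    by (rule continuous_on_eq[OF bounded_linear.continuous_on[OF h cont2]]) (simp add: inner)
  show "continuous_on {0..1} (?f l2)" if "l2 \<in> {0..1}" for l2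
    by (rule continuous_on_eq[OF bounded_linear.continuous_on[OF h cont1[OF that]]]) (rule hk[OF _ that])
  show "continuous_on {0..1} (\<lambda>s. unvech v \<bullet> (N s ** unvech v ** N s))"
    unfolding N_def
    by (intro continuous_intros continuous_on_matrix_mult continuous_on_matrix_inv
        pos_def_invertible pos_def_segment[OF x y])
qed

text \<open>On the segment between the two matrices the sandwiched form \<open>q\<close> has a
  positive minimum \<open>q s0\<close>; the double integral is at least the integral of
  \<open>l2 * q s0\<close>, which is \<open>q s0 / 2\<close>.\<close>

lemma V_mat_pos:
  assumes x: "x \<in> pd_set" and y: "y \<in> pd_set" and "v \<noteq> 0"
  shows "0 < v \<bullet> (V_mat (unvech x) (unvech y) *v v)"
proof -
  define N where "N s = matrix_inv (unvech y + s *\<^sub>R (unvech x - unvech y))" for s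
  define q where "q s = unvech v \<bullet> (N s ** unvech v ** N s)" for s
  note Q = V_mat_quadratic_form[OF x y, where v = v, folded N_def q_def]
  have "0 < q s" if "s \<in> {0..1}" for s
    unfolding q_def N_def using \<open>v \<noteq> 0\<close>
    by (intro sandwich_pos pos_def_segment[OF x y that]) (simp add: unvech_eq_0_iff)
  moreover obtain s0 where s0: "s0 \<in> {0..1}" "\<And>s. s \<in> {0..1} \<Longrightarrow> q s0 \<le> q s"
    using continuous_attains_inf[OF _ _ Q(4)] by auto
  ultimately have c: "q s0 > 0" by blast
  have le: "l2 * q s0 \<le> integral {0..1} (\<lambda>l1. l2 * q (l1 * l2))" if l2: "l2 \<in> {0..1}" for l2
  proof -
    have "integral {0..1} (\<lambda>l1::real. l2 * q s0) \<le> integral {0..1} (\<lambda>l1. l2 * q (l1 * l2))"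
      using l2 by (intro integral_le integrable_continuous_interval Q(3))
        (auto intro!: mult_left_mono s0(2) mult_le_one)
    then show ?thesis by simp
  qed
  have "integral {0..1} (\<lambda>l2. l2 * q s0) \<le>
      integral {0..1} (\<lambda>l2. integral {0..1} (\<lambda>l1. l2 * q (l1 * l2)))"
    by (intro integral_le integrable_continuous_interval Q(2) le continuous_intros)
  moreover have "((\<lambda>l2. l2 * q s0) has_integral (1\<^sup>2 / 2 * q s0 - 0\<^sup>2 / 2 * q s0)) {0..1}"
    by (rule fundamental_theorem_of_calculus)
       (auto intro!: derivative_eq_intros simp: has_real_derivative_iff_has_vector_derivative[symmetric])
  then have "integral {0..1} (\<lambda>l2. l2 * q s0) = q s0 / 2"
    by (simp add: integral_unique)
  ultimately show ?thesis using c by (simp add: Q(1))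
qed

text \<open>For equal arguments the segment is a point and only the weight \<open>l2\<close> is
  integrated. This is the origin of the factor 1/2 in the limiting quadratic form.\<close>

lemma V_mat_diagonal:
  assumes x: "x \<in> pd_set"
  shows "v \<bullet> (V_mat (unvech x) (unvech x) *v v) =
    (unvech v \<bullet> (matrix_inv (unvech x) ** unvech v ** matrix_inv (unvech x))) / 2"
proof -
  define c where "c = unvech v \<bullet> (matrix_inv (unvech x) ** unvech v ** matrix_inv (unvech x))"
  have "((\<lambda>l2. l2 * c) has_integral (1\<^sup>2 / 2 * c - 0\<^sup>2 / 2 * c)) {0..1}"
    by (rule fundamental_theorem_of_calculus)
       (auto intro!: derivative_eq_intros simp: has_real_derivative_iff_has_vector_derivative[symmetric])
  then have "integral {0..1} (\<lambda>l2. l2 * c) = c / 2"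
    by (simp add: integral_unique)
  then show ?thesis
    by (simp add: V_mat_quadratic_form(1)[OF x x] c_def[symmetric])
qed

lemma contrast_unvech:
  "contrast (unvech x) (unvech y) = (x - y) \<bullet> (V_tilde (unvech x) (unvech y) *v (x - y))"
  by (simp add: contrast_def)

lemma contrast_pd:
  "x \<in> pd_set \<Longrightarrow> contrast (unvech x) (unvech y) = (x - y) \<bullet> (V_mat (unvech x) (unvech y) *v (x - y))"
  by (simp add: contrast_unvech V_tilde_def pos_def_invertible)

lemma quadratic_sgn:
  fixes A :: "real^'n^'n"
  assumes "v \<noteq> 0"
  shows "(sgn v \<bullet> (A *v sgn v)) * (norm v)\<^sup>2 = v \<bullet> (A *v v)"
  using assms by (simp add: sgn_div_norm matrix_vector_mult_scaleR power2_eq_square field_simps)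

lemma matrix_quadratic_bound:
  fixes A :: "real^'n^'n"
  shows "\<bar>v \<bullet> (A *v v)\<bar> \<le> norm A * (norm v)\<^sup>2"
proof -
  have "norm (outer v v) = (norm v)\<^sup>2"
    by (simp add: norm_eq_sqrt_inner[of "outer v v"] inner_outer outer_mult_vec power2_norm_eq_inner)
  then show ?thesis
    using Cauchy_Schwarz_ineq2[of A "outer v v"] by (simp add: inner_outer)
qed

text \<open>By continuity the matrices of the form at (x, y) and at (x0, x0) differ by less than
  \<open>e\<close> near x0. The error is relative to |x - y|^2, so at distances of order 1 / sqrt n
  it stays small even after multiplication by n.\<close>

lemma contrast_local:
  fixes x0 :: "real^('a::finite uprod)"
  assumes x0: "x0 \<in> pd_set" and "e > 0"
  shows "\<exists>d>0. \<forall>x y. norm (x - x0) < d \<and> norm (y - x0) < d \<longrightarrow>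
    \<bar>contrast (unvech x) (unvech y) - (x - y) \<bullet> (V_mat (unvech x0) (unvech x0) *v (x - y))\<bar> \<le> e * (norm (x - y))\<^sup>2"
proof -
  let ?V = "\<lambda>(x, y). V_mat (unvech x) (unvech y)"
  have "open (pd_set \<times> pd_set :: ((real^('a uprod)) \<times> (real^('a uprod))) set)"
    by (intro open_Times open_pos_def_unvech)
  then have "isCont ?V (x0, x0)"
    using continuous_on_interior[OF continuous_on_V_mat, of "(x0, x0)"] x0 by (simp add: interior_open)
  then obtain d1 where d1: "d1 > 0" "\<And>z. dist z (x0, x0) < d1 \<Longrightarrow> dist (?V z) (?V (x0, x0)) < e"
    using \<open>e > 0\<close> unfolding continuous_at_eps_delta by blast
  obtain d2 where d2: "d2 > 0" "ball x0 d2 \<subseteq> pd_set"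
    using open_pos_def_unvech x0 open_contains_ball by blast
  define d where "d = min (d1 / 2) d2"
  have "\<bar>contrast (unvech x) (unvech y) - (x - y) \<bullet> (V_mat (unvech x0) (unvech x0) *v (x - y))\<bar> \<le> e * (norm (x - y))\<^sup>2"
    if "norm (x - x0) < d" "norm (y - x0) < d" for x y
  proof -
    have x: "x \<in> pd_set" and xy: "norm (x - x0) < d1 / 2" "norm (y - x0) < d1 / 2"
      using that d2(2) by (auto simp: d_def dist_norm norm_minus_commute subset_eq)
    have "dist (x, y) (x0, x0) \<le> dist x x0 + dist y x0"
      unfolding dist_Pair_Pair by (rule sqrt_sum_squares_le_sum) auto
    also have "\<dots> < d1" using xy by (simp add: dist_norm)
    finally have "dist (?V (x, y)) (?V (x0, x0)) < e" by (rule d1(2))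
    then have "norm (?V (x, y) - ?V (x0, x0)) \<le> e"
      by (simp only: dist_norm less_imp_le)
    then have "\<bar>(x - y) \<bullet> ((?V (x, y) - ?V (x0, x0)) *v (x - y))\<bar> \<le> e * (norm (x - y))\<^sup>2"
      by (intro order_trans[OF matrix_quadratic_bound] mult_right_mono) auto
    then show ?thesis
      by (simp add: contrast_pd[OF x] matrix_vector_mult_diff_rdistrib inner_diff_right)
  qed
  moreover have "d > 0" using d1 d2 by (simp add: d_def)
  ultimately show ?thesis by blast
qed

text \<open>The form is positive and continuous on the compact set of all x near x0, all y in
  \<open>S\<close> and all unit vectors, hence bounded below by some c > 0. The bound is global in y
  and is what forces the minimizer towards x0.\<close>

lemma contrast_lower:
  fixes x0 :: "real^('a::finite uprod)"
  assumes x0: "x0 \<in> pd_set" and S: "compact S" "S \<subseteq> pd_set" "S \<noteq> {}"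
  shows "\<exists>c>0. \<exists>d>0. \<forall>x. \<forall>y\<in>S. norm (x - x0) < d \<longrightarrow>
    c * (norm (x - y))\<^sup>2 \<le> contrast (unvech x) (unvech y)"
proof -
  obtain d where d: "d > 0" "cball x0 d \<subseteq> pd_set"
    using open_pos_def_unvech x0 open_contains_cball by blast
  let ?K = "(cball x0 d \<times> S) \<times> (sphere 0 1 :: (real^('a uprod)) set)"
  let ?f = "\<lambda>((x, y), v). v \<bullet> (V_mat (unvech x) (unvech y) *v v)"
  have "continuous_on ?K (\<lambda>z. (\<lambda>(x, y). V_mat (unvech x) (unvech y)) (fst z))"
    by (rule continuous_on_compose2[OF continuous_on_V_mat]) (use d S in \<open>auto intro!: continuous_intros\<close>)
  then have "continuous_on ?K (\<lambda>z. (\<lambda>(x, y). V_mat (unvech x) (unvech y)) (fst z) \<bullet> outer (snd z) (snd z))"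
    unfolding outer_def
    by (intro continuous_intros continuous_on_vec_lambda continuous_on_component)
  then have cont: "continuous_on ?K ?f"
    by (simp add: case_prod_unfold inner_outer)
  have "compact ?K" using S by (intro compact_Times) auto
  moreover have "?K \<noteq> {}"
    using S d vector_choose_size[of 1, where ?'a = "real^('a uprod)"] by fastforce
  ultimately obtain z where z: "z \<in> ?K" "\<And>z'. z' \<in> ?K \<Longrightarrow> ?f z \<le> ?f z'"
    using continuous_attains_inf[OF _ _ cont] by blast
  obtain xz yz vz where zz: "z = ((xz, yz), vz)" by (metis surj_pair)
  define c where "c = ?f z"
  have "vz \<noteq> 0" using z(1) zz by auto
  then have "c > 0"
    using z(1) d S unfolding c_def zz by (auto intro!: V_mat_pos)
  have "c * (norm (x - y))\<^sup>2 \<le> contrast (unvech x) (unvech y)" if "y \<in> S" "norm (x - x0) < d" for x y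
  proof (cases "x = y")
    case True
    then show ?thesis by (simp add: contrast_unvech)
  next
    case False
    have xd: "x \<in> cball x0 d" using that by (simp add: dist_norm norm_minus_commute)
    let ?u = "sgn (x - y)"
    have "((x, y), ?u) \<in> ?K" using xd that False by (simp add: norm_sgn)
    from z(2)[OF this] have "c \<le> ?u \<bullet> (V_mat (unvech x) (unvech y) *v ?u)"
      by (simp add: c_def)
    then have "c * (norm (x - y))\<^sup>2 \<le> (?u \<bullet> (V_mat (unvech x) (unvech y) *v ?u)) * (norm (x - y))\<^sup>2"
      by (intro mult_right_mono) auto
    also have "\<dots> = (x - y) \<bullet> (V_mat (unvech x) (unvech y) *v (x - y))"
      using False by (intro quadratic_sgn) simp
    also have "\<dots> = contrast (unvech x) (unvech y)"
      using xd d by (subst contrast_pd) auto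
    finally show ?thesis .
  qed
  then show ?thesis using \<open>c > 0\<close> d(1) by blast
qed

section \<open>Measurability of the minimal contrast\<close>

text \<open>Half-vectorized realized covariances always lie here, also when they are singular and
  the contrast falls back to the identity matrix.\<close>

definition psd_set :: "(real^('a::finite uprod)) set" where
  "psd_set = {x. \<forall>v. 0 \<le> v \<bullet> (unvech x *v v)}"

text \<open>If the form vanishes at x, so does each summand of the outer square decomposition, hence
  A x = 0. On \<open>psd_set\<close> the case distinction of \<open>V_tilde\<close> is therefore
  membership in the open set \<open>pd_set\<close>, which is Borel.\<close>

lemma psd_invertible:
  fixes A :: "real^'n^'n"
  assumes "transpose A = A" "\<And>x. 0 \<le> x \<bullet> (A *v x)" "invertible A"
  shows "pos_def A"
proof -
  obtain N v where A: "A = (\<Sum>k<(N::nat). outer (v k) (v k))"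
    using psd_sum_outer[OF assms(1,2)] by blast
  have mult: "A *v x = (\<Sum>k<N. (v k \<bullet> x) *\<^sub>R v k)" for x
  proof -
    have "(\<Sum>k\<in>I. outer (v k) (v k)) *v x = (\<Sum>k\<in>I. (v k \<bullet> x) *\<^sub>R v k)" if "finite I" for I
      using that by (induction I) (auto simp: matrix_vector_mult_add_rdistrib outer_mult_vec)
    then show ?thesis unfolding A by simp
  qed
  have "0 < x \<bullet> (A *v x)" if "x \<noteq> 0" for x
  proof (rule ccontr)
    assume "\<not> 0 < x \<bullet> (A *v x)"
    then have "(\<Sum>k<N. (v k \<bullet> x)\<^sup>2) \<le> 0"
      by (simp add: mult inner_sum_right power2_eq_square inner_commute)
    then have "(\<Sum>k<N. (v k \<bullet> x)\<^sup>2) = 0"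
      by (intro antisym sum_nonneg) auto
    then have "\<forall>k\<in>{..<N}. v k \<bullet> x = 0"
      by (subst (asm) sum_nonneg_eq_0_iff) auto
    then have "A *v x = 0" by (simp add: mult)
    then have "matrix_inv A *v (A *v x) = 0" by simp
    then show False
      using that matrix_inv_works[OF assms(3)] by (simp add: matrix_vector_mul_assoc)
  qed
  then show ?thesis using assms(1) by (simp add: pos_def_def)
qed

lemma contrast_psd:
  assumes "x \<in> psd_set"
  shows "contrast (unvech x) (unvech y) =
    (if x \<in> pd_set then (x - y) \<bullet> (V_mat (unvech x) (unvech y) *v (x - y)) else (norm (x - y))\<^sup>2)"
proof (cases "x \<in> pd_set")
  case False
  then have "\<not> invertible (unvech x)"
    using assms psd_invertible[OF unvech_symmetric, of x] by (auto simp: psd_set_def)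
  then show ?thesis
    using False by (simp add: contrast_unvech V_tilde_def power2_norm_eq_inner)
qed (simp add: contrast_pd)

lemma contrast_nonneg:
  assumes "x \<in> psd_set" "y \<in> pd_set"
  shows "0 \<le> contrast (unvech x) (unvech y)"
  using V_mat_pos[of x y "x - y"] assms
  by (cases "x = y") (auto simp: contrast_psd less_imp_le)

lemma continuous_on_V_mat_quadratic:
  assumes "continuous_on S f" "continuous_on S g" "f ` S \<subseteq> pd_set" "g ` S \<subseteq> pd_set"
  shows "continuous_on S (\<lambda>z. (f z - g z) \<bullet> (V_mat (unvech (f z)) (unvech (g z)) *v (f z - g z)))"
proof -
  have "continuous_on S (\<lambda>z. (\<lambda>(x, y). V_mat (unvech x) (unvech y)) (f z, g z))"
    by (rule continuous_on_compose2[OF continuous_on_V_mat]) (use assms in \<open>auto intro!: continuous_intros\<close>)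
  then have "continuous_on S (\<lambda>z. (\<lambda>(x, y). V_mat (unvech x) (unvech y)) (f z, g z) \<bullet> outer (f z - g z) (f z - g z))"
    unfolding outer_def using assms
    by (intro continuous_intros continuous_on_vec_lambda continuous_on_component)
  then show ?thesis by (simp add: inner_outer)
qed

lemma continuous_on_contrast_right:
  assumes "x \<in> psd_set" shows "continuous_on pd_set (\<lambda>y. contrast (unvech x) (unvech y))"
proof (cases "x \<in> pd_set")
  case True
  have "continuous_on pd_set (\<lambda>y. (x - y) \<bullet> (V_mat (unvech x) (unvech y) *v (x - y)))"
    using True by (intro continuous_on_V_mat_quadratic) (auto intro!: continuous_intros)
  then show ?thesis using True assms by (simp add: contrast_psd)
next
  case False
  have "continuous_on pd_set (\<lambda>y. (norm (x - y))\<^sup>2)"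
    by (intro continuous_intros)
  then show ?thesis using False assms by (simp add: contrast_psd)
qed

lemma measurable_contrast_left:
  assumes "X \<in> borel_measurable M" "\<And>\<omega>. \<omega> \<in> space M \<Longrightarrow> X \<omega> \<in> psd_set" "y \<in> pd_set"
  shows "(\<lambda>\<omega>. contrast (unvech (X \<omega>)) (unvech y)) \<in> borel_measurable M"
proof -
  let ?g = "\<lambda>x. if x \<in> pd_set then (x - y) \<bullet> (V_mat (unvech x) (unvech y) *v (x - y)) else (norm (x - y))\<^sup>2"
  have "?g \<in> borel_measurable borel"
    using open_pos_def_unvech assms(3)
    by (intro borel_measurable_continuous_on_if borel_open continuous_on_V_mat_quadratic continuous_intros) auto
  from measurable_compose[OF assms(1) this] show ?thesis
    by (rule measurable_cong[THEN iffD1, rotated]) (simp add: contrast_psd assms(2))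
qed

text \<open>\<open>yhat\<close> may be any selection of minimizers, measurable or not. By continuity
  in the second argument, the minimal value is below a number exactly if the contrast is below it at
  some point of a countable dense subset of \<open>S\<close>.\<close>

lemma measurable_min_contrast:
  fixes X yhat :: "'w \<Rightarrow> real^('a::finite uprod)"
  assumes X: "X \<in> borel_measurable M" "\<And>\<omega>. \<omega> \<in> space M \<Longrightarrow> X \<omega> \<in> psd_set"
    and S: "S \<subseteq> pd_set" and yhat: "\<And>\<omega>. \<omega> \<in> space M \<Longrightarrow> yhat \<omega> \<in> S"
    and min: "\<And>\<omega> y. \<omega> \<in> space M \<Longrightarrow> y \<in> S \<Longrightarrow>
      contrast (unvech (X \<omega>)) (unvech (yhat \<omega>)) \<le> contrast (unvech (X \<omega>)) (unvech y)"
  shows "(\<lambda>\<omega>. contrast (unvech (X \<omega>)) (unvech (yhat \<omega>))) \<in> borel_measurable M"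
proof -
  obtain D where D: "countable D" "D \<subseteq> S" "S \<subseteq> closure D"
    by (rule separable)
  show ?thesis
  proof (rule borel_measurableI_less)
    fix a :: real
    have "{\<omega> \<in> space M. contrast (unvech (X \<omega>)) (unvech (yhat \<omega>)) < a} =
        (\<Union>y\<in>D. {\<omega> \<in> space M. contrast (unvech (X \<omega>)) (unvech y) < a})"
    proof safe
      fix \<omega> assume \<omega>: "\<omega> \<in> space M" and lt: "contrast (unvech (X \<omega>)) (unvech (yhat \<omega>)) < a"
      have "continuous_on S (\<lambda>y. contrast (unvech (X \<omega>)) (unvech y))"
        by (rule continuous_on_subset[OF continuous_on_contrast_right[OF X(2)[OF \<omega>]] S])
      then obtain d where d: "d > 0" "\<And>y. y \<in> S \<Longrightarrow> dist y (yhat \<omega>) < d \<Longrightarrow>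
          dist (contrast (unvech (X \<omega>)) (unvech y)) (contrast (unvech (X \<omega>)) (unvech (yhat \<omega>))) <
            a - contrast (unvech (X \<omega>)) (unvech (yhat \<omega>))"
        using lt yhat[OF \<omega>] unfolding continuous_on_iff by (metis diff_gt_0_iff_gt)
      obtain y where y: "y \<in> D" "dist y (yhat \<omega>) < d"
        using D(3) yhat[OF \<omega>] d(1) by (meson closure_approachable subsetD)
      then have "contrast (unvech (X \<omega>)) (unvech y) < a"
        using d(2)[of y] D(2) by (auto simp: dist_real_def)
      with y \<omega> show "\<omega> \<in> (\<Union>y\<in>D. {\<omega> \<in> space M. contrast (unvech (X \<omega>)) (unvech y) < a})" by auto
    next
      fix \<omega> y assume "\<omega> \<in> space M" "y \<in> D" "contrast (unvech (X \<omega>)) (unvech y) < a"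
      then show "contrast (unvech (X \<omega>)) (unvech (yhat \<omega>)) < a"
        using min[of \<omega> y] D(2) by fastforce
    qed
    also have "\<dots> \<in> sets M"
    proof (intro sets.countable_UN''[OF D(1)])
      fix y assume "y \<in> D"
      then have "(\<lambda>\<omega>. contrast (unvech (X \<omega>)) (unvech y)) \<in> borel_measurable M"
        using S D(2) by (intro measurable_contrast_left X) auto
      then show "{\<omega> \<in> space M. contrast (unvech (X \<omega>)) (unvech y) < a} \<in> sets M"
        by (rule borel_measurable_less) simp
    qed
    finally show "{\<omega> \<in> space M. contrast (unvech (X \<omega>)) (unvech (yhat \<omega>)) < a} \<in> sets M" .
  qed
qed

section \<open>Minimum contrast asymptotics\<close>

lemma norm_square_perturb:
  fixes a c :: "'c::real_inner"
  shows "\<bar>(norm (a - c))\<^sup>2 / 2 - (norm a)\<^sup>2 / 2\<bar> \<le> norm c * (norm a + norm c)"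
proof -
  have "(norm (a - c))\<^sup>2 / 2 - (norm a)\<^sup>2 / 2 = (norm c)\<^sup>2 / 2 - a \<bullet> c"
    by (simp add: power2_norm_eq_inner inner_diff_left inner_diff_right inner_commute field_simps)
  also have "\<bar>\<dots>\<bar> \<le> (norm c)\<^sup>2 / 2 + norm a * norm c"
    using Cauchy_Schwarz_ineq2[of a c] abs_triangle_ineq4[of "(norm c)\<^sup>2 / 2" "a \<bullet> c"] by simp
  finally have "\<bar>(norm (a - c))\<^sup>2 / 2 - (norm a)\<^sup>2 / 2\<bar> \<le> (norm c)\<^sup>2 / 2 + norm a * norm c" .
  also have "\<dots> \<le> norm c * (norm a + norm c)"
    by (simp add: algebra_simps power2_eq_square)
  finally show ?thesis .
qed

text \<open>For |u| at most a multiple of |x - g \<theta>0|, the point g (\<theta>0 + u) may be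
  replaced by its tangent approximation: the remainder is o(|u|) and changes the squared norm by a
  product with a quantity of order |x - g \<theta>0|.\<close>

lemma contrast_along_model:
  fixes g :: "'p::euclidean_space \<Rightarrow> 'x::euclidean_space" and F :: "'x \<Rightarrow> 'x \<Rightarrow> real"
    and \<Psi> :: "'x \<Rightarrow> 'c::euclidean_space"
  assumes der: "(g has_derivative J) (at \<theta>0)" and lin: "linear \<Psi>"
    and loc: "\<And>e. e > 0 \<Longrightarrow> \<exists>d>0. \<forall>x y. norm (x - g \<theta>0) < d \<and> norm (y - g \<theta>0) < d \<longrightarrow>
      \<bar>F x y - (norm (\<Psi> (x - y)))\<^sup>2 / 2\<bar> \<le> e * (norm (x - y))\<^sup>2"
    and \<kappa>: "\<kappa> \<ge> 0" and e: "e > 0"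
  shows "\<exists>d>0. \<forall>x u. norm (x - g \<theta>0) < d \<and> norm u \<le> \<kappa> * norm (x - g \<theta>0) \<longrightarrow>
    \<bar>F x (g (\<theta>0 + u)) - (norm (\<Psi> (x - g \<theta>0 - J u)))\<^sup>2 / 2\<bar> \<le> e * (norm (x - g \<theta>0))\<^sup>2"
proof -
  define x0 where "x0 = g \<theta>0"
  obtain b where b: "b > 0" "\<And>v. norm (\<Psi> v) \<le> b * norm v"
    using linear_bounded_pos[OF lin] by blast
  obtain j where j: "j > 0" "\<And>u. norm (J u) \<le> j * norm u"
    using linear_bounded_pos has_derivative_linear[OF der] by blast
  \<comment> \<open>With \<open>n\<close> the distance of x from x0, \<open>A * n\<close> bounds
    both the distance from x to g (\<theta>0 + u) and that from g (\<theta>0 + u) to x0.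
    \<open>K\<close> collects two errors, \<open>A\<^sup>2\<close> from the local form of F and the
    rest from the linearization.\<close>
  define A where "A = 1 + j * \<kappa> + \<kappa>"
  define K where "K = A\<^sup>2 + b\<^sup>2 * \<kappa> * A"
  have A: "A \<ge> 1" using j(1) \<kappa> by (simp add: A_def)
  have K: "K > 0"
    unfolding K_def using A b(1) \<kappa> by (intro add_pos_nonneg) auto
  define e1 where "e1 = min 1 (e / K)"
  have e1: "0 < e1" "e1 \<le> 1" "e1 * K \<le> e"
    using e K by (auto simp: e1_def min_def field_simps)
  obtain r where r: "r > 0" "\<And>u. norm u < r \<Longrightarrow> norm (g (\<theta>0 + u) - x0 - J u) \<le> e1 * norm u"
  proof -
    obtain r where "r > 0" "\<And>y. norm (y - \<theta>0) < r \<Longrightarrow> norm (g y - g \<theta>0 - J (y - \<theta>0)) \<le> e1 * norm (y - \<theta>0)"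
      using der e1(1) unfolding has_derivative_at_alt by blast
    from this(1) this(2)[of "\<theta>0 + u" for u] show ?thesis
      by (intro that[of r]) (auto simp: x0_def)
  qed
  obtain d1 where d1: "d1 > 0" "\<And>x y. norm (x - x0) < d1 \<Longrightarrow> norm (y - x0) < d1 \<Longrightarrow>
      \<bar>F x y - (norm (\<Psi> (x - y)))\<^sup>2 / 2\<bar> \<le> e1 * (norm (x - y))\<^sup>2"
    using loc[OF e1(1)] unfolding x0_def by blast
  \<comment> \<open>The first bound keeps \<open>u\<close> in the range of the linearization, the
    second keeps both points in the range of the local form.\<close>
  define d where "d = min (r / (\<kappa> + 1)) (d1 / A)"
  have d: "d > 0" using r(1) d1(1) A \<kappa> by (simp add: d_def)
  have "\<bar>F x (g (\<theta>0 + u)) - (norm (\<Psi> (x - x0 - J u)))\<^sup>2 / 2\<bar> \<le> e * (norm (x - x0))\<^sup>2"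
    if x: "norm (x - x0) < d" and u: "norm u \<le> \<kappa> * norm (x - x0)" for x u
  proof -
    define n where "n = norm (x - x0)"
    have n: "n \<ge> 0" "n * (\<kappa> + 1) < r" "n * A < d1"
      using x A \<kappa> by (auto simp: n_def d_def field_simps)
    define \<rho> where "\<rho> = g (\<theta>0 + u) - x0 - J u"
    define w where "w = x - x0 - J u"
    have un: "norm u \<le> \<kappa> * n" using u by (simp add: n_def)
    also have "\<dots> \<le> n * (\<kappa> + 1)" using n(1) by (simp add: algebra_simps)
    finally have "norm \<rho> \<le> e1 * norm u"
      unfolding \<rho>_def using n(2) by (intro r(2)) simp
    also have "\<dots> \<le> e1 * (\<kappa> * n)" using un e1(1) by simp
    finally have \<rho>: "norm \<rho> \<le> e1 * (\<kappa> * n)" .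
    also have "\<dots> \<le> \<kappa> * n" using e1 \<kappa> n(1) by (simp add: mult_left_le_one_le)
    finally have \<rho>': "norm \<rho> \<le> \<kappa> * n" .
    have Ju: "norm (J u) \<le> j * (\<kappa> * n)"
      using j un by (meson less_imp_le mult_left_mono order_trans)
    have w: "norm w \<le> n + j * (\<kappa> * n)"
      unfolding w_def n_def using norm_triangle_ineq4[of "x - x0" "J u"] Ju by (simp add: n_def)
    have wA: "norm w + norm \<rho> \<le> A * n"
      using w \<rho>' by (simp add: A_def algebra_simps)
    have xy: "x - g (\<theta>0 + u) = w - \<rho>"
      by (simp add: w_def \<rho>_def)
    have nA: "norm (x - g (\<theta>0 + u)) \<le> A * n"
      unfolding xy using wA norm_triangle_ineq4[of w \<rho>] by linarith
    have "g (\<theta>0 + u) - x0 = J u + \<rho>" by (simp add: \<rho>_def)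
    then have "norm (g (\<theta>0 + u) - x0) \<le> j * (\<kappa> * n) + \<kappa> * n"
      using Ju \<rho>' norm_triangle_ineq[of "J u" \<rho>] by simp
    also have "\<dots> \<le> n * A" using n(1) by (simp add: A_def algebra_simps)
    finally have y: "norm (g (\<theta>0 + u) - x0) < d1" using n(3) by simp
    have "n \<le> n * A" using n(1) A by (simp add: mult_le_cancel_left1)
    then have "norm (x - x0) < d1" using n by (simp add: n_def)
    from d1(2)[OF this y]
    have 1: "\<bar>F x (g (\<theta>0 + u)) - (norm (\<Psi> (w - \<rho>)))\<^sup>2 / 2\<bar> \<le> e1 * (norm (x - g (\<theta>0 + u)))\<^sup>2"
      by (simp add: xy)
    also have "\<dots> \<le> e1 * (A * n)\<^sup>2"
      using nA e1(1) by (intro mult_left_mono power_mono) auto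
    finally have 1: "\<bar>F x (g (\<theta>0 + u)) - (norm (\<Psi> (w - \<rho>)))\<^sup>2 / 2\<bar> \<le> e1 * (A * n)\<^sup>2" .
    have "\<bar>(norm (\<Psi> (w - \<rho>)))\<^sup>2 / 2 - (norm (\<Psi> w))\<^sup>2 / 2\<bar> \<le> norm (\<Psi> \<rho>) * (norm (\<Psi> w) + norm (\<Psi> \<rho>))"
      using norm_square_perturb[of "\<Psi> w" "\<Psi> \<rho>"] by (simp add: linear_diff[OF lin])
    also have "\<dots> \<le> (b * norm \<rho>) * (b * norm w + b * norm \<rho>)"
      using b by (intro mult_mono add_mono) auto
    also have "\<dots> = b\<^sup>2 * norm \<rho> * (norm w + norm \<rho>)"
      by (simp add: power2_eq_square algebra_simps)
    also have "\<dots> \<le> b\<^sup>2 * (e1 * (\<kappa> * n)) * (A * n)"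
      using \<rho> wA b(1) e1 \<kappa> n(1) by (intro mult_mono) auto
    finally have "\<bar>F x (g (\<theta>0 + u)) - (norm (\<Psi> w))\<^sup>2 / 2\<bar> \<le>
        e1 * (A * n)\<^sup>2 + b\<^sup>2 * (e1 * (\<kappa> * n)) * (A * n)"
      using 1 by linarith
    also have "\<dots> = e1 * K * n\<^sup>2"
      by (simp add: K_def power2_eq_square algebra_simps)
    also have "\<dots> \<le> e * n\<^sup>2" using e1(3) by (intro mult_right_mono) auto
    finally show ?thesis by (simp add: w_def n_def)
  qed
  then show ?thesis using d unfolding x0_def by blast
qed

text \<open>Near \<theta>0 the injective derivative expands lengths by at least \<beta>, and the
  remainder uses up at most half of that. Away from \<theta>0, identifiability and compactness keep
  g \<theta> at a positive distance from g \<theta>0, so values close to g \<theta>0 come only from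
  nearby parameters.\<close>

lemma parameter_lipschitz_at:
  fixes g :: "'p::euclidean_space \<Rightarrow> 'x::euclidean_space"
  assumes P: "compact P" "\<theta>0 \<in> P" "continuous_on P g"
    and der: "(g has_derivative J) (at \<theta>0)" and inj: "inj J"
    and ident: "\<And>\<theta>. \<theta> \<in> P \<Longrightarrow> g \<theta> = g \<theta>0 \<Longrightarrow> \<theta> = \<theta>0"
  shows "\<exists>C>0. \<exists>d>0. \<forall>\<theta>\<in>P. norm (g \<theta> - g \<theta>0) < d \<longrightarrow> norm (\<theta> - \<theta>0) \<le> C * norm (g \<theta> - g \<theta>0)"
proof -
  obtain \<beta> where \<beta>: "\<beta> > 0" "\<And>u. \<beta> * norm u \<le> norm (J u)"
    using linear_inj_bounded_below_pos[OF has_derivative_linear[OF der] inj] by blast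
  obtain r where r: "r > 0"
      "\<And>y. norm (y - \<theta>0) < r \<Longrightarrow> norm (g y - g \<theta>0 - J (y - \<theta>0)) \<le> \<beta> / 2 * norm (y - \<theta>0)"
    using der \<beta>(1) unfolding has_derivative_at_alt by (meson half_gt_zero)
  have near: "\<beta> / 2 * norm (y - \<theta>0) \<le> norm (g y - g \<theta>0)" if "norm (y - \<theta>0) < r" for y
  proof -
    have "norm (J (y - \<theta>0)) \<le> norm (g y - g \<theta>0) + norm (g y - g \<theta>0 - J (y - \<theta>0))"
      using norm_triangle_ineq4[of "g y - g \<theta>0" "g y - g \<theta>0 - J (y - \<theta>0)"] by simp
    then show ?thesis using \<beta>(2)[of "y - \<theta>0"] r(2)[OF that] by (simp add: field_simps)
  qed
  let ?Q = "P - ball \<theta>0 r"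
  have Q: "compact ?Q" using P(1) by (simp add: compact_diff)
  obtain d where d: "d > 0" "\<And>\<theta>. \<theta> \<in> ?Q \<Longrightarrow> d \<le> norm (g \<theta> - g \<theta>0)"
  proof (cases "?Q = {}")
    case True
    then show ?thesis by (intro that[of 1]) auto
  next
    case False
    have "continuous_on ?Q (\<lambda>\<theta>. norm (g \<theta> - g \<theta>0))"
      using P(3) by (intro continuous_intros) (auto intro: continuous_on_subset)
    then obtain \<theta>1 where \<theta>1: "\<theta>1 \<in> ?Q" "\<And>\<theta>. \<theta> \<in> ?Q \<Longrightarrow> norm (g \<theta>1 - g \<theta>0) \<le> norm (g \<theta> - g \<theta>0)"
      using continuous_attains_inf[OF Q False] by blast
    have "\<theta>1 \<noteq> \<theta>0" using \<theta>1(1) r(1) by auto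
    then have "g \<theta>1 \<noteq> g \<theta>0" using ident \<theta>1(1) by blast
    then show ?thesis using \<theta>1(2) by (intro that[of "norm (g \<theta>1 - g \<theta>0)"]) auto
  qed
  have "norm (\<theta> - \<theta>0) \<le> 2 / \<beta> * norm (g \<theta> - g \<theta>0)" if "\<theta> \<in> P" "norm (g \<theta> - g \<theta>0) < d" for \<theta>
  proof -
    have "\<theta> \<notin> ?Q" using d(2) that by force
    then have "norm (\<theta> - \<theta>0) < r" using that by (simp add: dist_norm norm_minus_commute)
    from near[OF this] show ?thesis using \<beta>(1) by (simp add: field_simps)
  qed
  then show ?thesis using d(1) \<beta>(1) by (intro exI[of _ "2 / \<beta>"] conjI exI[of _ d]) auto
qed

text \<open>Comparing the minimizer with \<theta>0 puts it within a multiple of |x - g \<theta>0| of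
  \<theta>0, where the tangent form gives the lower bound N. For the upper bound the minimizer is
  compared with \<theta>0 + u, where u attains N on the tangent space.\<close>

lemma min_contrast_expansion:
  fixes g :: "'p::euclidean_space \<Rightarrow> 'x::euclidean_space" and F :: "'x \<Rightarrow> 'x \<Rightarrow> real"
    and \<Psi> :: "'x \<Rightarrow> 'c::euclidean_space"
  assumes P: "compact P" "\<theta>0 \<in> interior P" "continuous_on P g"
    and der: "(g has_derivative J) (at \<theta>0)" and inj: "inj J"
    and ident: "\<And>\<theta>. \<theta> \<in> P \<Longrightarrow> g \<theta> = g \<theta>0 \<Longrightarrow> \<theta> = \<theta>0"
    and lin: "linear \<Psi>"
    and loc: "\<And>e. e > 0 \<Longrightarrow> \<exists>d>0. \<forall>x y. norm (x - g \<theta>0) < d \<and> norm (y - g \<theta>0) < d \<longrightarrow>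
      \<bar>F x y - (norm (\<Psi> (x - y)))\<^sup>2 / 2\<bar> \<le> e * (norm (x - y))\<^sup>2"
    and low: "\<exists>c>0. \<exists>d>0. \<forall>x. \<forall>y\<in>g ` P. norm (x - g \<theta>0) < d \<longrightarrow> c * (norm (x - y))\<^sup>2 \<le> F x y"
    and N1: "\<And>v u. N v \<le> (norm (\<Psi> (v - J u)))\<^sup>2 / 2"
    and N2: "\<And>v. \<exists>u. norm u \<le> C * norm v \<and> (norm (\<Psi> (v - J u)))\<^sup>2 / 2 = N v"
    and e: "e > 0"
  shows "\<exists>d>0. \<forall>x. \<forall>\<theta>\<in>P. norm (x - g \<theta>0) < d \<and> (\<forall>\<theta>'\<in>P. F x (g \<theta>) \<le> F x (g \<theta>')) \<longrightarrow>
    \<bar>F x (g \<theta>) - N (x - g \<theta>0)\<bar> \<le> e * (norm (x - g \<theta>0))\<^sup>2"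
proof -
  have \<theta>0: "\<theta>0 \<in> P" using P(2) interior_subset by blast
  obtain r where r: "r > 0" "ball \<theta>0 r \<subseteq> P"
    using P(2) mem_interior by blast
  obtain b where b: "b > 0" "\<And>v. norm (\<Psi> v) \<le> b * norm v"
    using linear_bounded_pos[OF lin] by blast
  obtain d1 where d1: "d1 > 0" "\<And>x y. norm (x - g \<theta>0) < d1 \<Longrightarrow> norm (y - g \<theta>0) < d1 \<Longrightarrow>
      \<bar>F x y - (norm (\<Psi> (x - y)))\<^sup>2 / 2\<bar> \<le> 1 * (norm (x - y))\<^sup>2"
    using loc[of 1] by auto
  obtain c d2 where c: "c > 0" and d2: "d2 > 0"
      "\<And>x y. y \<in> g ` P \<Longrightarrow> norm (x - g \<theta>0) < d2 \<Longrightarrow> c * (norm (x - y))\<^sup>2 \<le> F x y"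
    using low by blast
  obtain C1 d3 where C1: "C1 > 0" and d3: "d3 > 0"
      "\<And>\<theta>. \<theta> \<in> P \<Longrightarrow> norm (g \<theta> - g \<theta>0) < d3 \<Longrightarrow> norm (\<theta> - \<theta>0) \<le> C1 * norm (g \<theta> - g \<theta>0)"
    using parameter_lipschitz_at[OF P(1) \<theta>0 P(3) der inj ident] by blast
  \<comment> \<open>Chosen so that c |x - g \<theta>|^2 <= F x (g \<theta>) <= F x (g \<theta>0) <=
    (1 + b^2 / 2) n^2 yields |x - g \<theta>| <= k n.\<close>
  define k where "k = sqrt ((1 + b\<^sup>2 / 2) / c)"
  have k: "k \<ge> 0" using c by (simp add: k_def)
  \<comment> \<open>One radius for both comparisons: \<open>C\<close> serves the tangent competitor,
    \<open>C1 * (k + 1)\<close> the minimizer.\<close>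
  define \<kappa> where "\<kappa> = max C (C1 * (k + 1))"
  have \<kappa>: "\<kappa> \<ge> 0" using C1 k by (simp add: \<kappa>_def le_max_iff_disj)
  obtain d4 where d4: "d4 > 0" "\<And>x u. norm (x - g \<theta>0) < d4 \<Longrightarrow> norm u \<le> \<kappa> * norm (x - g \<theta>0) \<Longrightarrow>
    \<bar>F x (g (\<theta>0 + u)) - (norm (\<Psi> (x - g \<theta>0 - J u)))\<^sup>2 / 2\<bar> \<le> e * (norm (x - g \<theta>0))\<^sup>2"
    using contrast_along_model[OF der lin loc \<kappa> e] by blast
  define d where "d = Min {d1, d2, d3 / (k + 1), d4, r / (\<kappa> + 1)}"
  have d: "d > 0" using d1(1) d2(1) d3(1) d4(1) r(1) k \<kappa> by (simp add: d_def)
  have dle: "d \<le> d1" "d \<le> d2" "d \<le> d3 / (k + 1)" "d \<le> d4" "d \<le> r / (\<kappa> + 1)"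
    by (simp_all add: d_def)
  have "\<bar>F x (g \<theta>) - N (x - g \<theta>0)\<bar> \<le> e * (norm (x - g \<theta>0))\<^sup>2"
    if \<theta>: "\<theta> \<in> P" and x: "norm (x - g \<theta>0) < d" and min: "\<And>\<theta>'. \<theta>' \<in> P \<Longrightarrow> F x (g \<theta>) \<le> F x (g \<theta>')" for x \<theta>
  proof -
    define n where "n = norm (x - g \<theta>0)"
    have "n < d" using x by (simp add: n_def)
    then have xd: "n < d1" "n < d2" "n < d4" "n * (k + 1) < d3" "n * (\<kappa> + 1) < r" "n \<ge> 0"
      using dle k \<kappa> by (auto simp: n_def pos_less_divide_eq[symmetric] intro: less_le_trans)
    have "c * (norm (x - g \<theta>))\<^sup>2 \<le> F x (g \<theta>)"
      using d2(2) \<theta> xd by (simp add: n_def)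
    also have "\<dots> \<le> F x (g \<theta>0)" using min \<theta>0 .
    also have "\<dots> \<le> (norm (\<Psi> (x - g \<theta>0)))\<^sup>2 / 2 + n\<^sup>2"
      using d1(2)[of x "g \<theta>0"] d1(1) xd by (simp add: n_def abs_le_iff)
    also have "\<dots> \<le> (b * n)\<^sup>2 / 2 + n\<^sup>2"
      using power_mono[OF b(2)[of "x - g \<theta>0"], of 2] by (simp add: n_def)
    finally have "(norm (x - g \<theta>))\<^sup>2 \<le> (1 + b\<^sup>2 / 2) / c * n\<^sup>2"
      using c by (simp add: field_simps)
    then have "norm (x - g \<theta>) \<le> sqrt ((1 + b\<^sup>2 / 2) / c * n\<^sup>2)"
      by (rule real_le_rsqrt)
    also have "\<dots> = k * n" using xd(6) by (simp only: k_def real_sqrt_mult real_sqrt_abs abs_of_nonneg)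
    finally have xg: "norm (x - g \<theta>) \<le> k * n" .
    have "norm (g \<theta> - g \<theta>0) \<le> norm (x - g \<theta>0) + norm (x - g \<theta>)"
      using norm_triangle_ineq4[of "x - g \<theta>0" "x - g \<theta>"] by simp
    with xg have gg: "norm (g \<theta> - g \<theta>0) \<le> (k + 1) * n"
      by (simp add: n_def algebra_simps)
    then have "norm (\<theta> - \<theta>0) \<le> C1 * norm (g \<theta> - g \<theta>0)"
      using xd(4) by (intro d3(2)[OF \<theta>]) (simp add: mult.commute)
    also have "\<dots> \<le> C1 * ((k + 1) * n)" using gg C1 by simp
    also have "\<dots> \<le> \<kappa> * n" using xd(6) by (simp add: \<kappa>_def mult.assoc[symmetric] mult_right_mono)
    finally have "norm (\<theta> - \<theta>0) \<le> \<kappa> * n" .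
    then have "\<bar>F x (g \<theta>) - (norm (\<Psi> (x - g \<theta>0 - J (\<theta> - \<theta>0))))\<^sup>2 / 2\<bar> \<le> e * n\<^sup>2"
      using d4(2)[of x "\<theta> - \<theta>0"] xd by (simp add: n_def)
    then have lower: "N (x - g \<theta>0) - e * n\<^sup>2 \<le> F x (g \<theta>)"
      using N1[of "x - g \<theta>0" "\<theta> - \<theta>0"] by linarith
    obtain u where u: "norm u \<le> C * n" "(norm (\<Psi> (x - g \<theta>0 - J u)))\<^sup>2 / 2 = N (x - g \<theta>0)"
      using N2[of "x - g \<theta>0"] by (auto simp: n_def)
    have "C * n \<le> \<kappa> * n" using xd(6) by (simp add: \<kappa>_def mult_right_mono)
    then have u': "norm u \<le> \<kappa> * n" using u(1) by simp
    also have "\<dots> < r" using xd(5,6) by (simp add: algebra_simps)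
    \<comment> \<open>Here interiority counts: at a boundary point the best tangent direction could
      leave \<open>P\<close>.\<close>
    finally have "\<theta>0 + u \<in> P" using r(2) by (auto simp: subset_eq dist_norm)
    then have "F x (g \<theta>) \<le> F x (g (\<theta>0 + u))" by (rule min)
    also have "\<dots> \<le> N (x - g \<theta>0) + e * n\<^sup>2"
      using d4(2)[of x u] u u' xd by (simp add: n_def abs_le_iff)
    finally show ?thesis using lower by (simp add: n_def abs_le_iff)
  qed
  then show ?thesis using d by blast
qed

text \<open>The minimum over \<open>u\<close> of \<open>|\<Psi> (v - J u)|\<^sup>2\<close> is the squared length of the component of \<open>\<Psi> v\<close>
  orthogonal to \<open>\<Psi> (J u)\<close>; \<open>B\<close> is an orthonormal basis of the space of these components.\<close>

lemma projection_onto_complement: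
  fixes \<Psi> :: "'x::euclidean_space \<Rightarrow> 'c::euclidean_space" and J :: "'p::euclidean_space \<Rightarrow> 'x"
  assumes "linear \<Psi>" "inj \<Psi>" "linear J" "inj J"
  obtains B C where "finite B" "B \<subseteq> range \<Psi>" "card B = DIM('x) - DIM('p)"
    "pairwise orthogonal B" "\<And>c. c \<in> B \<Longrightarrow> norm c = 1"
    "\<And>v u. (\<Sum>c\<in>B. (c \<bullet> \<Psi> v)\<^sup>2) \<le> (norm (\<Psi> (v - J u)))\<^sup>2"
    "\<And>v. \<exists>u. norm u \<le> C * norm v \<and> (norm (\<Psi> (v - J u)))\<^sup>2 = (\<Sum>c\<in>B. (c \<bullet> \<Psi> v)\<^sup>2)"
proof -
  define E where "E = range \<Psi>"
  define L where "L = range (\<Psi> \<circ> J)"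
  have lin: "linear (\<Psi> \<circ> J)" and inj: "inj (\<Psi> \<circ> J)"
    using linear_compose[OF assms(3,1)] inj_compose[OF assms(2,4)] by (simp_all add: o_def)
  have E: "subspace E"
    unfolding E_def by (rule linear_subspace_image[OF assms(1) subspace_UNIV])
  have L: "subspace L"
    unfolding L_def by (rule linear_subspace_image[OF lin subspace_UNIV])
  have LE: "L \<subseteq> E"
    by (auto simp: E_def L_def)
  have dims: "dim E = DIM('x)" "dim L = DIM('p)"
    unfolding E_def L_def using dim_image_eq[OF assms(1), of UNIV] dim_image_eq[OF lin, of UNIV] assms(2) inj
    by (simp_all add: inj_on_def inj_def)
  define K where "K = {y \<in> E. \<forall>x \<in> L. orthogonal x y}"
  have K: "subspace K"
    using E by (auto simp: K_def subspace_def orthogonal_clauses)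
  have dimK: "dim K = DIM('x) - DIM('p)"
    using dim_subspace_orthogonal_to_vectors[OF L E LE] unfolding K_def[symmetric] dims by simp
  obtain B where B: "B \<subseteq> K" "pairwise orthogonal B" "\<And>x. x \<in> B \<Longrightarrow> norm x = 1"
      "independent B" "card B = dim K" "span B = K"
    using orthonormal_basis_subspace[OF K] by metis
  have fin: "finite B" using B(4) by (rule independent_imp_finite)
  have parseval: "(norm z)\<^sup>2 = (\<Sum>c\<in>B. (c \<bullet> z)\<^sup>2)" if "z \<in> K" for z
  proof -
    have z: "z \<in> span B" using that B(6) by simp
    have "(\<Sum>c\<in>B. (c \<bullet> z) *\<^sub>R c) = z"
      using orthonormal_basis_expand[OF B(2,3) z fin] by (simp add: inner_commute)

    then have "z \<bullet> z = z \<bullet> (\<Sum>c\<in>B. (c \<bullet> z) *\<^sub>R c)" by simp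
    also have "\<dots> = (\<Sum>c\<in>B. (c \<bullet> z)\<^sup>2)"
      by (simp add: inner_sum_right power2_eq_square inner_commute)
    finally show ?thesis by (simp add: power2_norm_eq_inner)
  qed
  have decomp: "\<exists>l z. l \<in> L \<and> z \<in> K \<and> \<Psi> v = l + z" for v
  proof -
    obtain l z where lz: "l \<in> span L" "\<And>w. w \<in> span L \<Longrightarrow> orthogonal z w" "\<Psi> v = l + z"
      using orthogonal_subspace_decomp_exists[of L "\<Psi> v"] by blast
    have l: "l \<in> L" using lz(1) L by (simp add: span_eq_iff[THEN iffD2])
    then have "\<Psi> v - l \<in> E" using LE E by (intro subspace_diff) (auto simp: E_def)
    then have "z \<in> K" using lz(2,3) by (auto simp: K_def orthogonal_commute span_base)
    then show ?thesis using l lz(3) by blast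
  qed
  have coords: "(\<Sum>c\<in>B. (c \<bullet> (l + z))\<^sup>2) = (norm z)\<^sup>2" if "l \<in> L" "z \<in> K" for l z
    unfolding parseval[OF that(2)] using B(1) that(1)
    by (intro sum.cong) (auto simp: K_def orthogonal_def inner_add_right inner_commute)
  have pyth: "(norm (l + z))\<^sup>2 = (norm l)\<^sup>2 + (norm z)\<^sup>2" if "l \<in> L" "z \<in> K" for l z
    using that by (intro norm_add_Pythagorean) (auto simp: K_def)
  obtain \<beta> where \<beta>: "\<beta> > 0" "\<And>u. \<beta> * norm u \<le> norm ((\<Psi> \<circ> J) u)"
    using linear_inj_bounded_below_pos[OF lin inj] by blast
  obtain b where b: "b > 0" "\<And>v. norm (\<Psi> v) \<le> b * norm v"
    using linear_bounded_pos[OF assms(1)] by blast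
  have low: "(\<Sum>c\<in>B. (c \<bullet> \<Psi> v)\<^sup>2) \<le> (norm (\<Psi> (v - J u)))\<^sup>2" for v u
  proof -
    obtain l z where lz: "l \<in> L" "z \<in> K" "\<Psi> v = l + z" using decomp by blast
    have "\<Psi> (v - J u) = (l - \<Psi> (J u)) + z" by (simp add: linear_diff[OF assms(1)] lz)
    moreover have "l - \<Psi> (J u) \<in> L" using lz(1) L by (intro subspace_diff) (auto simp: L_def)
    ultimately show ?thesis using coords[OF lz(1,2)] pyth[OF _ lz(2)] by (simp add: lz(3))
  qed
  \<comment> \<open>The minimizing \<open>u\<close> is the preimage of the component of
    \<open>\<Psi> v\<close> in \<open>L\<close>. Orthogonal projection does not lengthen, and
    \<open>\<Psi> \<circ> J\<close> expands by at least \<beta>, whence the ratio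
    \<open>b / \<beta>\<close>.\<close>
  have up: "\<exists>u. norm u \<le> (b / \<beta>) * norm v \<and> (norm (\<Psi> (v - J u)))\<^sup>2 = (\<Sum>c\<in>B. (c \<bullet> \<Psi> v)\<^sup>2)" for v
  proof -
    obtain l z where lz: "l \<in> L" "z \<in> K" "\<Psi> v = l + z" using decomp by blast
    obtain u where u: "l = \<Psi> (J u)" using lz(1) by (auto simp: L_def)
    have "(norm l)\<^sup>2 \<le> (norm (\<Psi> v))\<^sup>2" using pyth[OF lz(1,2)] lz(3) by simp
    then have "norm l \<le> b * norm v" using b(2)[of v] power2_le_imp_le norm_ge_zero order_trans by blast
    then have "\<beta> * norm u \<le> b * norm v" using \<beta>(2)[of u] u by simp
    moreover have "(norm (\<Psi> (v - J u)))\<^sup>2 = (\<Sum>c\<in>B. (c \<bullet> \<Psi> v)\<^sup>2)"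
      using coords[OF lz(1,2)] lz(3) u by (simp add: linear_diff[OF assms(1)])
    ultimately show ?thesis using \<beta>(1) by (intro exI[of _ u]) (simp add: field_simps)
  qed
  show ?thesis
    by (rule that[OF fin _ _ B(2,3) low up]) (use B(1,5) dimK in \<open>auto simp: K_def E_def\<close>)
qed

section \<open>Quadratic forms of standard Gaussian vectors\<close>

abbreviation gauss_PiM :: "('r \<Rightarrow> real) measure" where
  "gauss_PiM \<equiv> \<Pi>\<^sub>M i\<in>UNIV. std_normal_distribution"

definition moment :: "nat \<Rightarrow> real" where
  "moment k = (LINT x|std_normal_distribution. x ^ k)"

lemma moment_simps [simp]: "moment 0 = 1" "moment (Suc 0) = 0" "moment 2 = 1" "moment 3 = 0" "moment 4 = 3"
  using std_normal_distribution_even_moments(1)[of 0] std_normal_distribution_even_moments(1)[of 1]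
    std_normal_distribution_even_moments(1)[of 2]
    integral_std_normal_distribution_moment_odd[of 1] integral_std_normal_distribution_moment_odd[of 3]
  by (simp_all add: moment_def fact_numeral)

lemma prod_power_delta:
  fixes y :: "'r::finite \<Rightarrow> real"
  shows "(\<Prod>\<rho>\<in>UNIV. y \<rho> ^ (if \<rho> = i then 1 else 0)) = y i"
proof -
  have "(\<Prod>\<rho>\<in>UNIV. y \<rho> ^ (if \<rho> = i then 1 else 0)) = (\<Prod>\<rho>\<in>UNIV. if \<rho> = i then y \<rho> else 1)"
    by (intro prod.cong) auto
  then show ?thesis by simp
qed

lemma gauss_monomial:
  fixes m :: "'r::finite \<Rightarrow> nat"
  shows "integrable gauss_PiM (\<lambda>x. \<Prod>\<rho>\<in>UNIV. x \<rho> ^ m \<rho>)"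
    and "(LINT x|gauss_PiM. (\<Prod>\<rho>\<in>UNIV. x \<rho> ^ m \<rho>)) = (\<Prod>\<rho>\<in>UNIV. moment (m \<rho>))"
proof -
  interpret N: prob_space std_normal_distribution
    using real_dist_normal_dist by (simp add: real_distribution_def)
  interpret product_sigma_finite "\<lambda>_::'r. std_normal_distribution" ..
  show "integrable gauss_PiM (\<lambda>x. \<Prod>\<rho>\<in>UNIV. x \<rho> ^ m \<rho>)"
    by (intro product_integrable_prod integrable_std_normal_distribution_moment) auto
  show "(LINT x|gauss_PiM. (\<Prod>\<rho>\<in>UNIV. x \<rho> ^ m \<rho>)) = (\<Prod>\<rho>\<in>UNIV. moment (m \<rho>))"
    unfolding moment_def
    by (intro product_integral_prod integrable_std_normal_distribution_moment) auto
qed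

lemma gauss_second_moment:
  fixes i j :: "'r::finite"
  shows "integrable gauss_PiM (\<lambda>x. x i * x j)"
    and "(LINT x|gauss_PiM. x i * x j) = (if i = j then 1 else 0)"
proof -
  let ?m = "\<lambda>\<rho>. (if \<rho> = i then 1 else 0) + (if \<rho> = j then 1 else 0) :: nat"
  have eq: "(\<lambda>x::'r \<Rightarrow> real. x i * x j) = (\<lambda>x. \<Prod>\<rho>\<in>UNIV. x \<rho> ^ ?m \<rho>)"
    by (simp only: power_add prod.distrib prod_power_delta)
  show "integrable gauss_PiM (\<lambda>x. x i * x j)"
    unfolding eq by (rule gauss_monomial)
  have "(\<Prod>\<rho>\<in>UNIV. moment (?m \<rho>)) = (\<Prod>\<rho>\<in>{i, j}. moment (?m \<rho>))"
    by (intro prod.mono_neutral_right) auto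
  also have "\<dots> = (if i = j then 1 else 0)"
    by (cases "i = j") (auto simp: numeral_2_eq_2[symmetric])
  finally show "(LINT x|gauss_PiM. x i * x j) = (if i = j then 1 else 0)"
    unfolding eq by (simp only: gauss_monomial(2))
qed

text \<open>Isserlis' formula, one term for each pairing of the four indices. The integrand is a
  monomial, so its mean is a product of one-dimensional moments that depends only on which indices
  coincide.\<close>

lemma gauss_fourth_moment:
  fixes i j k l :: "'r::finite"
  shows "integrable gauss_PiM (\<lambda>x. x i * x j * (x k * x l))"
    and "(LINT x|gauss_PiM. x i * x j * (x k * x l)) =
      (if i = j \<and> k = l then 1 else 0) + (if i = k \<and> j = l then 1 else 0) + (if i = l \<and> j = k then 1 else 0)"
proof -
  let ?m = "\<lambda>\<rho>. (if \<rho> = i then 1 else 0) + (if \<rho> = j then 1 else 0) +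
    ((if \<rho> = k then 1 else 0) + (if \<rho> = l then 1 else 0)) :: nat"
  have eq: "(\<lambda>x::'r \<Rightarrow> real. x i * x j * (x k * x l)) = (\<lambda>x. \<Prod>\<rho>\<in>UNIV. x \<rho> ^ ?m \<rho>)"
    by (simp only: power_add prod.distrib prod_power_delta)
  show "integrable gauss_PiM (\<lambda>x. x i * x j * (x k * x l))"
    unfolding eq by (rule gauss_monomial)
  have "(\<Prod>\<rho>\<in>UNIV. moment (?m \<rho>)) = (\<Prod>\<rho>\<in>{i, j, k, l}. moment (?m \<rho>))"
    by (intro prod.mono_neutral_right) auto
  also have "\<dots> = (if i = j \<and> k = l then 1 else 0) + (if i = k \<and> j = l then 1 else 0) + (if i = l \<and> j = k then 1 else 0)"
    by (cases "i = j"; cases "i = k"; cases "i = l"; cases "j = k"; cases "j = l"; cases "k = l")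
       (auto simp: numeral_2_eq_2[symmetric] numeral_3_eq_3[symmetric] insert_commute)
  finally show "(LINT x|gauss_PiM. x i * x j * (x k * x l)) =
      (if i = j \<and> k = l then 1 else 0) + (if i = k \<and> j = l then 1 else 0) + (if i = l \<and> j = k then 1 else 0)"
    unfolding eq by (simp only: gauss_monomial(2))
qed

text \<open>The Wick product of two coordinates: their product minus its mean under
  \<open>gauss_PiM\<close>.\<close>

definition wick :: "'r \<Rightarrow> 'r \<Rightarrow> ('r \<Rightarrow> real) \<Rightarrow> real" where
  "wick i j x = x i * x j - (if i = j then 1 else 0)"

lemma measurable_wick [measurable]: "wick i j \<in> borel_measurable (PiM UNIV (\<lambda>_. borel))"
  unfolding wick_def by measurable

text \<open>Centring removes the pairing of i with j and of k with l; the two crossed pairings of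
  Isserlis' formula remain.\<close>

lemma wick_moments:
  fixes i j k l :: "'r::finite"
  shows "integrable gauss_PiM (wick i j)" "(LINT x|gauss_PiM. wick i j x) = 0"
    and "integrable gauss_PiM (\<lambda>x. wick i j x * wick k l x)"
    and "(LINT x|gauss_PiM. wick i j x * wick k l x) =
      (if i = k \<and> j = l then 1 else 0) + (if i = l \<and> j = k then 1 else 0)"
proof -
  interpret N: prob_space std_normal_distribution
    using real_dist_normal_dist by (simp add: real_distribution_def)
  interpret product_prob_space "\<lambda>_::'r. std_normal_distribution" UNIV ..
  note [simp] = gauss_second_moment gauss_fourth_moment P.prob_space
  show "integrable gauss_PiM (wick i j)" "(LINT x|gauss_PiM. wick i j x) = 0"
    unfolding wick_def[abs_def] by auto
  have eq: "wick i j x * wick k l x = x i * x j * (x k * x l) - (if k = l then 1 else 0) * (x i * x j)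
      - (if i = j then 1 else 0) * (x k * x l) + (if i = j then 1 else 0) * (if k = l then 1 else 0)" for x
    unfolding wick_def by (simp only: algebra_simps)
  show "integrable gauss_PiM (\<lambda>x. wick i j x * wick k l x)"
    unfolding eq by (intro Bochner_Integration.integrable_add Bochner_Integration.integrable_diff integrable_mult_right) auto
  show "(LINT x|gauss_PiM. wick i j x * wick k l x) =
      (if i = k \<and> j = l then 1 else 0) + (if i = l \<and> j = k then 1 else 0)"
    unfolding eq
    by (subst Bochner_Integration.integral_add Bochner_Integration.integral_diff;
        (intro Bochner_Integration.integrable_add Bochner_Integration.integrable_diff integrable_mult_right)?; simp)+
qed

text \<open>The centred quadratic form x^T C x - tr C.\<close>

definition gquad :: "real^'r::finite^'r \<Rightarrow> ('r \<Rightarrow> real) \<Rightarrow> real" where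
  "gquad C x = (\<Sum>i\<in>UNIV. \<Sum>j\<in>UNIV. C $ i $ j * wick i j x)"

lemma measurable_gquad [measurable]: "gquad C \<in> borel_measurable (PiM UNIV (\<lambda>_. borel))"
  unfolding gquad_def[abs_def] by measurable

text \<open>The two crossed pairings contribute C_ij C_ij and C_ij C_ji; symmetry makes them equal,
  hence the factor 2.\<close>

lemma gquad_moments:
  fixes C :: "real^'r::finite^'r"
  assumes "transpose C = C"
  shows "integrable gauss_PiM (gquad C)" "(LINT x|gauss_PiM. gquad C x) = 0"
    and "integrable gauss_PiM (\<lambda>x. (gquad C x)\<^sup>2)"
    and "(LINT x|gauss_PiM. (gquad C x)\<^sup>2) = 2 * (norm C)\<^sup>2"
proof -
  note [simp] = wick_moments
  show "integrable gauss_PiM (gquad C)" "(LINT x|gauss_PiM. gquad C x) = 0"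
    unfolding gquad_def[abs_def] by auto
  have eq: "(gquad C x)\<^sup>2 = (\<Sum>i\<in>UNIV. \<Sum>j\<in>UNIV. \<Sum>k\<in>UNIV. \<Sum>l\<in>UNIV.
      C $ i $ j * C $ k $ l * (wick i j x * wick k l x))" for x
  proof -
    have "(gquad C x)\<^sup>2 = (\<Sum>i\<in>UNIV. \<Sum>j\<in>UNIV. (C $ i $ j * wick i j x) * (\<Sum>k\<in>UNIV. \<Sum>l\<in>UNIV. C $ k $ l * wick k l x))"
      unfolding gquad_def power2_eq_square by (simp only: sum_distrib_right)
    also have "\<dots> = (\<Sum>i\<in>UNIV. \<Sum>j\<in>UNIV. \<Sum>k\<in>UNIV. \<Sum>l\<in>UNIV.
        (C $ i $ j * wick i j x) * (C $ k $ l * wick k l x))"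
      by (simp only: sum_distrib_left)
    finally show ?thesis by (simp only: ac_simps)
  qed
  show "integrable gauss_PiM (\<lambda>x. (gquad C x)\<^sup>2)"
    unfolding eq by auto
  have "(LINT x|gauss_PiM. (gquad C x)\<^sup>2) = (\<Sum>i\<in>UNIV. \<Sum>j\<in>UNIV. \<Sum>k\<in>UNIV. \<Sum>l\<in>UNIV.
      C $ i $ j * C $ k $ l * ((if i = k \<and> j = l then 1 else 0) + (if i = l \<and> j = k then 1 else 0)))"
    unfolding eq by simp
  also have "\<dots> = (\<Sum>i\<in>UNIV. \<Sum>j\<in>UNIV. \<Sum>k\<in>UNIV. \<Sum>l\<in>UNIV.
      (if k = i then if l = j then C $ i $ j * C $ i $ j else 0 else 0) +
      (if k = j then if l = i then C $ i $ j * C $ j $ i else 0 else 0))"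
    by (intro sum.cong refl) auto
  also have "\<dots> = (\<Sum>i\<in>UNIV. \<Sum>j\<in>UNIV. C $ i $ j * C $ i $ j + C $ i $ j * C $ j $ i)"
  proof -
    have delta: "(\<Sum>k\<in>UNIV. \<Sum>l\<in>UNIV. if k = a then if l = b then c else 0 else 0) = c"
      for a b :: 'r and c :: real
      by (subst sum.swap) simp
    show ?thesis by (simp only: sum.distrib delta)
  qed
  also have "\<dots> = (\<Sum>i\<in>UNIV. \<Sum>j\<in>UNIV. 2 * (C $ i $ j * C $ i $ j))"
  proof (intro sum.cong refl)
    fix i j
    have "C $ j $ i = C $ i $ j" using assms by (metis transpose_def vec_lambda_beta)
    then show "C $ i $ j * C $ i $ j + C $ i $ j * C $ j $ i = 2 * (C $ i $ j * C $ i $ j)" by simp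
  qed
  also have "\<dots> = 2 * (norm C)\<^sup>2"
    by (simp add: power2_norm_eq_inner inner_vec_def sum_distrib_left)
  finally show "(LINT x|gauss_PiM. (gquad C x)\<^sup>2) = 2 * (norm C)\<^sup>2" .
qed

section \<open>Sums of independent variables\<close>

lemma (in prob_space) char_iid_sum:
  fixes X :: "nat \<Rightarrow> 'a \<Rightarrow> real"
  assumes "indep_vars (\<lambda>_. borel) X {..<n}" "\<And>k. k < n \<Longrightarrow> distr M borel (X k) = \<mu>"
  shows "(LINT \<omega>|M. iexp (s * (\<Sum>k<n. X k \<omega>))) = char \<mu> s ^ n"
proof -
  have [measurable]: "X k \<in> borel_measurable M" if "k < n" for k
    using assms(1) that by (simp add: indep_vars_def)
  have "(\<lambda>\<omega>. \<Sum>k<n. X k \<omega>) \<in> borel_measurable M"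
    by (intro borel_measurable_sum) auto
  then have "(LINT \<omega>|M. iexp (s * (\<Sum>k<n. X k \<omega>))) = char (distr M borel (\<lambda>\<omega>. \<Sum>k<n. X k \<omega>)) s"
    unfolding char_def by (subst integral_distr) auto
  also have "\<dots> = (\<Prod>k<n. char (distr M borel (X k)) s)"
    by (rule char_distr_sum[OF assms(1)])
  also have "\<dots> = char \<mu> s ^ n" by (simp add: assms(2))
  finally show ?thesis .
qed

text \<open>The central limit theorem is applied to the coordinates of an infinite product of copies
  of \<open>M\<close>. This auxiliary sequence is then forgotten: the resulting statement about
  \<open>char M\<close> alone applies to any array whose n-th row has n independent entries of that
  law.\<close>

lemma (in real_distribution) clt_char:
  assumes "integrable M (\<lambda>x. x\<^sup>2)" "expectation (\<lambda>x. x) = 0" "expectation (\<lambda>x. x\<^sup>2) = \<sigma>\<^sup>2" "\<sigma> > 0"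
  shows "(\<lambda>n. char M (t / sqrt (real n)) ^ n) \<longlonglongrightarrow> exp (- (t\<^sup>2 * \<sigma>\<^sup>2) / 2)"
proof -
  interpret Q: product_prob_space "\<lambda>_::nat. M" UNIV ..
  let ?Q = "\<Pi>\<^sub>M i\<in>(UNIV::nat set). M"
  let ?X = "\<lambda>i x. x i :: real"
  have comp: "distr ?Q borel (?X i) = M" for i
    using distr_PiM_component[of UNIV "\<lambda>_::nat. M" i] prob_space_axioms
    by (simp cong: distr_cong)
  have [measurable]: "?X i \<in> borel_measurable ?Q" for i
    by simp
  have sets: "sets (\<Pi>\<^sub>M i\<in>(UNIV::nat set). borel) = sets ?Q"
    by (intro sets_PiM_cong) auto
  have indep: "Q.indep_vars (\<lambda>_. borel) ?X UNIV"
    by (subst Q.P.indep_vars_iff_distr_eq_PiM')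
       (auto simp: comp restrict_UNIV distr_id2[OF sets] cong: distr_cong)
  have weak: "weak_conv_m (\<lambda>n. distr ?Q borel (\<lambda>x. (\<Sum>i<n. ?X i x) / sqrt (n * \<sigma>\<^sup>2))) std_normal_distribution"
  proof (rule Q.P.central_limit_theorem_zero_mean[OF indep _ \<open>\<sigma> > 0\<close> _ _ comp])
    have i: "integral\<^sup>L ?Q (\<lambda>x. f (x n)) = expectation f" if [measurable]: "f \<in> borel_measurable borel" for n and f :: "real \<Rightarrow> real"
      by (subst comp[of n, symmetric]) (simp add: integral_distr)
    have i': "integrable ?Q (\<lambda>x. f (x n)) \<longleftrightarrow> integrable M f" if [measurable]: "f \<in> borel_measurable borel" for n and f :: "real \<Rightarrow> real"
      by (subst comp[of n, symmetric]) (simp add: integrable_distr_eq)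
    show zero: "integral\<^sup>L ?Q (?X n) = 0" for n using i[of "\<lambda>x. x" n] assms(2) by simp
    show "integrable ?Q (\<lambda>x. (?X n x)\<^sup>2)" for n using i'[of "\<lambda>x. x\<^sup>2" n] assms(1) by simp
    show "integral\<^sup>L ?Q (\<lambda>x. (?X n x - integral\<^sup>L ?Q (?X n))\<^sup>2) = \<sigma>\<^sup>2" for n
      unfolding zero using i[of "\<lambda>x. x\<^sup>2" n] assms(3) by simp
  qed
  \<comment> \<open>The theorem normalizes by the standard deviation; the argument
    \<open>t * \<sigma>\<close> takes \<sigma> out again.\<close>
  have "(\<lambda>n. char (distr ?Q borel (\<lambda>x. (\<Sum>i<n. ?X i x) / sqrt (n * \<sigma>\<^sup>2))) (t * \<sigma>)) \<longlonglongrightarrow> char std_normal_distribution (t * \<sigma>)"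
    by (rule levy_continuity1[OF _ real_dist_normal_dist weak]) (auto intro!: Q.P.real_distribution_distr)
  moreover have "char (distr ?Q borel (\<lambda>x. (\<Sum>i<n. ?X i x) / sqrt (n * \<sigma>\<^sup>2))) (t * \<sigma>) = char M (t / sqrt n) ^ n" for n
  proof -
    have "char (distr ?Q borel (\<lambda>x. (\<Sum>i<n. ?X i x) / sqrt (n * \<sigma>\<^sup>2))) (t * \<sigma>) =
        (LINT x|?Q. iexp (t / sqrt n * (\<Sum>i<n. ?X i x)))"
      unfolding char_def using \<open>\<sigma> > 0\<close> by (subst integral_distr) (auto simp: real_sqrt_mult)
    also have "\<dots> = char M (t / sqrt n) ^ n"
      by (rule Q.P.char_iid_sum[OF Q.P.indep_vars_subset[OF indep] comp]) auto
    finally show ?thesis .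
  qed
  ultimately show ?thesis
    by (simp add: char_std_normal_distribution power_mult_distrib)
qed

text \<open>Cross terms vanish, since each new summand is centred and independent of the partial
  sum.\<close>

lemma (in prob_space) second_moment_indep_sum:
  fixes X :: "'i \<Rightarrow> 'a \<Rightarrow> real"
  assumes "finite I" "indep_vars (\<lambda>_. borel) X I"
    and "\<And>i. i \<in> I \<Longrightarrow> integrable M (\<lambda>\<omega>. (X i \<omega>)\<^sup>2)" "\<And>i. i \<in> I \<Longrightarrow> expectation (X i) = 0"
  shows "integrable M (\<lambda>\<omega>. (\<Sum>i\<in>I. X i \<omega>)\<^sup>2) \<and> expectation (\<lambda>\<omega>. (\<Sum>i\<in>I. X i \<omega>)\<^sup>2) = (\<Sum>i\<in>I. expectation (\<lambda>\<omega>. (X i \<omega>)\<^sup>2))"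
  using assms
proof (induction I rule: finite_induct)
  case (insert i I)
  have [measurable]: "X j \<in> borel_measurable M" if "j \<in> insert i I" for j
    using insert.prems(1) that by (auto simp: indep_vars_def)
  let ?S = "\<lambda>\<omega>. \<Sum>i\<in>I. X i \<omega>"
  have int: "integrable M (X j)" if "j \<in> insert i I" for j
    by (rule square_integrable_imp_integrable[OF _ insert.prems(2)[OF that]]) (use that in measurable)
  have S: "integrable M ?S" "expectation ?S = 0"
    using int insert.prems(3) by auto
  have IH: "integrable M (\<lambda>\<omega>. (?S \<omega>)\<^sup>2)" "expectation (\<lambda>\<omega>. (?S \<omega>)\<^sup>2) = (\<Sum>i\<in>I. expectation (\<lambda>\<omega>. (X i \<omega>)\<^sup>2))"
    using insert.IH insert.prems indep_vars_subset[OF insert.prems(1), of I] by auto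
  have indep: "indep_var borel (X i) borel ?S"
    by (rule indep_vars_sum) (use insert in auto)
  have XS: "integrable M (\<lambda>\<omega>. X i \<omega> * ?S \<omega>)" "expectation (\<lambda>\<omega>. X i \<omega> * ?S \<omega>) = 0"
    using indep_var_integrable[OF indep int S(1)] indep_var_lebesgue_integral[OF indep int S(1)] S(2) by auto
  have eq: "(\<Sum>i\<in>insert i I. X i \<omega>)\<^sup>2 = (X i \<omega>)\<^sup>2 + 2 * (X i \<omega> * ?S \<omega>) + (?S \<omega>)\<^sup>2" for \<omega>
    using insert.hyps by (simp add: power2_eq_square algebra_simps)
  show ?case
    unfolding eq using insert.hyps insert.prems(2)[of i] XS IH by simp
qed simp

lemma (in prob_space) indep_vars_image:
  assumes indep: "indep_vars M' X (f ` I)" and inj: "inj_on f I"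
  shows "indep_vars (\<lambda>i. M' (f i)) (\<lambda>i. X (f i)) I"
  unfolding indep_vars_def2
proof (intro conjI ballI indep_setsI)
  let ?E = "\<lambda>j. {X j -` A \<inter> space M |A. A \<in> sets (M' j)}"
  have E: "indep_sets ?E (f ` I)" and rv: "\<And>i. i \<in> I \<Longrightarrow> X (f i) \<in> measurable M (M' (f i))"
    using indep by (auto simp: indep_vars_def2)
  show "X (f i) \<in> measurable M (M' (f i))" if "i \<in> I" for i
    using rv[OF that] .
  show "?E (f i) \<subseteq> events" if "i \<in> I" for i
    using rv[OF that] by (auto intro: measurable_sets)
  fix A J assume J: "J \<noteq> {}" "J \<subseteq> I" "finite J" and A: "\<forall>i\<in>J. A i \<in> ?E (f i)"
  have inv: "inv_into I f (f i) = i" if "i \<in> J" for i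
    using that J(2) inj by (auto intro: inv_into_f_f)
  have "prob (\<Inter>j\<in>f ` J. A (inv_into I f j)) = (\<Prod>j\<in>f ` J. prob (A (inv_into I f j)))"
  proof (rule indep_setsD[OF E])
    show "\<forall>j\<in>f ` J. A (inv_into I f j) \<in> ?E j"
      using A by (auto simp: inv)
  qed (use J in auto)
  also have "\<dots> = (\<Prod>i\<in>J. prob (A i))"
    using inj_on_subset[OF inj J(2)] by (simp add: prod.reindex inv)
  finally show "prob (\<Inter>i\<in>J. A i) = (\<Prod>i\<in>J. prob (A i))"
    by (simp add: inv)
qed

section \<open>Arrays of standard Gaussian vectors\<close>

text \<open>Rows with different \<open>n\<close> may depend on each other in any way; in the
  application they are increments of one path over different grids.\<close>

locale gauss_array = prob_space +
  fixes w :: "nat \<Rightarrow> nat \<Rightarrow> 'a \<Rightarrow> real^'r::finite"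
  assumes indep_entries: "\<And>n. n \<ge> 1 \<Longrightarrow>
      indep_vars (\<lambda>_. borel) (\<lambda>(k, \<rho>) \<omega>. w n k \<omega> $ \<rho>) ({..<n} \<times> UNIV)"
    and distr_entries: "\<And>n k \<rho>. n \<ge> 1 \<Longrightarrow> k < n \<Longrightarrow>
      distr M borel (\<lambda>\<omega>. w n k \<omega> $ \<rho>) = std_normal_distribution"
begin

lemma measurable_entry: "k < n \<Longrightarrow> (\<lambda>\<omega>. w n k \<omega> $ \<rho>) \<in> borel_measurable M"
  using indep_entries[of n] unfolding indep_vars_def by force

lemma distr_row:
  assumes "k < n"
  shows "distr M (\<Pi>\<^sub>M i\<in>UNIV. borel) (\<lambda>\<omega> \<rho>. w n k \<omega> $ \<rho>) = gauss_PiM"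
proof -
  have "indep_vars (\<lambda>_. borel) (\<lambda>(k, \<rho>) \<omega>. w n k \<omega> $ \<rho>) (Pair k ` UNIV)"
    using assms by (intro indep_vars_subset[OF indep_entries]) auto
  then have "indep_vars (\<lambda>_. borel) (\<lambda>\<rho> \<omega>. w n k \<omega> $ \<rho>) UNIV"
    using indep_vars_image[of "\<lambda>_. borel" "\<lambda>(k, \<rho>) \<omega>. w n k \<omega> $ \<rho>" "Pair k" UNIV]
    by (simp add: inj_on_def)
  then have "distr M (\<Pi>\<^sub>M i\<in>UNIV. borel) (\<lambda>\<omega>. \<lambda>\<rho>\<in>UNIV. w n k \<omega> $ \<rho>) =
      (\<Pi>\<^sub>M \<rho>\<in>UNIV. distr M borel (\<lambda>\<omega>. w n k \<omega> $ \<rho>))"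
    using measurable_entry[OF assms] by (subst (asm) indep_vars_iff_distr_eq_PiM') auto
  then show ?thesis using assms distr_entries[of n k] by (simp add: restrict_UNIV)
qed

lemma indep_rows:
  assumes n: "n \<ge> 1" and f [measurable]: "f \<in> borel_measurable (\<Pi>\<^sub>M i\<in>UNIV. borel)"
  shows "indep_vars (\<lambda>_. borel) (\<lambda>k \<omega>. f (($) (w n k \<omega>)) :: real) {..<n}"
proof -
  have "indep_vars (\<lambda>k. \<Pi>\<^sub>M i\<in>{k} \<times> UNIV. borel)
      (\<lambda>k \<omega>. restrict (\<lambda>i. (\<lambda>(k, \<rho>) \<omega>. w n k \<omega> $ \<rho>) i \<omega>) ({k} \<times> UNIV)) {..<n}"
    by (rule indep_vars_restrict[OF indep_entries[OF n]]) (auto simp: disjoint_family_on_def)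
  then have "indep_vars (\<lambda>_. borel) (\<lambda>k \<omega>. (\<lambda>y. f (\<lambda>\<rho>. y (k, \<rho>)))
      (restrict (\<lambda>i. (\<lambda>(k, \<rho>) \<omega>. w n k \<omega> $ \<rho>) i \<omega>) ({k} \<times> UNIV))) {..<n}"
  proof (rule indep_vars_compose2)
    fix k :: nat
    have "(\<lambda>y \<rho>. y (k, \<rho>)) \<in> measurable (\<Pi>\<^sub>M i\<in>{k} \<times> (UNIV::'r set). borel :: real measure) (\<Pi>\<^sub>M i\<in>UNIV. borel)"
      by (rule measurable_PiM_single') (auto intro!: measurable_component_singleton)
    from measurable_compose[OF this f]
    show "(\<lambda>y. f (\<lambda>\<rho>. y (k, \<rho>))) \<in> borel_measurable (\<Pi>\<^sub>M i\<in>{k} \<times> UNIV. borel)" .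
  qed
  then show ?thesis by simp
qed

lemma measurable_row:
  assumes "k < n" shows "(\<lambda>\<omega> \<rho>. w n k \<omega> $ \<rho>) \<in> measurable M (\<Pi>\<^sub>M i\<in>UNIV. borel)"
  by (rule measurable_PiM_single') (auto intro: measurable_entry[OF assms])

lemma distr_row_function:
  assumes "k < n" "f \<in> borel_measurable (\<Pi>\<^sub>M i\<in>UNIV. borel)"
  shows "distr M borel (\<lambda>\<omega>. f (($) (w n k \<omega>)) :: real) = distr gauss_PiM borel f"
  using distr_distr[OF assms(2) measurable_row[OF assms(1)]] distr_row[OF assms(1)]
  by (simp add: o_def)

lemma row_integral:
  assumes "k < n" and [measurable]: "f \<in> borel_measurable (\<Pi>\<^sub>M i\<in>UNIV. borel)"
  shows "(LINT \<omega>|M. f (($) (w n k \<omega>)) :: real) = (LINT x|gauss_PiM. f x)"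
    and "integrable M (\<lambda>\<omega>. f (($) (w n k \<omega>))) \<longleftrightarrow> integrable gauss_PiM f"
  unfolding distr_row[OF assms(1), symmetric]
  using measurable_row[OF assms(1)] by (simp_all add: integral_distr integrable_distr_eq)

text \<open>The summands are independent copies of \<open>gquad C\<close> with variance 2 |C|^2. The
  case C = 0 is separate because \<open>clt_char\<close> asks for positive variance.\<close>

lemma quadratic_char_limit:
  fixes C :: "real^'r^'r"
  assumes "transpose C = C"
  shows "(\<lambda>n. LINT \<omega>|M. iexp (t * ((\<Sum>k<n. gquad C (($) (w n k \<omega>))) / sqrt (real n))))
    \<longlonglongrightarrow> exp (- (t\<^sup>2 * (2 * (norm C)\<^sup>2)) / 2)"
proof (cases "C = 0")
  case True
  then show ?thesis by (simp add: gquad_def prob_space)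
next
  case False
  define \<mu> where "\<mu> = distr gauss_PiM borel (gquad C)"
  interpret N: prob_space std_normal_distribution
    using real_dist_normal_dist by (simp add: real_distribution_def)
  interpret P: product_prob_space "\<lambda>_::'r. std_normal_distribution" UNIV ..
  have gm: "gquad C \<in> borel_measurable gauss_PiM"
    using measurable_gquad[of C] by (simp cong: measurable_cong_sets sets_PiM_cong)
  interpret \<mu>: real_distribution \<mu>
    unfolding \<mu>_def by (rule P.P.real_distribution_distr[OF gm])
  have "(\<lambda>n. char \<mu> (t / sqrt (real n)) ^ n) \<longlonglongrightarrow> exp (- (t\<^sup>2 * (sqrt 2 * norm C)\<^sup>2) / 2)"
    using gquad_moments[OF assms] gm False
    by (intro \<mu>.clt_char) (auto simp: \<mu>_def integral_distr integrable_distr_eq power_mult_distrib)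
  moreover have "\<forall>\<^sub>F n in sequentially. char \<mu> (t / sqrt (real n)) ^ n =
      (LINT \<omega>|M. iexp (t * ((\<Sum>k<n. gquad C (($) (w n k \<omega>))) / sqrt (real n))))"
  proof (rule eventually_sequentiallyI[of 1])
    fix n :: nat assume n: "n \<ge> 1"
    show "char \<mu> (t / sqrt (real n)) ^ n =
      (LINT \<omega>|M. iexp (t * ((\<Sum>k<n. gquad C (($) (w n k \<omega>))) / sqrt (real n))))"
      using char_iid_sum[OF indep_rows[OF n measurable_gquad], of C \<mu> "t / sqrt n"]
        distr_row_function[OF _ measurable_gquad, of _ n C] by (simp add: \<mu>_def)
  qed
  ultimately show ?thesis
    by (simp add: power_mult_distrib filterlim_cong)
qed

text \<open>Used only for tightness. The bound 2 is the variance of x^2 - 1, the case i = j; for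
  distinct indices the variance is 1.\<close>

lemma wick_sum_second_moment:
  assumes n: "n \<ge> 1"
  shows "integrable M (\<lambda>\<omega>. ((\<Sum>k<n. wick i j (($) (w n k \<omega>))) / sqrt (real n))\<^sup>2)"
    and "expectation (\<lambda>\<omega>. ((\<Sum>k<n. wick i j (($) (w n k \<omega>))) / sqrt (real n))\<^sup>2) \<le> 2"
proof -
  let ?X = "\<lambda>k \<omega>. wick i j (($) (w n k \<omega>))"
  have sq: "integrable M (\<lambda>\<omega>. (?X k \<omega>)\<^sup>2)" "expectation (\<lambda>\<omega>. (?X k \<omega>)\<^sup>2) \<le> 2" "expectation (?X k) = 0" if "k < n" for k
    using row_integral[OF that, of "\<lambda>x. (wick i j x)\<^sup>2"] row_integral[OF that, of "wick i j"]
      wick_moments(2)[of i j] wick_moments(3,4)[of i j i j]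
    by (simp_all add: power2_eq_square)
  have sum: "integrable M (\<lambda>\<omega>. (\<Sum>k<n. ?X k \<omega>)\<^sup>2)"
    "expectation (\<lambda>\<omega>. (\<Sum>k<n. ?X k \<omega>)\<^sup>2) = (\<Sum>k<n. expectation (\<lambda>\<omega>. (?X k \<omega>)\<^sup>2))"
    using second_moment_indep_sum[of "{..<n}" ?X] indep_rows[OF n measurable_wick] sq by auto
  have le: "(\<Sum>k<n. expectation (\<lambda>\<omega>. (?X k \<omega>)\<^sup>2)) \<le> (\<Sum>k<n. 2)"
    using sq by (intro sum_mono) auto
  show "integrable M (\<lambda>\<omega>. ((\<Sum>k<n. ?X k \<omega>) / sqrt (real n))\<^sup>2)"
    using sum(1) by (simp add: power_divide)
  show "expectation (\<lambda>\<omega>. ((\<Sum>k<n. ?X k \<omega>) / sqrt (real n))\<^sup>2) \<le> 2"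
    using sum(2) le n by (simp add: power_divide divide_le_eq)
qed

end

section \<open>Convergence of Laplace transforms\<close>

text \<open>The step function vanishes from y on, so cutting exp (- t) off below at exp (- y)
  changes nothing. It thereby becomes a continuous function of u = exp (- t) on the closed unit
  interval, including u = 0.\<close>

lemma cts_step_as_exp:
  assumes "x < y" "t \<ge> 0"
  shows "cts_step x y t = cts_step x y (- ln (max (exp (- t)) (exp (- y))))"
proof (cases "t \<le> y")
  case True
  then show ?thesis by (simp add: max_def)
next
  case False
  then have "cts_step x y t = 0" "cts_step x y y = 0"
    using assms by (simp_all add: cts_step_def)
  then show ?thesis using False by (simp add: max_def)
qed

text \<open>For nonnegative t a continuous step is a continuous function of u = exp (- t). By
  Weierstrass it is uniformly close to a polynomial in u, whose expectation is a combination of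
  Laplace transforms at natural numbers. Hence convergence at natural \<open>k\<close>
  suffices.\<close>

lemma laplace_imp_weak_conv:
  fixes X :: "nat \<Rightarrow> 'a \<Rightarrow> real" and \<nu> :: "real measure"
  assumes M: "prob_space M" and X: "\<And>n. X n \<in> borel_measurable M" "\<And>n \<omega>. \<omega> \<in> space M \<Longrightarrow> 0 \<le> X n \<omega>"
    and \<nu>: "real_distribution \<nu>" "AE t in \<nu>. 0 \<le> t"
    and lim: "\<And>k::nat. (\<lambda>n. LINT \<omega>|M. exp (- (real k * X n \<omega>))) \<longlonglongrightarrow> (LINT t|\<nu>. exp (- (real k * t)))"
  shows "weak_conv_m (\<lambda>n. distr M borel (X n)) \<nu>"
proof (rule integral_cts_step_conv_imp_weak_conv)
  interpret M: prob_space M by fact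
  interpret \<nu>: real_distribution \<nu> by fact
  show "real_distribution (distr M borel (X n))" for n
    by (rule M.real_distribution_distr[OF X(1)])
  fix x y :: real assume xy: "x < y"
  let ?f = "cts_step x y"
  define g where "g u = ?f (- ln (max u (exp (- y))))" for u
  have pos: "0 < max u (exp (- y))" for u by (simp add: less_max_iff_disj)
  have "continuous_on UNIV ?f"
    by (rule uniformly_continuous_imp_continuous[OF cts_step_uniformly_continuous[OF xy]])
  moreover have "continuous_on {0..1} (\<lambda>u. - ln (max u (exp (- y))))"
    using pos by (intro continuous_on_minus continuous_on_ln continuous_on_max continuous_on_id continuous_on_const)
      (metis less_irrefl)
  ultimately have "continuous_on {0..1} g"
    unfolding g_def by (rule continuous_on_compose2) auto
  have fm [measurable]: "?f \<in> borel_measurable borel"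
    by (rule borel_measurable_continuous_onI[OF uniformly_continuous_imp_continuous[OF cts_step_uniformly_continuous[OF xy]]])
  have bnd: "\<bar>?f t\<bar> \<le> 1" for t
    using xy by (auto simp: cts_step_def field_simps)
  show "(\<lambda>n. integral\<^sup>L (distr M borel (X n)) ?f) \<longlonglongrightarrow> integral\<^sup>L \<nu> ?f"
  proof (rule LIMSEQ_I)
    fix e :: real assume e: "0 < e"
    obtain p where p: "real_polynomial_function p" "\<And>u. u \<in> {0..1} \<Longrightarrow> \<bar>g u - p u\<bar> < e / 3"
      using Stone_Weierstrass_real_polynomial_function[of "{0..1}" g "e / 3"] \<open>continuous_on {0..1} g\<close> e
      by auto
    obtain a N where a: "p = (\<lambda>u. \<Sum>i\<le>N. a i * u ^ i)"
      using p(1) by (auto simp: real_polynomial_function_iff_sum)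
    define q where "q t = (\<Sum>i\<le>N. a i * exp (- (real i * t)))" for t
    have q: "\<bar>?f t - q t\<bar> \<le> e / 3" if "t \<ge> 0" for t
      using p(2)[of "exp (- t)"] that cts_step_as_exp[OF xy that]
      by (simp add: g_def a q_def exp_of_nat_mult[symmetric])
    have qm [measurable]: "q \<in> borel_measurable borel"
      unfolding q_def[abs_def] by measurable
    have expM: "integrable M (\<lambda>\<omega>. exp (- (real i * X n \<omega>)))" for i n
      using X by (intro M.integrable_const_bound[where B = 1]) (auto intro!: AE_I2)
    have exp\<nu>: "integrable \<nu> (\<lambda>t. exp (- (real i * t)))" for i
      using \<nu>(2) by (intro \<nu>.integrable_const_bound[where B = 1]) auto
    have fM: "integrable M (\<lambda>\<omega>. ?f (X n \<omega>))" for n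
      using X bnd by (intro M.integrable_const_bound[where B = 1]) (auto intro!: AE_I2 measurable_compose[OF X(1)])
    have f\<nu>: "integrable \<nu> ?f"
      using bnd by (intro \<nu>.integrable_const_bound[where B = 1]) auto
    have "(\<lambda>n. LINT \<omega>|M. q (X n \<omega>)) \<longlonglongrightarrow> (LINT t|\<nu>. q t)"
      unfolding q_def using expM exp\<nu> by (simp add: tendsto_sum tendsto_mult_left lim)
    from LIMSEQ_D[OF this, of "e / 3"] e
    obtain n0 where n0: "\<And>n. n \<ge> n0 \<Longrightarrow> \<bar>(LINT \<omega>|M. q (X n \<omega>)) - (LINT t|\<nu>. q t)\<bar> < e / 3"
      unfolding real_norm_def by (metis divide_pos_pos zero_less_numeral)
    have qM: "integrable M (\<lambda>\<omega>. q (X n \<omega>))" and q\<nu>: "integrable \<nu> q" for n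
      unfolding q_def[abs_def] using expM exp\<nu> by auto
    have 1: "\<bar>(LINT \<omega>|M. ?f (X n \<omega>)) - (LINT \<omega>|M. q (X n \<omega>))\<bar> \<le> e / 3" for n
    proof -
      have "\<bar>LINT \<omega>|M. ?f (X n \<omega>) - q (X n \<omega>)\<bar> \<le> (LINT \<omega>|M. \<bar>?f (X n \<omega>) - q (X n \<omega>)\<bar>)"
        by (rule integral_abs_bound)
      also have "\<dots> \<le> (LINT \<omega>|M. e / 3)"
        using fM qM q X(2) by (intro integral_mono) auto
      finally show ?thesis using fM qM by (simp add: M.prob_space)
    qed
    have 2: "\<bar>(LINT t|\<nu>. ?f t) - (LINT t|\<nu>. q t)\<bar> \<le> e / 3"
    proof -
      have "\<bar>LINT t|\<nu>. ?f t - q t\<bar> \<le> (LINT t|\<nu>. \<bar>?f t - q t\<bar>)"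
        by (rule integral_abs_bound)
      also have "\<dots> \<le> (LINT t|\<nu>. e / 3)"
        using f\<nu> q\<nu> \<nu>(2) q by (intro integral_mono_AE) auto
      finally show ?thesis using f\<nu> q\<nu> \<nu>.prob_space by simp
    qed
    have "\<bar>integral\<^sup>L (distr M borel (X n)) ?f - integral\<^sup>L \<nu> ?f\<bar> < e" if "n \<ge> n0" for n
    proof -
      have "integral\<^sup>L (distr M borel (X n)) ?f = (LINT \<omega>|M. ?f (X n \<omega>))"
        using X(1) by (simp add: integral_distr)
      then show ?thesis using 1[of n] 2 n0[OF that] by linarith
    qed
    then show "\<exists>n0. \<forall>n\<ge>n0. norm (integral\<^sup>L (distr M borel (X n)) ?f - integral\<^sup>L \<nu> ?f) < e"
      by auto
  qed
qed fact

section \<open>The chi-squared limit\<close>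

lemma chi_squared_sum_measurable:
  "(\<lambda>x. \<Sum>i<r. (x i)\<^sup>2) \<in> borel_measurable (\<Pi>\<^sub>M i\<in>{..<r}. std_normal_distribution)"
  by measurable

lemma prob_space_normal_PiM: "prob_space (\<Pi>\<^sub>M i\<in>I. std_normal_distribution)"
  using real_dist_normal_dist by (intro prob_space_PiM) (simp add: real_distribution_def)

lemma real_distribution_chi_squared: "real_distribution (chi_squared r)"
  unfolding chi_squared_def
  by (rule prob_space.real_distribution_distr[OF prob_space_normal_PiM chi_squared_sum_measurable])

lemma AE_chi_squared: "AE t in chi_squared r. 0 \<le> t"
  unfolding chi_squared_def
  by (subst AE_distr_iff[OF chi_squared_sum_measurable]) (auto intro!: AE_I2 sum_nonneg)

text \<open>\<open>exp (-\<beta> |y|\<^sup>2)\<close> is a Gaussian average of the characters \<open>exp (i \<surd>(2\<beta>) x \<bullet> y)\<close>, so the Laplace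
  transform of a squared length is an average of values of the characteristic function.\<close>

lemma laplace_sum_squares:
  fixes Y :: "nat \<Rightarrow> nat \<Rightarrow> 'a \<Rightarrow> real"
  assumes M: "prob_space M" and Y [measurable]: "\<And>n j. j < r \<Longrightarrow> Y n j \<in> borel_measurable M"
    and lim: "\<And>x. (\<lambda>n. LINT \<omega>|M. iexp (\<Sum>j<r. x j * Y n j \<omega>)) \<longlonglongrightarrow> exp (- (\<Sum>j<r. (x j)\<^sup>2) / 2)"
    and \<beta>: "\<beta> \<ge> 0"
  shows "(\<lambda>n. LINT \<omega>|M. exp (- (\<beta> * (\<Sum>j<r. (Y n j \<omega>)\<^sup>2)))) \<longlonglongrightarrow>
    (LINT t|chi_squared r. exp (- (\<beta> * t)))"
proof -
  interpret M: prob_space M by fact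
  let ?N = "\<Pi>\<^sub>M i\<in>{..<r}. std_normal_distribution"
  interpret S: prob_space std_normal_distribution
    using real_dist_normal_dist by (simp add: real_distribution_def)
  interpret PS: product_sigma_finite "\<lambda>_::nat. std_normal_distribution" ..
  interpret N: prob_space ?N by (rule prob_space_normal_PiM)
  interpret MN: pair_prob_space M ?N ..
  \<comment> \<open>With this c the Gaussian characteristic function at c y is exp (- \<beta>
    y^2).\<close>
  define c where "c = sqrt (2 * \<beta>)"
  have c: "c\<^sup>2 = 2 * \<beta>" using \<beta> by (simp add: c_def)
  define h where "h n \<omega> x = iexp (\<Sum>j<r. (c * x j) * Y n j \<omega>)" for n \<omega> and x :: "nat \<Rightarrow> real"
  have hm [measurable]: "(\<lambda>(\<omega>, x). h n \<omega> x) \<in> borel_measurable (M \<Otimes>\<^sub>M ?N)" for n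
    unfolding h_def by measurable
  have norm_h: "norm (h n \<omega> x) = 1" for n \<omega> x
    unfolding h_def by simp
  have int_h: "integrable (M \<Otimes>\<^sub>M ?N) (\<lambda>(\<omega>, x). h n \<omega> x)" for n
    by (rule MN.P.integrable_const_bound[where B = 1]) (auto simp: norm_h split: prod.split)
  have inner: "(LINT x|?N. h n \<omega> x) = of_real (exp (- (\<beta> * (\<Sum>j<r. (Y n j \<omega>)\<^sup>2))))" for n \<omega>
  proof -
    have "(LINT x|?N. h n \<omega> x) = (LINT x|?N. (\<Prod>j<r. iexp ((c * Y n j \<omega>) * x j)))"
      unfolding h_def by (simp add: exp_sum sum_distrib_left[symmetric] flip: of_real_sum) (simp add: exp_sum sum_distrib_left ac_simps)
    also have "\<dots> = (\<Prod>j<r. LINT u|std_normal_distribution. iexp ((c * Y n j \<omega>) * u))"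
      by (intro PS.product_integral_prod S.integrable_const_bound[where B = 1]) auto
    also have "\<dots> = (\<Prod>j<r. char std_normal_distribution (c * Y n j \<omega>))"
      by (simp add: char_def)
    also have "\<dots> = of_real (\<Prod>j<r. exp (- (\<beta> * (Y n j \<omega>)\<^sup>2)))"
      by (simp add: char_std_normal_distribution power_mult_distrib c)
    also have "\<dots> = of_real (exp (- (\<beta> * (\<Sum>j<r. (Y n j \<omega>)\<^sup>2))))"
      by (simp add: exp_sum[symmetric] sum_negf sum_distrib_left)
    finally show ?thesis .
  qed
  have swap: "of_real (LINT \<omega>|M. exp (- (\<beta> * (\<Sum>j<r. (Y n j \<omega>)\<^sup>2)))) = (LINT x|?N. LINT \<omega>|M. h n \<omega> x)" for n
  proof -
    have "(LINT x|?N. LINT \<omega>|M. h n \<omega> x) = (LINT \<omega>|M. LINT x|?N. h n \<omega> x)"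
      by (rule MN.Fubini_integral[OF int_h])
    then show ?thesis by (simp add: inner)
  qed
  \<comment> \<open>After Fubini the limit is taken inside for each fixed Gaussian argument x. The
    limiting characteristic function at c x is again exp (- \<beta> |x|^2), so its average over x is
    the Laplace transform of the chi-squared law.\<close>
  have "(\<lambda>n. LINT x|?N. LINT \<omega>|M. h n \<omega> x) \<longlonglongrightarrow> (LINT x|?N. complex_of_real (exp (- (\<beta> * (\<Sum>j<r. (x j)\<^sup>2)))))"
  proof (rule integral_dominated_convergence[where w = "\<lambda>_. 1"])
    show "(\<lambda>x. LINT \<omega>|M. h n \<omega> x) \<in> borel_measurable ?N" for n
    proof (rule M.borel_measurable_lebesgue_integral)
      show "(\<lambda>(x, \<omega>). h n \<omega> x) \<in> borel_measurable (?N \<Otimes>\<^sub>M M)"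
        unfolding h_def by measurable
    qed
    show "AE x in ?N. (\<lambda>n. LINT \<omega>|M. h n \<omega> x) \<longlonglongrightarrow> complex_of_real (exp (- (\<beta> * (\<Sum>j<r. (x j)\<^sup>2))))"
    proof (rule AE_I2)
      fix x
      have "- (\<Sum>j<r. (c * x j)\<^sup>2) / 2 = - (\<beta> * (\<Sum>j<r. (x j)\<^sup>2))"
        by (simp add: power_mult_distrib c sum_distrib_left[symmetric] mult.assoc)
      then show "(\<lambda>n. LINT \<omega>|M. h n \<omega> x) \<longlonglongrightarrow> complex_of_real (exp (- (\<beta> * (\<Sum>j<r. (x j)\<^sup>2))))"
        using lim[of "\<lambda>j. c * x j"] unfolding h_def by simp
    qed
    show "AE x in ?N. norm (LINT \<omega>|M. h n \<omega> x) \<le> 1" for n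
    proof (rule AE_I2)
      fix x
      have "norm (LINT \<omega>|M. h n \<omega> x) \<le> (LINT \<omega>|M. norm (h n \<omega> x))"
        by (rule integral_norm_bound)
      then show "norm (LINT \<omega>|M. h n \<omega> x) \<le> 1" by (simp add: norm_h M.prob_space)
    qed
  qed auto
  then have "(\<lambda>n. complex_of_real (LINT \<omega>|M. exp (- (\<beta> * (\<Sum>j<r. (Y n j \<omega>)\<^sup>2))))) \<longlonglongrightarrow>
      complex_of_real (LINT x|?N. exp (- (\<beta> * (\<Sum>j<r. (x j)\<^sup>2))))"
    unfolding swap by simp
  then have "(\<lambda>n. LINT \<omega>|M. exp (- (\<beta> * (\<Sum>j<r. (Y n j \<omega>)\<^sup>2)))) \<longlonglongrightarrow>
      (LINT x|?N. exp (- (\<beta> * (\<Sum>j<r. (x j)\<^sup>2))))"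
    by (simp only: tendsto_of_real_iff)
  moreover have "(LINT t|chi_squared r. exp (- (\<beta> * t))) = (LINT x|?N. exp (- (\<beta> * (\<Sum>j<r. (x j)\<^sup>2))))"
    unfolding chi_squared_def by (rule integral_distr[OF chi_squared_sum_measurable]) measurable
  ultimately show ?thesis by simp
qed

section \<open>Cross variation with a smooth path\<close>

definition incr :: "real \<Rightarrow> nat \<Rightarrow> (real \<Rightarrow> 'v::ab_group_add) \<Rightarrow> nat \<Rightarrow> 'v" where
  "incr T n f k = f (real (Suc k) * (T / real n)) - f (real k * (T / real n))"

definition cross_var :: "real \<Rightarrow> nat \<Rightarrow> (real \<Rightarrow> real) \<Rightarrow> (real \<Rightarrow> real) \<Rightarrow> real" where
  "cross_var T n f g = (\<Sum>k<n. incr T n f k * incr T n g k)"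

lemma grid_in_interval:
  assumes "T > 0" "k \<le> n" shows "real k * (T / real n) \<in> {0..T}"
proof (cases "n = 0")
  case False
  then have "real k / real n \<le> 1" using assms by simp
  then have "real k / real n * T \<le> 1 * T" using assms by (intro mult_right_mono) auto
  then show ?thesis using assms by simp
qed (use assms in auto)

lemma sum_by_parts:
  fixes g c :: "nat \<Rightarrow> real"
  shows "(\<Sum>k<n. (g (Suc k) - g k) * c k) = g n * c n - g 0 * c 0 - (\<Sum>k<n. g (Suc k) * (c (Suc k) - c k))"
  by (induction n) (simp_all add: algebra_simps)

text \<open>The density \<open>b\<close> is approximated uniformly by a polynomial. The error is controlled by the
  Cauchy-Schwarz inequality, and the polynomial, being Lipschitz, allows summation by parts, which only
  needs that \<open>g\<close> is bounded.\<close>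

lemma cross_variation_bound:
  fixes g b f :: "real \<Rightarrow> real"
  assumes T: "T > 0" and g: "continuous_on {0..T} g" and b: "continuous_on {0..T} b"
    and f: "\<And>t. t \<in> {0..T} \<Longrightarrow> f t = c0 + integral {0..t} b" and e: "e > 0"
  shows "\<exists>C. \<forall>n\<ge>1. \<bar>sqrt (real n) * cross_var T n g f\<bar> \<le>
    (T * e + C / sqrt (real n)) * (1 + sqrt (\<Sum>k<n. (incr T n g k)\<^sup>2))"
proof -
  obtain p where p: "real_polynomial_function p" "\<And>t. t \<in> {0..T} \<Longrightarrow> \<bar>b t - p t\<bar> < e"
    using Stone_Weierstrass_real_polynomial_function[OF compact_Icc b e] by blast
  obtain p' where p': "real_polynomial_function p'" "\<And>t. (p has_real_derivative p' t) (at t)"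
    using has_real_derivative_polynomial_function[OF p(1)] by blast
  have bounded: "\<exists>B. B \<ge> 0 \<and> (\<forall>t\<in>{0..T}. \<bar>u t\<bar> \<le> B)" if "continuous_on {0..T} u" for u :: "real \<Rightarrow> real"
  proof -
    have "bounded (u ` {0..T})"
      by (intro compact_imp_bounded compact_continuous_image that compact_Icc)
    then show ?thesis unfolding bounded_pos by (auto intro: less_imp_le)
  qed
  have cont: "continuous_on {0..T} q" if "real_polynomial_function q" for q :: "real \<Rightarrow> real"
    using that continuous_on_polymonial_function real_polynomial_function_eq by blast
  obtain G where G: "G \<ge> 0" "\<And>t. t \<in> {0..T} \<Longrightarrow> \<bar>g t\<bar> \<le> G" using bounded[OF g] by blast
  obtain B where B: "B \<ge> 0" "\<And>t. t \<in> {0..T} \<Longrightarrow> \<bar>p t\<bar> \<le> B" using bounded[OF cont[OF p(1)]] by blast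
  obtain L where L: "L \<ge> 0" "\<And>t. t \<in> {0..T} \<Longrightarrow> \<bar>p' t\<bar> \<le> L" using bounded[OF cont[OF p'(1)]] by blast
  have lip: "\<bar>p s - p t\<bar> \<le> L * \<bar>s - t\<bar>" if "s \<in> {0..T}" "t \<in> {0..T}" for s t
    using field_differentiable_bound[of "{0..T}" p p' L s t] that L(2) p'(2)
    by (auto intro: has_field_derivative_at_within)
  \<comment> \<open>The first term stems from the Lipschitz error of freezing \<open>p\<close> on
    each step, the second from the boundary terms and the remaining sum of the summation by
    parts.\<close>
  define C where "C = L * T\<^sup>2 + T * G * (2 * B + L * T)"
  have "\<bar>sqrt (real n) * cross_var T n g f\<bar> \<le>
      (T * e + C / sqrt (real n)) * (1 + sqrt (\<Sum>k<n. (incr T n g k)\<^sup>2))" if n: "n \<ge> 1" for n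
  proof -
    define h where "h = T / real n"
    define t where "t k = real k * h" for k
    have h: "h > 0" "real n * h = T" using T n by (auto simp: h_def)
    have t: "t k \<in> {0..T}" if "k \<le> n" for k
      unfolding t_def h_def by (rule grid_in_interval[OF T that])
    have ts: "t (Suc k) = t k + h" for k by (simp add: t_def algebra_simps)
    have tinc: "incr T n u k = u (t (Suc k)) - u (t k)" for u :: "real \<Rightarrow> real" and k
      unfolding incr_def t_def h_def by simp
    define S where "S = sqrt (\<Sum>k<n. (incr T n g k)\<^sup>2)"
    have S: "S \<ge> 0" unfolding S_def by (intro real_sqrt_ge_zero sum_nonneg) auto
    \<comment> \<open>Per unit of time, replacing \<open>b\<close> by \<open>p\<close> costs
      \<open>e\<close> and freezing \<open>p\<close> at the left end point costs
      \<open>L * h\<close>.\<close>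
    have rest: "\<bar>incr T n f k - h * p (t k)\<bar> \<le> h * (e + L * h)" if k: "k < n" for k
    proof -
      have tk: "t k \<in> {0..T}" "t (Suc k) \<in> {0..T}" "t k \<le> t (Suc k)"
        using k h t[of k] t[of "Suc k"] by (auto simp: ts)
      have int: "b integrable_on {t k..t (Suc k)}"
        by (rule integrable_continuous_interval[OF continuous_on_subset[OF b]]) (use tk in auto)
      have "integral {0..t k} b + integral {t k..t (Suc k)} b = integral {0..t (Suc k)} b"
        using tk by (intro Henstock_Kurzweil_Integration.integral_combine
            integrable_continuous_interval[OF continuous_on_subset[OF b]]) auto
      then have "incr T n f k = integral {t k..t (Suc k)} b"
        by (simp add: tinc f[OF tk(1)] f[OF tk(2)])
      also have "\<dots> - h * p (t k) = integral {t k..t (Suc k)} (\<lambda>s. b s - p (t k))"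
        using int h by (subst Henstock_Kurzweil_Integration.integral_diff) (auto simp: ts)
      also have "\<bar>\<dots>\<bar> \<le> (e + L * h) * (t (Suc k) - t k)"
        unfolding real_norm_def[symmetric]
      proof (rule integral_bound)
        show "t k \<le> t (Suc k)" by fact
        show "continuous_on {t k..t (Suc k)} (\<lambda>s. b s - p (t k))"
          by (intro continuous_intros continuous_on_subset[OF b]) (use tk in auto)
        fix s assume s: "s \<in> {t k..t (Suc k)}"
        then have sT: "s \<in> {0..T}" using tk by auto
        have "\<bar>p s - p (t k)\<bar> \<le> L * \<bar>s - t k\<bar>" by (rule lip[OF sT tk(1)])
        also have "\<dots> \<le> L * h" using s L(1) by (intro mult_left_mono) (auto simp: ts)
        finally show "norm (b s - p (t k)) \<le> e + L * h" using p(2)[OF sT] by simp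
      qed
      finally show ?thesis by (simp add: ts mult.commute)
    qed
    have cs: "(\<Sum>k<n. \<bar>incr T n g k\<bar>) \<le> sqrt (real n) * S"
    proof -
      have "(\<Sum>k<n. \<bar>incr T n g k\<bar>)\<^sup>2 \<le> (\<Sum>k<n. (incr T n g k)\<^sup>2) * real n"
        using sum_squared_le_sum_of_squares[of "\<lambda>k. \<bar>incr T n g k\<bar>" "{..<n}"] by simp
      then show ?thesis
        unfolding S_def by (subst real_sqrt_mult[symmetric], intro real_le_rsqrt) (simp add: mult.commute)
    qed
    have 1: "\<bar>\<Sum>k<n. incr T n g k * (incr T n f k - h * p (t k))\<bar> \<le> h * (e + L * h) * (sqrt (real n) * S)"
    proof -
      have "\<bar>\<Sum>k<n. incr T n g k * (incr T n f k - h * p (t k))\<bar> \<le>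
          (\<Sum>k<n. \<bar>incr T n g k\<bar> * (h * (e + L * h)))"
        using rest by (intro order_trans[OF sum_abs] sum_mono) (simp add: abs_mult mult_left_mono)
      also have "\<dots> = h * (e + L * h) * (\<Sum>k<n. \<bar>incr T n g k\<bar>)"
        by (simp add: sum_distrib_right[symmetric] mult.commute)
      also have "\<dots> \<le> h * (e + L * h) * (sqrt (real n) * S)"
        using cs h e L(1) by (intro mult_left_mono) auto
      finally show ?thesis .
    qed
    \<comment> \<open>This part is O(h), so it is O(1 / sqrt n) even after multiplication by sqrt n.
      The Cauchy-Schwarz part stays of order one but carries the small factor
      \<open>e\<close>.\<close>
    have 2: "\<bar>\<Sum>k<n. incr T n g k * (h * p (t k))\<bar> \<le> h * (G * (2 * B + L * T))"
    proof -
      have "(\<Sum>k<n. incr T n g k * (h * p (t k))) = h * (\<Sum>k<n. (g (t (Suc k)) - g (t k)) * p (t k))"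
        by (simp add: tinc sum_distrib_left ac_simps)
      also have "(\<Sum>k<n. (g (t (Suc k)) - g (t k)) * p (t k)) =
          g (t n) * p (t n) - g (t 0) * p (t 0) - (\<Sum>k<n. g (t (Suc k)) * (p (t (Suc k)) - p (t k)))"
        by (rule sum_by_parts)
      also have "\<bar>h * \<dots>\<bar> \<le> h * (G * B + G * B + (\<Sum>k<n. G * (L * h)))"
      proof -
        have gp: "\<bar>g (t k) * p (t k)\<bar> \<le> G * B" if "k \<le> n" for k
          unfolding abs_mult using G B t[OF that] by (intro mult_mono) auto
        have "\<bar>g (t (Suc k)) * (p (t (Suc k)) - p (t k))\<bar> \<le> G * (L * h)" if "k < n" for k
        proof -
          have "\<bar>p (t (Suc k)) - p (t k)\<bar> \<le> L * \<bar>t (Suc k) - t k\<bar>"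
            using that by (intro lip t) auto
          then have "\<bar>p (t (Suc k)) - p (t k)\<bar> \<le> L * h" using h by (simp add: ts)
          then show ?thesis
            unfolding abs_mult using G t[of "Suc k"] that by (intro mult_mono) auto
        qed
        then have "\<bar>\<Sum>k<n. g (t (Suc k)) * (p (t (Suc k)) - p (t k))\<bar> \<le> (\<Sum>k<n. G * (L * h))"
          by (intro order_trans[OF sum_abs] sum_mono) auto
        then have "\<bar>g (t n) * p (t n) - g (t 0) * p (t 0) - (\<Sum>k<n. g (t (Suc k)) * (p (t (Suc k)) - p (t k)))\<bar>
            \<le> G * B + G * B + (\<Sum>k<n. G * (L * h))"
          using gp[of n] gp[of 0] by linarith
        then show ?thesis using h by (simp add: abs_mult)
      qed
      also have "(\<Sum>k<n. G * (L * h)) = G * (L * T)"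
        using h(2) by (simp add: algebra_simps)
      finally show ?thesis by (simp add: algebra_simps)
    qed
    have "cross_var T n g f =
        (\<Sum>k<n. incr T n g k * (incr T n f k - h * p (t k))) + (\<Sum>k<n. incr T n g k * (h * p (t k)))"
      by (simp add: cross_var_def sum.distrib[symmetric] algebra_simps)
    then have "\<bar>cross_var T n g f\<bar> \<le>
        h * (e + L * h) * (sqrt (real n) * S) + h * (G * (2 * B + L * T))"
      using 1 2 by linarith
    then have "\<bar>sqrt (real n) * cross_var T n g f\<bar> \<le>
        sqrt (real n) * (h * (e + L * h) * (sqrt (real n) * S) + h * (G * (2 * B + L * T)))"
      by (simp add: abs_mult mult_left_mono)
    also have "\<dots> = T * (e + L * h) * S + sqrt (real n) * h * (G * (2 * B + L * T))"
    proof -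
      have "sqrt (real n) * (h * (e + L * h) * (sqrt (real n) * S)) =
          (sqrt (real n) * sqrt (real n)) * h * (e + L * h) * S"
        by (simp only: ac_simps)
      also have "\<dots> = T * (e + L * h) * S" using h(2) by simp
      finally show ?thesis by (simp add: algebra_simps)
    qed
    also have "sqrt (real n) * h = T / sqrt (real n)"
    proof -
      have "sqrt (real n) * (sqrt (real n) * h) = T"
        using h(2) by (simp add: mult.assoc[symmetric])
      then show ?thesis using n by (simp add: field_simps)
    qed
    also have "T * (e + L * h) * S + T / sqrt (real n) * (G * (2 * B + L * T)) \<le>
        (T * e + C / sqrt (real n)) * (1 + S)"
    proof -
      have "sqrt (real n) \<le> real n" using n by (simp add: real_le_lsqrt power2_eq_square)
      then have "h \<le> T / sqrt (real n)" unfolding h_def using T n by (intro divide_left_mono) auto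
      then have "L * h \<le> L * T / sqrt (real n)" using L(1) mult_left_mono by fastforce
      then have "T * (e + L * h) * S \<le> T * (e + L * T / sqrt (real n)) * S"
        using T S by (intro mult_right_mono mult_left_mono) auto
      also have "\<dots> \<le> T * (e + L * T / sqrt (real n)) * (1 + S)"
        using T S e L(1) by (intro mult_left_mono) auto
      moreover have "T / sqrt (real n) * (G * (2 * B + L * T)) * 1 \<le> T / sqrt (real n) * (G * (2 * B + L * T)) * (1 + S)"
        using T S G(1) B(1) L(1) by (intro mult_left_mono) auto
      moreover have "T * (e + L * T / sqrt (real n)) * (1 + S) + T / sqrt (real n) * (G * (2 * B + L * T)) * (1 + S) =
          (T * e + C / sqrt (real n)) * (1 + S)"
        by (simp add: C_def add_divide_distrib power2_eq_square algebra_simps)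
      ultimately show ?thesis by linarith
    qed
    finally show ?thesis by (simp add: S_def)
  qed
  then show ?thesis by blast
qed

lemma cross_variation_vanishes:
  fixes g b f :: "real \<Rightarrow> real"
  assumes T: "T > 0" and g: "continuous_on {0..T} g" and b: "continuous_on {0..T} b"
    and f: "\<And>t. t \<in> {0..T} \<Longrightarrow> f t = c0 + integral {0..t} b"
    and S: "\<And>n. sqrt (\<Sum>k<n. (incr T n g k)\<^sup>2) \<le> S n"
  shows "(\<lambda>n. sqrt (real n) * cross_var T n g f / (1 + S n)) \<longlonglongrightarrow> 0"
proof (rule LIMSEQ_I)
  fix e :: real assume e: "0 < e"
  obtain C where C: "\<And>n. n \<ge> 1 \<Longrightarrow> \<bar>sqrt (real n) * cross_var T n g f\<bar> \<le>
      (T * (e / (2 * T)) + C / sqrt (real n)) * (1 + sqrt (\<Sum>k<n. (incr T n g k)\<^sup>2))"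
    using cross_variation_bound[OF T g b f, of "e / (2 * T)"] e T by auto
  have "(\<lambda>n. C / sqrt (real n)) \<longlonglongrightarrow> 0"
    by (intro tendsto_divide_0[OF tendsto_const] filterlim_at_top_imp_at_infinity
        filterlim_compose[OF sqrt_at_top filterlim_real_sequentially])
  then obtain n0 where n0: "\<And>n. n \<ge> n0 \<Longrightarrow> \<bar>C / sqrt (real n)\<bar> < e / 2"
    using LIMSEQ_D[of "\<lambda>n. C / sqrt (real n)" 0 "e / 2"] e by auto
  have "\<bar>sqrt (real n) * cross_var T n g f / (1 + S n)\<bar> < e" if "n \<ge> max n0 1" for n
  proof -
    let ?s = "sqrt (\<Sum>k<n. (incr T n g k)\<^sup>2)"
    have s: "0 \<le> ?s" by (intro real_sqrt_ge_zero sum_nonneg) auto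
    have "\<bar>sqrt (real n) * cross_var T n g f\<bar> \<le> (T * (e / (2 * T)) + C / sqrt (real n)) * (1 + ?s)"
      using C that by simp
    also have "\<dots> < e * (1 + ?s)"
    proof (rule mult_strict_right_mono)
      have "T * (e / (2 * T)) = e / 2" using T by simp
      moreover have "C / sqrt (real n) < e / 2" using n0[of n] that by linarith
      ultimately show "T * (e / (2 * T)) + C / sqrt (real n) < e" by linarith
      show "0 < 1 + ?s" using s by linarith
    qed
    also have "\<dots> \<le> e * (1 + S n)" using S[of n] e by simp
    finally have lt: "\<bar>sqrt (real n) * cross_var T n g f\<bar> < e * (1 + S n)" .
    have "0 < 1 + S n" using s S[of n] by linarith
    with lt show ?thesis by (simp only: abs_divide abs_of_pos pos_divide_less_eq)
  qed
  then show "\<exists>n0. \<forall>n\<ge>n0. norm (sqrt (real n) * cross_var T n g f / (1 + S n) - 0) < e"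
    by (intro exI[of _ "max n0 1"]) auto
qed

lemma incr_integral_bound:
  fixes b f :: "real \<Rightarrow> real"
  assumes T: "T > 0" and b: "continuous_on {0..T} b" "\<And>t. t \<in> {0..T} \<Longrightarrow> \<bar>b t\<bar> \<le> B"
    and f: "\<And>t. t \<in> {0..T} \<Longrightarrow> f t = c0 + integral {0..t} b" and k: "k < n"
  shows "\<bar>incr T n f k\<bar> \<le> B * (T / real n)"
proof -
  let ?s = "real k * (T / real n)" and ?t = "real (Suc k) * (T / real n)"
  have st: "?s \<in> {0..T}" "?t \<in> {0..T}" using grid_in_interval[OF T, of k n] grid_in_interval[OF T, of "Suc k" n] k by auto
  have ts: "?t - ?s = T / real n" by (simp add: algebra_simps add_divide_distrib)
  then have le: "?s \<le> ?t" using T by (smt (verit) divide_nonneg_nonneg of_nat_0_le_iff)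
  have "integral {0..?s} b + integral {?s..?t} b = integral {0..?t} b"
    using st le by (intro Henstock_Kurzweil_Integration.integral_combine
        integrable_continuous_interval[OF continuous_on_subset[OF b(1)]]) auto
  then have "incr T n f k = integral {?s..?t} b"
    unfolding incr_def by (simp only: f[OF st(1)] f[OF st(2)])
  moreover have "norm (integral {?s..?t} b) \<le> B * (?t - ?s)"
    by (rule integral_bound[OF le continuous_on_subset[OF b(1)]]) (use st b(2) in auto)
  ultimately show ?thesis by (simp only: ts real_norm_def)
qed

section \<open>Matrix identities and measurability\<close>

lemma inner_matrix_mult_left:
  fixes B :: "real^'n^'m" and M :: "real^'k^'n" and N :: "real^'k^'m"
  shows "(B ** M) \<bullet> N = M \<bullet> (transpose B ** N)"
proof -
  have "(B ** M) \<bullet> N = (\<Sum>i\<in>UNIV. \<Sum>j\<in>UNIV. \<Sum>k\<in>UNIV. B $ i $ k * M $ k $ j * N $ i $ j)"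
    by (simp add: inner_vec_def matrix_matrix_mult_def sum_distrib_right)
  also have "\<dots> = (\<Sum>i\<in>UNIV. \<Sum>k\<in>UNIV. \<Sum>j\<in>UNIV. B $ i $ k * M $ k $ j * N $ i $ j)"
    by (intro sum.cong refl sum.swap)
  also have "\<dots> = (\<Sum>k\<in>UNIV. \<Sum>i\<in>UNIV. \<Sum>j\<in>UNIV. B $ i $ k * M $ k $ j * N $ i $ j)"
    by (rule sum.swap)
  also have "\<dots> = (\<Sum>k\<in>UNIV. \<Sum>j\<in>UNIV. \<Sum>i\<in>UNIV. B $ i $ k * M $ k $ j * N $ i $ j)"
    by (intro sum.cong refl sum.swap)
  also have "\<dots> = M \<bullet> (transpose B ** N)"
    by (simp add: inner_vec_def matrix_matrix_mult_def transpose_def sum_distrib_left ac_simps)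
  finally show ?thesis .
qed

lemma inner_transpose_both: "transpose M \<bullet> transpose N = M \<bullet> (N::real^'n^'m)"
  by (simp add: inner_vec_def transpose_def) (rule sum.swap)

lemma inner_matrix_mult_right:
  fixes B :: "real^'k^'n" and M :: "real^'n^'m" and N :: "real^'k^'m"
  shows "(M ** B) \<bullet> N = M \<bullet> (N ** transpose B)"
  using inner_matrix_mult_left[of "transpose B" "transpose M" "transpose N"]
  by (simp add: matrix_transpose_mul[symmetric] inner_transpose_both)
     (metis inner_transpose_both matrix_transpose_mul transpose_transpose)

lemma linear_sandwich: "linear (\<lambda>M. B ** M ** C)"
  for B :: "real^'n^'m" and C :: "real^'l^'k"
  by (rule linearI)
     (simp_all add: matrix_add_ldistrib matrix_add_rdistrib,
      simp add: vec_eq_iff matrix_matrix_mult_def sum_distrib_left sum_distrib_right ac_simps)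

lemma outer_matrix_vec: "outer (A *v v) (A *v v) = A ** outer v v ** transpose A"
  for A :: "real^'n^'m"
proof -
  have "outer (A *v v) (A *v v) *v x = (A ** outer v v ** transpose A) *v x" for x
    by (simp only: matrix_vector_mul_assoc[symmetric] outer_mult_vec matrix_vector_mult_scaleR
        inner_transpose[of v] transpose_transpose)
  then show ?thesis by (simp add: matrix_eq)
qed

lemma outer_scaleR: "outer (c *\<^sub>R v) (c *\<^sub>R v) = c\<^sup>2 *\<^sub>R outer v v"
  by (simp add: outer_def vec_eq_iff power2_eq_square)

lemma borel_measurable_vec:
  fixes f :: "'a \<Rightarrow> 'b::euclidean_space^'n"
  assumes "\<And>i. (\<lambda>x. f x $ i) \<in> borel_measurable M"
  shows "f \<in> borel_measurable M"
proof -
  have "(\<lambda>x. \<Sum>i\<in>UNIV. axis i (f x $ i)) \<in> borel_measurable M"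
    by (intro borel_measurable_sum measurable_compose[OF assms] borel_measurable_continuous_onI
        linear_continuous_on linear_conv_bounded_linear[THEN iffD1, OF linear_axis])
  then show ?thesis by (simp add: vec_eq_sum_axis[symmetric])
qed

lemma borel_measurable_nth:
  fixes f :: "'a \<Rightarrow> 'b::euclidean_space^'n"
  assumes "f \<in> borel_measurable M"
  shows "(\<lambda>x. f x $ i) \<in> borel_measurable M"
  using measurable_compose[OF assms borel_measurable_continuous_onI[OF linear_continuous_on[OF bounded_linear_vec_nth]]] .

lemma borel_measurable_linear:
  fixes h :: "'b::euclidean_space \<Rightarrow> 'c::euclidean_space"
  assumes "linear h" "f \<in> borel_measurable M"
  shows "(\<lambda>x. h (f x)) \<in> borel_measurable M"
  using measurable_compose[OF assms(2) borel_measurable_continuous_onI[OF linear_continuous_on]]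
    assms(1) linear_conv_bounded_linear by blast

section \<open>The realized covariance\<close>

text \<open>Shifts the index from 1..n to k < n, which removes the truncated subtraction
  \<open>i - 1\<close>.\<close>

lemma realized_cov_incr:
  "realized_cov T X n \<omega> = (1 / T) *\<^sub>R (\<Sum>k<n. outer (incr T n (\<lambda>t. X t \<omega>) k) (incr T n (\<lambda>t. X t \<omega>) k))"
  by (simp add: realized_cov_def incr_def sum.atLeast1_atMost_eq Let_def)

lemma realized_cov_symmetric: "transpose (realized_cov T X n \<omega>) = realized_cov T X n \<omega>"
  by (simp add: realized_cov_incr transpose_scaleR transpose_sum transpose_outer)

lemma realized_cov_psd: "T > 0 \<Longrightarrow> 0 \<le> v \<bullet> (realized_cov T X n \<omega> *v v)"
proof -
  assume "T > 0"
  let ?d = "incr T n (\<lambda>t. X t \<omega>)"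
  have "v \<bullet> (realized_cov T X n \<omega> *v v) = (\<Sum>k<n. outer (?d k) (?d k) \<bullet> outer v v) / T"
    by (simp add: inner_outer[symmetric] realized_cov_incr inner_sum_left)
  also have "\<dots> = (\<Sum>k<n. (?d k \<bullet> v)\<^sup>2) / T"
    by (simp add: inner_outer outer_mult_vec power2_eq_square inner_commute)
  finally show ?thesis using \<open>T > 0\<close> by (simp add: sum_nonneg)
qed

section \<open>The test statistic\<close>

text \<open>The statistical problem stripped of structural equations: a path that is
  \<open>A W\<close> plus a smooth part, and a smooth identifiable family of covariances containing
  \<open>A ** transpose A\<close>. The number of Wiener coordinates and the dimension of
  \<open>X\<close> are unrelated.\<close>

locale covariance_test = gauss_array M w
  for M :: "'a measure" and w :: "nat \<Rightarrow> nat \<Rightarrow> 'a \<Rightarrow> real^'r::finite" +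
  fixes T :: real and W :: "real \<Rightarrow> 'a \<Rightarrow> real^'r" and X :: "real \<Rightarrow> 'a \<Rightarrow> real^'p::finite"
    and A :: "real^'r^'p" and \<Sigma> :: "real^'s::finite \<Rightarrow> real^'p^'p" and P and \<theta>0
    and J :: "real^'s \<Rightarrow> real^('p uprod)" and \<theta>hat :: "nat \<Rightarrow> 'a \<Rightarrow> real^'s"
  assumes T: "T > 0"
    and X_measurable: "\<And>t. t \<in> {0..T} \<Longrightarrow> X t \<in> borel_measurable M"
    and W_incr: "\<And>n k \<omega>. n \<ge> 1 \<Longrightarrow> k < n \<Longrightarrow> \<omega> \<in> space M \<Longrightarrow>
      incr T n (\<lambda>t. W t \<omega>) k = sqrt (T / real n) *\<^sub>R w n k \<omega>"
    and W_continuous: "AE \<omega> in M. continuous_on {0..T} (\<lambda>t. W t \<omega>)"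
    and X_repr: "AE \<omega> in M. \<exists>b x0. continuous_on {0..T} b \<and>
      (\<forall>t\<in>{0..T}. X t \<omega> = x0 + integral {0..t} b + A *v W t \<omega>)"
    and \<Sigma>_pd: "\<And>\<theta>. \<theta> \<in> P \<Longrightarrow> pos_def (\<Sigma> \<theta>)"
    and P: "compact P" "\<theta>0 \<in> interior P"
    and AA: "A ** transpose A = \<Sigma> \<theta>0"
    and \<Sigma>_continuous: "continuous_on P (\<lambda>\<theta>. vech (\<Sigma> \<theta>))"
    and \<Sigma>_deriv: "((\<lambda>\<theta>. vech (\<Sigma> \<theta>)) has_derivative J) (at \<theta>0)" and inj_J: "inj J"
    and ident: "\<And>\<theta>. \<theta> \<in> P \<Longrightarrow> \<Sigma> \<theta> = \<Sigma> \<theta>0 \<Longrightarrow> \<theta> = \<theta>0"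
    and est: "\<And>n \<omega>. n \<ge> 1 \<Longrightarrow> \<omega> \<in> space M \<Longrightarrow> \<theta>hat n \<omega> \<in> P \<and>
      contrast (realized_cov T X n \<omega>) (\<Sigma> (\<theta>hat n \<omega>)) =
      (INF \<theta>\<in>P. contrast (realized_cov T X n \<omega>) (\<Sigma> \<theta>))"
begin

definition Q where "Q n \<omega> = realized_cov T X n \<omega>"
definition \<Sigma>0 where "\<Sigma>0 = \<Sigma> \<theta>0"
definition x0 where "x0 = vech \<Sigma>0"
definition S where "S = matrix_inv \<Sigma>0"
definition \<Phi> :: "real^('p uprod) \<Rightarrow> real^'r^'r" where
  "\<Phi> v = transpose A ** (S ** unvech v ** S) ** A"
text \<open>sqrt n times the deviation of the empirical second moment matrix of the row from the
  identity.\<close>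

definition Z :: "nat \<Rightarrow> 'a \<Rightarrow> real^'r^'r" where
  "Z n \<omega> = (\<chi> i j. (\<Sum>k<n. wick i j (($) (w n k \<omega>))) / sqrt (real n))"
definition stat where "stat n \<omega> = real n * contrast (Q n \<omega>) (\<Sigma> (\<theta>hat n \<omega>))"

lemma \<theta>0_in: "\<theta>0 \<in> P"
  using P(2) interior_subset by blast

lemma \<Sigma>_symmetric: "\<theta> \<in> P \<Longrightarrow> transpose (\<Sigma> \<theta>) = \<Sigma> \<theta>"
  using \<Sigma>_pd by (simp add: pos_def_def)

lemma unvech_\<Sigma>: "\<theta> \<in> P \<Longrightarrow> unvech (vech (\<Sigma> \<theta>)) = \<Sigma> \<theta>"
  by (simp add: unvech_vech \<Sigma>_symmetric)

lemma \<Sigma>0_pd: "pos_def \<Sigma>0" and \<Sigma>0_invertible: "invertible \<Sigma>0" and unvech_x0: "unvech x0 = \<Sigma>0"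
  and x0_pd: "x0 \<in> pd_set"
  using \<Sigma>_pd[OF \<theta>0_in] unvech_\<Sigma>[OF \<theta>0_in] by (auto simp: \<Sigma>0_def x0_def pos_def_invertible)

lemma S_inverse: "\<Sigma>0 ** S = mat 1" "S ** \<Sigma>0 = mat 1" "transpose S = S"
  using matrix_inv_works[OF \<Sigma>0_invertible] \<Sigma>0_pd symmetric_matrix_inv[OF _ \<Sigma>0_invertible]
  by (auto simp: S_def pos_def_def)

lemma unvech_Q: "unvech (vech (Q n \<omega>)) = Q n \<omega>"
  by (simp add: unvech_vech Q_def realized_cov_symmetric)

lemma linear_\<Phi>: "linear \<Phi>"
proof -
  have "\<Phi> = (\<lambda>M. transpose A ** M ** A) \<circ> (\<lambda>M. S ** M ** S) \<circ> unvech"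
    by (auto simp: \<Phi>_def)
  then show ?thesis
    by (metis linear_compose linear_sandwich linear_unvech)
qed

text \<open>Moving both factors \<open>A\<close> to one side by adjunction produces \<Sigma>0 twice,
  which cancels against \<open>S\<close>. With \<open>V_mat_diagonal\<close>, half of this norm is
  the contrast form at \<Sigma>0.\<close>

lemma norm_\<Phi>: "(norm (\<Phi> v))\<^sup>2 = unvech v \<bullet> (S ** unvech v ** S)"
proof -
  let ?M = "S ** unvech v ** S"
  have "(norm (\<Phi> v))\<^sup>2 = (transpose A ** (?M ** A)) \<bullet> (transpose A ** ?M ** A)"
    by (simp add: power2_norm_eq_inner \<Phi>_def matrix_mul_assoc)
  also have "\<dots> = (?M ** A) \<bullet> (A ** (transpose A ** ?M ** A))"
    by (simp only: inner_matrix_mult_left transpose_transpose)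
  also have "\<dots> = ?M \<bullet> (A ** (transpose A ** ?M ** A) ** transpose A)"
    by (simp only: inner_matrix_mult_right)
  also have "A ** (transpose A ** ?M ** A) ** transpose A = (A ** transpose A) ** ?M ** (A ** transpose A)"
    by (simp only: matrix_mul_assoc)
  also have "\<dots> = (\<Sigma>0 ** S) ** unvech v ** (S ** \<Sigma>0)"
    by (simp only: matrix_mul_assoc AA \<Sigma>0_def)
  also have "\<dots> = unvech v"
    by (simp add: S_inverse)
  finally show ?thesis by (simp add: inner_commute)
qed

lemma inj_\<Phi>: "inj \<Phi>"
proof -
  have "v = 0" if "\<Phi> v = 0" for v
  proof (rule ccontr)
    assume "v \<noteq> 0"
    then have "0 < unvech v \<bullet> (S ** unvech v ** S)"
      unfolding S_def by (intro sandwich_pos \<Sigma>0_pd) (simp add: unvech_eq_0_iff)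
    then show False using norm_\<Phi>[of v] that by simp
  qed
  then show ?thesis using linear_injective_0[OF linear_\<Phi>] by blast
qed

lemma transpose_\<Phi>: "transpose (\<Phi> v) = \<Phi> v"
  by (simp add: \<Phi>_def matrix_transpose_mul S_inverse unvech_symmetric matrix_mul_assoc)

lemma transpose_Z: "transpose (Z n \<omega>) = Z n \<omega>"
proof -
  have "wick i j x = wick j i x" for i j :: 'r and x by (auto simp: wick_def)
  then show ?thesis by (simp add: Z_def transpose_def vec_eq_iff)
qed

text \<open>The matrix \<open>p\<close> is the orthogonal projection onto the range of the transpose
  of \<open>A\<close>, and the left argument of the inner product becomes
  \<open>p ** U ** p\<close>. Conjugation by \<open>p\<close> fixes the range of \<Phi>, because
  \<open>S\<close> cancels \<open>A ** transpose A\<close>; so \<open>p\<close> can be shifted onto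
  \<open>c\<close> and disappears.\<close>

lemma \<Phi>_pushforward:
  assumes "c \<in> range \<Phi>" "transpose U = U"
  shows "c \<bullet> \<Phi> (vech (A ** U ** transpose A)) = c \<bullet> U"
proof -
  obtain v where c: "c = \<Phi> v" using assms(1) by blast
  define p where "p = transpose A ** S ** A"
  have p: "transpose p = p"
    by (simp add: p_def matrix_transpose_mul S_inverse matrix_mul_assoc)
  have "transpose (A ** U ** transpose A) = A ** U ** transpose A"
    by (simp add: matrix_transpose_mul assms(2) matrix_mul_assoc)
  then have "\<Phi> (vech (A ** U ** transpose A)) = p ** U ** p"
    by (simp add: \<Phi>_def unvech_vech p_def matrix_mul_assoc)
  then have "c \<bullet> \<Phi> (vech (A ** U ** transpose A)) = (p ** U ** p) \<bullet> c"
    by (simp add: inner_commute)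
  also have "\<dots> = (p ** (U ** p)) \<bullet> c"
    by (simp only: matrix_mul_assoc)
  also have "\<dots> = (U ** p) \<bullet> (p ** c)"
    by (simp only: inner_matrix_mult_left p)
  also have "\<dots> = U \<bullet> (p ** c ** p)"
    by (simp only: inner_matrix_mult_right p)
  also have "p ** c ** p = transpose A ** S ** (A ** transpose A) ** S ** unvech v ** S ** (A ** transpose A) ** S ** A"
    by (simp only: c \<Phi>_def p_def matrix_mul_assoc)
  also have "\<dots> = transpose A ** (S ** \<Sigma>0) ** S ** unvech v ** S ** (\<Sigma>0 ** S) ** A"
    by (simp only: AA matrix_mul_assoc \<Sigma>0_def)
  also have "\<dots> = c"
    by (simp add: c \<Phi>_def S_inverse matrix_mul_assoc)
  finally show ?thesis by (simp add: inner_commute)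
qed

section \<open>Minimality of the estimator and measurability of the statistic\<close>

lemma contrast_nonneg_model:
  assumes "\<theta> \<in> P" shows "0 \<le> contrast (Q n \<omega>) (\<Sigma> \<theta>)"
proof -
  have "vech (Q n \<omega>) \<in> psd_set" by (simp add: psd_set_def unvech_Q) (simp add: Q_def realized_cov_psd[OF T])
  from contrast_nonneg[OF this, of "vech (\<Sigma> \<theta>)"] show ?thesis
    using assms by (simp add: unvech_Q unvech_\<Sigma> \<Sigma>_pd)
qed

text \<open>An infimum of reals is a lower bound only if the set is bounded below; nonnegativity of
  the contrast provides this.\<close>

lemma \<theta>hat_min:
  assumes "n \<ge> 1" "\<omega> \<in> space M" "\<theta> \<in> P"
  shows "contrast (Q n \<omega>) (\<Sigma> (\<theta>hat n \<omega>)) \<le> contrast (Q n \<omega>) (\<Sigma> \<theta>)"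
proof -
  have "bdd_below ((\<lambda>\<theta>. contrast (Q n \<omega>) (\<Sigma> \<theta>)) ` P)"
    using contrast_nonneg_model by (intro bdd_belowI[of _ 0]) auto
  then show ?thesis using est[OF assms(1,2)] assms(3) by (auto simp: Q_def intro: cINF_lower)
qed

lemma Q_measurable: "Q n \<in> borel_measurable M"
proof (cases "n = 0")
  case True
  then show ?thesis unfolding Q_def[abs_def] realized_cov_incr by simp
next
  case False
  have "(\<lambda>\<omega>. incr T n (\<lambda>t. X t \<omega>) k $ i) \<in> borel_measurable M" if "k < n" for k i
    unfolding incr_def using that
    by (intro borel_measurable_nth borel_measurable_diff X_measurable grid_in_interval T) auto
  then have "(\<lambda>\<omega>. realized_cov T X n \<omega> $ i $ j) \<in> borel_measurable M" for i j
    unfolding realized_cov_incr by (simp add: outer_def) 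
  then show ?thesis unfolding Q_def[abs_def] by (intro borel_measurable_vec)
qed

lemma Z_measurable: "Z n \<in> borel_measurable M"
proof -
  have "(\<lambda>\<omega>. wick i j (($) (w n k \<omega>))) \<in> borel_measurable M" if "k < n" for i j k
    by (rule measurable_compose[OF measurable_row[OF that] measurable_wick])
  then show ?thesis unfolding Z_def[abs_def] by (intro borel_measurable_vec) simp
qed

lemma stat_measurable: "stat n \<in> borel_measurable M"
proof (cases "n = 0")
  case True
  then show ?thesis by (simp add: stat_def[abs_def])
next
  case False
  then have n: "n \<ge> 1" by simp
  have "(\<lambda>\<omega>. contrast (unvech (vech (Q n \<omega>))) (unvech (vech (\<Sigma> (\<theta>hat n \<omega>))))) \<in> borel_measurable M"
  proof (rule measurable_min_contrast[where S = "(\<lambda>\<theta>. vech (\<Sigma> \<theta>)) ` P"])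
    show "(\<lambda>\<omega>. vech (Q n \<omega>)) \<in> borel_measurable M"
      by (rule borel_measurable_linear[OF linear_vech Q_measurable])
    show "vech (Q n \<omega>) \<in> psd_set" for \<omega>
      by (simp add: psd_set_def unvech_Q) (simp add: Q_def realized_cov_psd[OF T])
    show "(\<lambda>\<theta>. vech (\<Sigma> \<theta>)) ` P \<subseteq> pd_set"
      using \<Sigma>_pd by (auto simp: unvech_\<Sigma>)
    show "vech (\<Sigma> (\<theta>hat n \<omega>)) \<in> (\<lambda>\<theta>. vech (\<Sigma> \<theta>)) ` P" if "\<omega> \<in> space M" for \<omega>
      using est[OF n that] by blast
    show "contrast (unvech (vech (Q n \<omega>))) (unvech (vech (\<Sigma> (\<theta>hat n \<omega>)))) \<le>
        contrast (unvech (vech (Q n \<omega>))) (unvech y)" if "\<omega> \<in> space M" "y \<in> (\<lambda>\<theta>. vech (\<Sigma> \<theta>)) ` P" for \<omega> y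
      using \<theta>hat_min[OF n that(1)] that(2) est[OF n that(1)] by (auto simp: unvech_Q unvech_\<Sigma>)
  qed
  then have "(\<lambda>\<omega>. contrast (Q n \<omega>) (\<Sigma> (\<theta>hat n \<omega>))) \<in> borel_measurable M"
    by (rule measurable_cong[THEN iffD1, rotated]) (use est[OF n] in \<open>simp add: unvech_Q unvech_\<Sigma>\<close>)
  then show ?thesis unfolding stat_def[abs_def] by simp
qed

lemma stat_nonneg: "\<omega> \<in> space M \<Longrightarrow> 0 \<le> stat n \<omega>"
  using est[of n \<omega>] contrast_nonneg_model[of "\<theta>hat n \<omega>" n \<omega>] by (cases "n = 0") (auto simp: stat_def)

text \<open>A deterministic property: the bound is uniform in \<open>n\<close> and in the sample
  point, and randomness enters only through the distance of \<open>Q\<close> from \<Sigma>0.\<close>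

definition expands where
  "expands B \<longleftrightarrow> (\<forall>e>0. \<exists>d>0. \<forall>n\<ge>1. \<forall>\<omega>\<in>space M. norm (vech (Q n \<omega>) - x0) < d \<longrightarrow>
      \<bar>contrast (Q n \<omega>) (\<Sigma> (\<theta>hat n \<omega>)) - (\<Sum>c\<in>B. (c \<bullet> \<Phi> (vech (Q n \<omega>) - x0))\<^sup>2) / 2\<bar>
        \<le> e * (norm (vech (Q n \<omega>) - x0))\<^sup>2)"

text \<open>Since \<open>norm_\<Phi>\<close> and \<open>V_mat_diagonal\<close> identify the local
  form with half of |\<Phi> v|^2, the general expansion applies, with N half the squared length of
  the projection.\<close>

lemma contrast_expansion:
  obtains B where "finite B" "B \<subseteq> range \<Phi>" "card B = CARD('p uprod) - CARD('s)"
    "pairwise orthogonal B" "\<And>c. c \<in> B \<Longrightarrow> norm c = 1"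
    "expands B"
proof -
  let ?g = "\<lambda>\<theta>. vech (\<Sigma> \<theta>)"
  let ?F = "\<lambda>x y. contrast (unvech x) (unvech y)"
  have g0: "?g \<theta>0 = x0" by (simp add: x0_def \<Sigma>0_def)
  obtain B C where B: "finite B" "B \<subseteq> range \<Phi>" "card B = DIM(real^('p uprod)) - DIM(real^'s)"
    "pairwise orthogonal B" "\<And>c. c \<in> B \<Longrightarrow> norm c = 1"
    "\<And>v u. (\<Sum>c\<in>B. (c \<bullet> \<Phi> v)\<^sup>2) \<le> (norm (\<Phi> (v - J u)))\<^sup>2"
    "\<And>v. \<exists>u. norm u \<le> C * norm v \<and> (norm (\<Phi> (v - J u)))\<^sup>2 = (\<Sum>c\<in>B. (c \<bullet> \<Phi> v)\<^sup>2)"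
    using projection_onto_complement[OF linear_\<Phi> inj_\<Phi> has_derivative_linear[OF \<Sigma>_deriv] inj_J] by blast
  have "\<exists>d>0. \<forall>n\<ge>1. \<forall>\<omega>\<in>space M. norm (vech (Q n \<omega>) - x0) < d \<longrightarrow>
      \<bar>contrast (Q n \<omega>) (\<Sigma> (\<theta>hat n \<omega>)) - (\<Sum>c\<in>B. (c \<bullet> \<Phi> (vech (Q n \<omega>) - x0))\<^sup>2) / 2\<bar>
        \<le> e * (norm (vech (Q n \<omega>) - x0))\<^sup>2" if e: "e > 0" for e
  proof -
    have "\<exists>d>0. \<forall>x. \<forall>\<theta>\<in>P. norm (x - ?g \<theta>0) < d \<and> (\<forall>\<theta>'\<in>P. ?F x (?g \<theta>) \<le> ?F x (?g \<theta>')) \<longrightarrow>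
      \<bar>?F x (?g \<theta>) - (\<Sum>c\<in>B. (c \<bullet> \<Phi> (x - ?g \<theta>0))\<^sup>2) / 2\<bar> \<le> e * (norm (x - ?g \<theta>0))\<^sup>2"
    proof (rule min_contrast_expansion[where g = ?g and F = ?F and J = J and C = C and \<Psi> = \<Phi>
          and N = "\<lambda>v. (\<Sum>c\<in>B. (c \<bullet> \<Phi> v)\<^sup>2) / 2", OF P \<Sigma>_continuous \<Sigma>_deriv inj_J _ linear_\<Phi>])
      show "\<theta> = \<theta>0" if "\<theta> \<in> P" "?g \<theta> = ?g \<theta>0" for \<theta>
        using that unvech_\<Sigma> \<theta>0_in by (intro ident) metis+
      show "\<exists>d>0. \<forall>x y. norm (x - ?g \<theta>0) < d \<and> norm (y - ?g \<theta>0) < d \<longrightarrow>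
          \<bar>?F x y - (norm (\<Phi> (x - y)))\<^sup>2 / 2\<bar> \<le> e * (norm (x - y))\<^sup>2" if "e > 0" for e
        unfolding g0 norm_\<Phi> S_def unvech_x0[symmetric] V_mat_diagonal[OF x0_pd, symmetric]
        by (rule contrast_local[OF x0_pd that])
      show "\<exists>c>0. \<exists>d>0. \<forall>x. \<forall>y\<in>?g ` P. norm (x - ?g \<theta>0) < d \<longrightarrow> c * (norm (x - y))\<^sup>2 \<le> ?F x y"
        unfolding g0
      proof (rule contrast_lower[OF x0_pd])
        show "compact (?g ` P)" by (rule compact_continuous_image[OF \<Sigma>_continuous P(1)])
        show "?g ` P \<subseteq> pd_set" using \<Sigma>_pd by (auto simp: unvech_\<Sigma>)
        show "?g ` P \<noteq> {}" using \<theta>0_in by blast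
      qed
      show "(\<Sum>c\<in>B. (c \<bullet> \<Phi> v)\<^sup>2) / 2 \<le> (norm (\<Phi> (v - J u)))\<^sup>2 / 2" for v u
        using B(6) by simp
      show "\<exists>u. norm u \<le> C * norm v \<and> (norm (\<Phi> (v - J u)))\<^sup>2 / 2 = (\<Sum>c\<in>B. (c \<bullet> \<Phi> v)\<^sup>2) / 2" for v
        using B(7)[of v] by simp
    qed (rule e)
    then obtain d where d: "d > 0" "\<And>x \<theta>. \<theta> \<in> P \<Longrightarrow> norm (x - x0) < d \<Longrightarrow> (\<And>\<theta>'. \<theta>' \<in> P \<Longrightarrow> ?F x (?g \<theta>) \<le> ?F x (?g \<theta>')) \<Longrightarrow>
      \<bar>?F x (?g \<theta>) - (\<Sum>c\<in>B. (c \<bullet> \<Phi> (x - x0))\<^sup>2) / 2\<bar> \<le> e * (norm (x - x0))\<^sup>2"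
      unfolding g0 by blast
    have "\<bar>contrast (Q n \<omega>) (\<Sigma> (\<theta>hat n \<omega>)) - (\<Sum>c\<in>B. (c \<bullet> \<Phi> (vech (Q n \<omega>) - x0))\<^sup>2) / 2\<bar>
        \<le> e * (norm (vech (Q n \<omega>) - x0))\<^sup>2" if "n \<ge> 1" "\<omega> \<in> space M" "norm (vech (Q n \<omega>) - x0) < d" for n \<omega>
      using d(2)[of "\<theta>hat n \<omega>" "vech (Q n \<omega>)"] est[OF that(1,2)] that(3) \<theta>hat_min[OF that(1,2)]
      by (simp add: unvech_Q unvech_\<Sigma>)
    then show ?thesis using d(1) by blast
  qed
  then have "expands B" by (simp add: expands_def)
  then show thesis using B by (intro that[of B]) auto
qed

end

section \<open>Comparison with the realized covariance of the noise alone, and passage to the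
  limit\<close>

context covariance_test
begin

text \<open>The realized covariance of \<open>A W\<close> without the smooth part, expressed through
  \<open>Z\<close>. Its trace times T is the sum of the squared lengths of the noise increments,
  whose root is \<open>scale\<close>.\<close>

definition Qw where "Qw n \<omega> = \<Sigma>0 + (1 / sqrt (real n)) *\<^sub>R (A ** Z n \<omega> ** transpose A)"
definition scale where "scale n \<omega> = sqrt (T * (mat 1 \<bullet> Qw n \<omega>))"
text \<open>The denominator makes almost sure convergence to 0 available path by path; where
  \<open>Z\<close> is bounded, \<open>scale\<close> is bounded too and the division is
  harmless.\<close>

definition res where "res n \<omega> = norm (sqrt (real n) *\<^sub>R (Q n \<omega> - Qw n \<omega>)) / (1 + scale n \<omega>)"

lemma noise_covariance:
  assumes n: "n \<ge> 1" and \<omega>: "\<omega> \<in> space M"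
  shows "(1 / T) *\<^sub>R (\<Sum>k<n. outer (A *v incr T n (\<lambda>t. W t \<omega>) k) (A *v incr T n (\<lambda>t. W t \<omega>) k)) = Qw n \<omega>"
proof -
  have Zsum: "(1 / real n) *\<^sub>R (\<Sum>k<n. outer (w n k \<omega>) (w n k \<omega>)) = mat 1 + (1 / sqrt (real n)) *\<^sub>R Z n \<omega>"
    using n by (simp add: vec_eq_iff Z_def outer_def wick_def mat_def sum_subtractf field_simps)
  have "(1 / T) *\<^sub>R (\<Sum>k<n. outer (A *v incr T n (\<lambda>t. W t \<omega>) k) (A *v incr T n (\<lambda>t. W t \<omega>) k)) =
      (1 / real n) *\<^sub>R (\<Sum>k<n. A ** outer (w n k \<omega>) (w n k \<omega>) ** transpose A)"
    using n T W_incr[OF n _ \<omega>]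
    by (simp add: matrix_vector_mult_scaleR outer_scaleR outer_matrix_vec scaleR_sum_right[symmetric])
  also have "\<dots> = A ** ((1 / real n) *\<^sub>R (\<Sum>k<n. outer (w n k \<omega>) (w n k \<omega>))) ** transpose A"
    by (simp add: linear_scale[OF linear_sandwich] linear_sum[OF linear_sandwich])
  also have "\<dots> = A ** transpose A + (1 / sqrt (real n)) *\<^sub>R (A ** Z n \<omega> ** transpose A)"
    unfolding Zsum by (simp add: linear_add[OF linear_sandwich] linear_scale[OF linear_sandwich])
  finally show ?thesis by (simp add: Qw_def AA \<Sigma>0_def)
qed

lemma scale_eq:
  assumes n: "n \<ge> 1" and \<omega>: "\<omega> \<in> space M"
  shows "scale n \<omega> = sqrt (\<Sum>k<n. (norm (A *v incr T n (\<lambda>t. W t \<omega>) k))\<^sup>2)"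
  unfolding scale_def noise_covariance[OF assms, symmetric] using T
  by (simp add: inner_sum_right inner_outer power2_norm_eq_inner)

lemma Qw_measurable: "Qw n \<in> borel_measurable M"
  unfolding Qw_def[abs_def]
  by (intro borel_measurable_add borel_measurable_const borel_measurable_scaleR
      borel_measurable_linear[OF linear_sandwich Z_measurable])

lemma res_measurable: "res n \<in> borel_measurable M"
proof -
  have "(\<lambda>\<omega>. norm (sqrt (real n) *\<^sub>R (Q n \<omega> - Qw n \<omega>))) \<in> borel_measurable M"
    using Q_measurable[of n] Qw_measurable[of n] by measurable
  moreover have "(\<lambda>\<omega>. mat 1 \<bullet> Qw n \<omega>) \<in> borel_measurable M"
    by (intro borel_measurable_inner borel_measurable_const Qw_measurable)
  ultimately show ?thesis
    unfolding res_def[abs_def] scale_def by measurable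
qed

text \<open>Split the path into its smooth part F and the noise G. In \<open>Q - Qw\<close> the
  square of the noise cancels, and each entry is a combination of the cross variations of G with F,
  F with G and F with F.\<close>

lemma res_null: "AE \<omega> in M. (\<lambda>n. res n \<omega>) \<longlonglongrightarrow> 0"
  using W_continuous X_repr AE_space
proof eventually_elim
  case (elim \<omega>)
  then obtain b x1 where b: "continuous_on {0..T} b"
    and X: "\<And>t. t \<in> {0..T} \<Longrightarrow> X t \<omega> = x1 + integral {0..t} b + A *v W t \<omega>" by blast
  have \<omega>: "\<omega> \<in> space M" and Wc: "continuous_on {0..T} (\<lambda>t. W t \<omega>)" using elim by auto
  define F where "F t = x1 + integral {0..t} b" for t
  define G where "G t = A *v W t \<omega>" for t
  have bc: "continuous_on {0..T} (\<lambda>s. b s $ i)" for i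
    using b by (rule continuous_on_component)
  have Fc: "F t $ i = x1 $ i + integral {0..t} (\<lambda>s. b s $ i)" if "t \<in> {0..T}" for t i
  proof -
    have "b integrable_on {0..t}"
      by (rule integrable_continuous_interval[OF continuous_on_subset[OF b]]) (use that in auto)
    then show ?thesis by (simp add: F_def integral_component_eq_cart)
  qed
  have Gc: "continuous_on {0..T} (\<lambda>t. G t $ i)" for i
    unfolding G_def using Wc
    by (intro continuous_on_component linear_continuous_on_compose[OF Wc]) simp
  have Fcont: "continuous_on {0..T} (\<lambda>t. F t $ i)" for i
    unfolding F_def
    by (intro continuous_on_component continuous_on_add continuous_on_const
        indefinite_integral_continuous_1 integrable_continuous_interval b)
  define s where "s n = sqrt (\<Sum>k<n. (norm (incr T n G k))\<^sup>2)" for n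
  have s: "s n \<ge> 0" for n unfolding s_def by (intro real_sqrt_ge_zero sum_nonneg) auto
  have incr_nth: "incr T n H k $ i = incr T n (\<lambda>t. H t $ i) k" for H :: "real \<Rightarrow> real^'p" and n k i
    by (simp add: incr_def)
  have sG: "sqrt (\<Sum>k<n. (incr T n (\<lambda>t. G t $ i) k)\<^sup>2) \<le> s n" for n i
    unfolding s_def incr_nth[symmetric]
    by (intro real_sqrt_le_mono sum_mono) (simp add: power2_eq_iff abs_le_square_iff[symmetric] component_le_norm_cart)
  define c where "c H H' i j n = sqrt (real n) * cross_var T n (\<lambda>t. H t $ i) (\<lambda>t. H' t $ j) / (1 + s n)"
    for H H' :: "real \<Rightarrow> real^'p" and i j n
  define D where "D n = (sqrt (real n) / (1 + s n)) *\<^sub>R (Q n \<omega> - Qw n \<omega>)" for n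
  have GF: "c G F i j \<longlonglongrightarrow> 0" for i j
    unfolding c_def[abs_def] by (rule cross_variation_vanishes[OF T Gc bc Fc sG])
  \<comment> \<open>F also takes the role of the rough path. Its increments are O(1 / n), so
    \<open>B * T\<close> majorizes its square sums, and the constant divisor
    \<open>1 + B * T\<close> can be multiplied away.\<close>
  have FF: "c F F i j \<longlonglongrightarrow> 0" for i j
  proof -
    obtain B where B: "\<And>t. t \<in> {0..T} \<Longrightarrow> \<bar>b t $ i\<bar> \<le> B" "B > 0"
    proof -
      have "\<exists>B>0. \<forall>t\<in>{0..T}. \<bar>b t $ i\<bar> \<le> B"
        using compact_imp_bounded[OF compact_continuous_image[OF bc compact_Icc]]
        unfolding bounded_pos by auto
      then show ?thesis using that by blast
    qed
    have "sqrt (\<Sum>k<n. (incr T n (\<lambda>t. F t $ i) k)\<^sup>2) \<le> B * T" for n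
    proof (cases "n = 0")
      case False
      have "(\<Sum>k<n. (incr T n (\<lambda>t. F t $ i) k)\<^sup>2) \<le> (\<Sum>k<n. (B * (T / real n))\<^sup>2)"
      proof (rule sum_mono)
        fix k assume "k \<in> {..<n}"
        then have "\<bar>incr T n (\<lambda>t. F t $ i) k\<bar> \<le> B * (T / real n)"
          by (intro incr_integral_bound[OF T bc B(1) Fc]) auto
        then show "(incr T n (\<lambda>t. F t $ i) k)\<^sup>2 \<le> (B * (T / real n))\<^sup>2"
          by (rule power2_le_iff_abs_le[THEN iffD2, rotated]) (use B(2) T in auto)
      qed
      also have "\<dots> = (B * T)\<^sup>2 / real n"
        using False by (simp add: power2_eq_square)
      also have "\<dots> \<le> (B * T)\<^sup>2"
        using False by (simp add: divide_le_eq mult_le_cancel_left1)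
      finally show ?thesis using B(2) T by (intro real_le_lsqrt) auto
    qed (use B(2) T in auto)
    from cross_variation_vanishes[OF T Fcont bc Fc this, of j]
    have "(\<lambda>n. (1 + B * T) * (sqrt (real n) * cross_var T n (\<lambda>t. F t $ i) (\<lambda>t. F t $ j) / (1 + B * T))) \<longlonglongrightarrow> (1 + B * T) * 0"
      by (intro tendsto_mult tendsto_const)
    moreover have "1 + B * T > 0" using B(2) T by (simp add: add_pos_pos)
    ultimately have lim: "(\<lambda>n. sqrt (real n) * cross_var T n (\<lambda>t. F t $ i) (\<lambda>t. F t $ j)) \<longlonglongrightarrow> 0"
      by simp
    show ?thesis
    proof (rule Lim_null_comparison[OF always_eventually tendsto_rabs_zero[OF lim]], rule allI)
      fix n
      show "norm (c F F i j n) \<le> \<bar>sqrt (real n) * cross_var T n (\<lambda>t. F t $ i) (\<lambda>t. F t $ j)\<bar>"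
        using s[of n] by (simp only: c_def real_norm_def abs_divide) (simp add: divide_le_eq mult_le_cancel_left1)
    qed
  qed
  have incrX: "incr T n (\<lambda>t. X t \<omega>) k = incr T n F k + incr T n G k" if "k < n" for n k
    using X[OF grid_in_interval[OF T, of k n]] X[OF grid_in_interval[OF T, of "Suc k" n]] that
    by (simp add: incr_def F_def G_def)
  have entry: "(1 / T) * (c G F i j n + c G F j i n + c F F i j n) = D n $ i $ j" if n: "n \<ge> 1" for n i j
  proof -
    have G: "A *v incr T n (\<lambda>t. W t \<omega>) k = incr T n G k" for k
      by (simp add: incr_def G_def matrix_vector_mult_diff_distrib)
    have "(Q n \<omega> - Qw n \<omega>) $ i $ j = (1 / T) * (\<Sum>k<n. (incr T n F k + incr T n G k) $ i * (incr T n F k + incr T n G k) $ j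
        - incr T n G k $ i * incr T n G k $ j)"
      unfolding noise_covariance[OF n \<omega>, symmetric] Q_def realized_cov_incr G
      by (simp add: outer_def incrX sum_subtractf diff_divide_distrib)
    also have "\<dots> = (1 / T) * (cross_var T n (\<lambda>t. G t $ i) (\<lambda>t. F t $ j) +
       cross_var T n (\<lambda>t. G t $ j) (\<lambda>t. F t $ i) +
       cross_var T n (\<lambda>t. F t $ i) (\<lambda>t. F t $ j))"
      unfolding cross_var_def sum.distrib[symmetric]
      by (intro arg_cong2[where f = "(*)"] refl sum.cong) (simp add: incr_nth algebra_simps)
    finally show ?thesis using s[of n] by (simp add: c_def D_def add_divide_distrib algebra_simps)
  qed
  have "D \<longlonglongrightarrow> 0"
  proof (intro vec_tendstoI)
    fix i j
    have "(\<lambda>n. (1 / T) * (c G F i j n + c G F j i n + c F F i j n)) \<longlonglongrightarrow> (1 / T) * (0 + 0 + 0)"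
      by (intro tendsto_mult tendsto_add tendsto_const GF FF)
    moreover have "\<forall>\<^sub>F n in sequentially. (1 / T) * (c G F i j n + c G F j i n + c F F i j n) = D n $ i $ j"
      using entry by (intro eventually_sequentiallyI[of 1])
    ultimately show "(\<lambda>n. D n $ i $ j) \<longlonglongrightarrow> 0 $ i $ j"
      by (simp add: Lim_transform_eventually)
  qed
  then have "(\<lambda>n. norm (D n)) \<longlonglongrightarrow> 0"
    by (rule tendsto_norm_zero)
  moreover have "\<forall>\<^sub>F n in sequentially. norm (D n) = res n \<omega>"
  proof (rule eventually_sequentiallyI[of 1])
    fix n :: nat assume n: "n \<ge> 1"
    have "s n = scale n \<omega>"
      unfolding scale_eq[OF n \<omega>] s_def by (simp add: incr_def G_def matrix_vector_mult_diff_distrib)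
    then show "norm (D n) = res n \<omega>"
      using s[of n] by (simp add: res_def D_def)
  qed
  ultimately show ?case by (rule Lim_transform_eventually)
qed

text \<open>Markov's inequality for the squared norm, each of whose entries has mean at most 2,
  uniformly in n.\<close>

lemma Z_tight:
  assumes n: "n \<ge> 1" and K: "K > 0"
  shows "prob {\<omega> \<in> space M. K \<le> norm (Z n \<omega>)} \<le> 2 * (real CARD('r))\<^sup>2 / K\<^sup>2"
proof -
  have eq: "(norm (Z n \<omega>))\<^sup>2 = (\<Sum>i\<in>UNIV. \<Sum>j\<in>UNIV. ((\<Sum>k<n. wick i j (($) (w n k \<omega>))) / sqrt (real n))\<^sup>2)" for \<omega>
    unfolding power2_norm_eq_inner by (simp add: inner_vec_def Z_def power2_eq_square)
  have int: "integrable M (\<lambda>\<omega>. (norm (Z n \<omega>))\<^sup>2)"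
    unfolding eq using wick_sum_second_moment(1)[OF n] by auto
  have "expectation (\<lambda>\<omega>. (norm (Z n \<omega>))\<^sup>2) =
      (\<Sum>i\<in>UNIV. \<Sum>j\<in>UNIV. expectation (\<lambda>\<omega>. ((\<Sum>k<n. wick i j (($) (w n k \<omega>))) / sqrt (real n))\<^sup>2))"
    unfolding eq using wick_sum_second_moment(1)[OF n] by simp
  also have "\<dots> \<le> (\<Sum>i\<in>(UNIV::'r set). \<Sum>j\<in>(UNIV::'r set). 2)"
    by (intro sum_mono wick_sum_second_moment(2)[OF n])
  also have "\<dots> = 2 * (real CARD('r))\<^sup>2" by (simp add: power2_eq_square)
  finally have le: "expectation (\<lambda>\<omega>. (norm (Z n \<omega>))\<^sup>2) \<le> 2 * (real CARD('r))\<^sup>2" .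
  have "{\<omega> \<in> space M. K \<le> norm (Z n \<omega>)} = {\<omega> \<in> space M. K\<^sup>2 \<le> (norm (Z n \<omega>))\<^sup>2}"
    using K by (auto intro: power_mono power2_le_imp_le)
  also have "prob \<dots> \<le> expectation (\<lambda>\<omega>. (norm (Z n \<omega>))\<^sup>2) / K\<^sup>2"
    using K by (intro integral_Markov_inequality_measure[OF int, of "{}"]) auto
  also have "\<dots> \<le> 2 * (real CARD('r))\<^sup>2 / K\<^sup>2"
    using le by (intro divide_right_mono) auto
  finally show ?thesis .
qed

text \<open>Where \<open>Z\<close> is bounded and \<open>res\<close> small, sqrt n (vech Q - x0) is
  a sum r + u with u the image of \<open>Z\<close> and r that of the residual. The expansion
  replaces the contrast by \<open>q\<close> at cost e / 2, uniform continuity of \<open>q\<close> on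
  a ball removes r at cost e / 2, and \<open>\<Phi>_pushforward\<close> expresses q u through
  \<open>Z\<close>.\<close>

lemma stat_close:
  assumes B: "finite B" "B \<subseteq> range \<Phi>"
    and expansion: "expands B"
    and K: "K > 0" and e: "e > 0"
  shows "\<exists>n0. \<exists>\<eta>>0. \<forall>n\<ge>n0. \<forall>\<omega>\<in>space M. norm (Z n \<omega>) \<le> K \<and> res n \<omega> \<le> \<eta> \<longrightarrow>
    \<bar>stat n \<omega> - (\<Sum>c\<in>B. (c \<bullet> Z n \<omega>)\<^sup>2) / 2\<bar> \<le> e"
proof -
  define q where "q v = (\<Sum>c\<in>B. (c \<bullet> \<Phi> v)\<^sup>2) / 2" for v
  obtain cv where cv: "cv > 0" "\<And>U::real^'p^'p. norm (vech U) \<le> cv * norm U"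
    using linear_bounded_pos[OF linear_vech] by blast
  obtain a where a: "a > 0" "\<And>U. norm (A ** U ** transpose A) \<le> a * norm U"
    using linear_bounded_pos[OF linear_sandwich[of A "transpose A"]] by blast
  \<comment> \<open>If |Z| <= K, then \<open>K'\<close> bounds \<open>scale\<close> and, once
    \<open>res\<close> is at most 1, \<open>L\<close> bounds the rescaled error.\<close>
  define K' where "K' = sqrt (T * (norm (mat 1 :: real^'p^'p) * (norm \<Sigma>0 + a * K)))"
  have K': "K' \<ge> 0" using T a K by (simp add: K'_def)
  define L where "L = cv * (a * K + 1 + K')"
  have L: "L > 0" using cv a K K' by (simp add: L_def add_pos_nonneg)
  have "continuous_on UNIV q"
    unfolding q_def
    by (intro continuous_intros linear_continuous_on linear_conv_bounded_linear[THEN iffD1, OF linear_\<Phi>]) auto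
  from continuous_on_subset[OF this subset_UNIV]
  have "uniformly_continuous_on (cball 0 L) q"
    by (rule compact_uniformly_continuous) simp
  then obtain d1 where d1: "d1 > 0" "\<And>u v. norm u \<le> L \<Longrightarrow> norm v \<le> L \<Longrightarrow> norm (u - v) < d1 \<Longrightarrow> \<bar>q u - q v\<bar> < e / 2"
    using e unfolding uniformly_continuous_on_def dist_norm real_norm_def
    by (metis half_gt_zero mem_cball_0)
  define e1 where "e1 = e / (2 * L\<^sup>2)"
  have e1: "e1 > 0" "e1 * L\<^sup>2 = e / 2" using e L by (simp_all add: e1_def)
  obtain d where d: "d > 0" "\<And>n \<omega>. n \<ge> 1 \<Longrightarrow> \<omega> \<in> space M \<Longrightarrow> norm (vech (Q n \<omega>) - x0) < d \<Longrightarrow>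
      \<bar>contrast (Q n \<omega>) (\<Sigma> (\<theta>hat n \<omega>)) - q (vech (Q n \<omega>) - x0)\<bar> \<le> e1 * (norm (vech (Q n \<omega>) - x0))\<^sup>2"
    using expansion[unfolded expands_def, rule_format, OF e1(1)] unfolding q_def by blast
  \<comment> \<open>The cap 1 lets \<open>L\<close> be fixed before \<eta>; the other term makes |r|
    at most d1 / 2.\<close>
  define \<eta> where "\<eta> = min 1 (d1 / (2 * (cv * (1 + K'))))"
  have \<eta>: "\<eta> > 0" "\<eta> \<le> 1" "cv * (\<eta> * (1 + K')) < d1"
  proof -
    show "\<eta> > 0" "\<eta> \<le> 1" using d1(1) cv(1) K' by (auto simp: \<eta>_def)
    have "cv * (1 + K') * \<eta> \<le> cv * (1 + K') * (d1 / (2 * (cv * (1 + K'))))"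
      using cv(1) K' by (intro mult_left_mono) (auto simp: \<eta>_def)
    also have "\<dots> = d1 / 2" using cv(1) K' by simp
    finally show "cv * (\<eta> * (1 + K')) < d1" using d1(1) by (simp add: algebra_simps)
  qed
  \<comment> \<open>From here on L / sqrt n < d, so the unscaled error lies where the expansion
    holds.\<close>
  obtain n1 :: nat where n1: "(L / d)\<^sup>2 < real n1" using reals_Archimedean2 by blast
  have "\<bar>stat n \<omega> - (\<Sum>c\<in>B. (c \<bullet> Z n \<omega>)\<^sup>2) / 2\<bar> \<le> e"
    if n: "n \<ge> max 1 n1" and \<omega>: "\<omega> \<in> space M" and Z: "norm (Z n \<omega>) \<le> K" and res: "res n \<omega> \<le> \<eta>" for n \<omega>
  proof -
    have n1': "n \<ge> 1" and sn: "sqrt (real n) \<ge> 1" using n by auto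
    have AZ: "norm (A ** Z n \<omega> ** transpose A) \<le> a * K"
      using a(2)[of "Z n \<omega>"] Z a(1) by (meson less_imp_le mult_left_mono order_trans)
    have "norm ((1 / sqrt (real n)) *\<^sub>R (A ** Z n \<omega> ** transpose A)) \<le> 1 * norm (A ** Z n \<omega> ** transpose A)"
      unfolding norm_scaleR using sn by (intro mult_right_mono) auto
    then have "norm (Qw n \<omega>) \<le> norm \<Sigma>0 + a * K"
      unfolding Qw_def using AZ by (intro norm_triangle_le) auto
    then have "mat 1 \<bullet> Qw n \<omega> \<le> norm (mat 1 :: real^'p^'p) * (norm \<Sigma>0 + a * K)"
      using norm_cauchy_schwarz[of "mat 1" "Qw n \<omega>"] by (meson mult_left_mono norm_ge_zero order_trans)
    then have sc: "scale n \<omega> \<le> K'"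
      unfolding scale_def K'_def using T by simp
    have sc0: "scale n \<omega> \<ge> 0"
      unfolding scale_eq[OF n1' \<omega>] by (intro real_sqrt_ge_zero sum_nonneg) auto
    have "norm (sqrt (real n) *\<^sub>R (Q n \<omega> - Qw n \<omega>)) = res n \<omega> * (1 + scale n \<omega>)"
      using sc0 by (simp add: res_def)
    also have "\<dots> \<le> \<eta> * (1 + K')"
      using res sc sc0 \<eta>(1) by (intro mult_mono) auto
    finally have diff: "norm (sqrt (real n) *\<^sub>R (Q n \<omega> - Qw n \<omega>)) \<le> \<eta> * (1 + K')" .
    define u where "u = vech (A ** Z n \<omega> ** transpose A)"
    define v where "v = vech (Q n \<omega>) - x0"
    define r where "r = vech (sqrt (real n) *\<^sub>R (Q n \<omega> - Qw n \<omega>))"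
    have "sqrt (real n) *\<^sub>R (Q n \<omega> - \<Sigma>0) = sqrt (real n) *\<^sub>R (Q n \<omega> - Qw n \<omega>) + A ** Z n \<omega> ** transpose A"
      using sn by (simp add: Qw_def algebra_simps)
    then have "vech (sqrt (real n) *\<^sub>R (Q n \<omega> - \<Sigma>0)) = r + u"
      by (simp add: r_def u_def linear_add[OF linear_vech])
    then have v: "sqrt (real n) *\<^sub>R v = r + u"
      by (simp add: v_def x0_def linear_diff[OF linear_vech] linear_scale[OF linear_vech])
    have r: "norm r \<le> cv * (\<eta> * (1 + K'))"
      unfolding r_def using cv(2) diff cv(1) by (meson less_imp_le mult_left_mono order_trans)
    have "cv * (\<eta> * (1 + K')) \<le> cv * (1 * (1 + K'))"
      using cv(1) \<eta>(2) K' by (intro mult_left_mono mult_right_mono) auto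
    then have r': "norm r \<le> cv * (1 + K')" using r by simp
    have u: "norm u \<le> cv * (a * K)"
      unfolding u_def using cv(2) AZ cv(1) by (meson less_imp_le mult_left_mono order_trans)
    have Lsplit: "L = cv * (a * K) + cv * (1 + K')" "0 \<le> cv * (1 + K')"
      using cv(1) K' by (simp_all add: L_def distrib_left)
    have uL: "norm u \<le> L"
      using u Lsplit by linarith
    have vL: "norm (sqrt (real n) *\<^sub>R v) \<le> L"
      unfolding v using norm_triangle_ineq[of r u] r' u Lsplit(1) by linarith
    have "\<bar>q (sqrt (real n) *\<^sub>R v) - q u\<bar> < e / 2"
      using r \<eta>(3) by (intro d1(2)[OF vL uL]) (simp add: v)
    moreover have "q (sqrt (real n) *\<^sub>R v) = real n * q v"
      by (simp add: q_def linear_scale[OF linear_\<Phi>] power_mult_distrib sum_distrib_left)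
    moreover have "q u = (\<Sum>c\<in>B. (c \<bullet> Z n \<omega>)\<^sup>2) / 2"
      unfolding q_def u_def
      by (intro arg_cong2[where f = "(/)"] sum.cong refl arg_cong2[where f = power] \<Phi>_pushforward transpose_Z)
         (use B(2) in auto)
    ultimately have 1: "\<bar>real n * q v - (\<Sum>c\<in>B. (c \<bullet> Z n \<omega>)\<^sup>2) / 2\<bar> < e / 2" by simp
    have "L / d < sqrt (real n)"
      using n1 n L d(1) by (intro real_less_rsqrt) simp
    then have "L < sqrt (real n) * d" using d(1) by (simp add: pos_divide_less_eq)
    then have "sqrt (real n) * norm v < sqrt (real n) * d" using vL by simp
    then have "norm v < d" using sn by (simp add: mult_less_cancel_left_pos)
    then have "\<bar>contrast (Q n \<omega>) (\<Sigma> (\<theta>hat n \<omega>)) - q v\<bar> \<le> e1 * (norm v)\<^sup>2"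
      unfolding v_def by (rule d(2)[OF n1' \<omega>])
    then have "real n * \<bar>contrast (Q n \<omega>) (\<Sigma> (\<theta>hat n \<omega>)) - q v\<bar> \<le> real n * (e1 * (norm v)\<^sup>2)"
      by (rule mult_left_mono) simp
    also have "\<dots> = e1 * (norm (sqrt (real n) *\<^sub>R v))\<^sup>2"
      by (simp add: power_mult_distrib)
    also have "\<dots> \<le> e1 * L\<^sup>2"
      using vL e1(1) by (intro mult_left_mono power_mono) auto
    also have "real n * \<bar>contrast (Q n \<omega>) (\<Sigma> (\<theta>hat n \<omega>)) - q v\<bar> = \<bar>stat n \<omega> - real n * q v\<bar>"
    proof -
      have "stat n \<omega> - real n * q v = real n * (contrast (Q n \<omega>) (\<Sigma> (\<theta>hat n \<omega>)) - q v)"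
        by (simp add: stat_def right_diff_distrib)
      then show ?thesis by (simp only: abs_mult abs_of_nat)
    qed
    finally show ?thesis using 1 e1(2) by linarith
  qed
  then show ?thesis using \<eta>(1) by blast
qed

text \<open>On the good event the exponentials differ by at most \<beta> times the distance of their
  arguments, elsewhere by at most 1. The order of choices matters: \<open>K\<close> by Chebyshev
  uniformly in n, then \<eta> depending on \<open>K\<close>, and only then n so large that
  \<open>res\<close> exceeds \<eta> with small probability.\<close>

lemma laplace_stat_close:
  fixes Y :: "nat \<Rightarrow> 'a \<Rightarrow> real"
  assumes Y: "\<And>n. Y n \<in> borel_measurable M" "\<And>n \<omega>. 0 \<le> Y n \<omega>" and \<beta>: "\<beta> \<ge> 0"
    and close: "\<And>K e. K > 0 \<Longrightarrow> e > 0 \<Longrightarrow> \<exists>n0. \<exists>\<eta>>0. \<forall>n\<ge>n0. \<forall>\<omega>\<in>space M. norm (Z n \<omega>) \<le> K \<and> res n \<omega> \<le> \<eta> \<longrightarrow>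
      \<bar>stat n \<omega> - Y n \<omega>\<bar> \<le> e"
  shows "(\<lambda>n. expectation (\<lambda>\<omega>. exp (- (\<beta> * stat n \<omega>))) - expectation (\<lambda>\<omega>. exp (- (\<beta> * Y n \<omega>)))) \<longlonglongrightarrow> 0"
proof (rule LIMSEQ_I)
  fix e :: real assume e: "0 < e"
  have exp_lip: "\<bar>exp (- (\<beta> * s)) - exp (- (\<beta> * t))\<bar> \<le> \<beta> * \<bar>s - t\<bar>" if "s \<ge> 0" "t \<ge> 0" for s t
  proof -
    have *: "exp (- x) - exp (- y) \<le> y - x" if "0 \<le> x" "x \<le> y" for x y :: real
    proof -
      have "exp (- x) * (1 - exp (- (y - x))) \<le> 1 * (y - x)"
      proof (rule mult_mono)
        show "1 - exp (- (y - x)) \<le> y - x" using exp_ge_add_one_self[of "- (y - x)"] by linarith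
      qed (use that in auto)
      then show ?thesis by (simp add: right_diff_distrib exp_add[symmetric])
    qed
    have "\<bar>exp (- (\<beta> * s)) - exp (- (\<beta> * t))\<bar> \<le> \<bar>\<beta> * s - \<beta> * t\<bar>"
      using *[of "\<beta> * s" "\<beta> * t"] *[of "\<beta> * t" "\<beta> * s"] that \<beta> by (cases "\<beta> * s \<le> \<beta> * t") auto
    then show ?thesis using \<beta> by (simp add: right_diff_distrib[symmetric] abs_mult)
  qed
  define C where "C = 2 * (real CARD('r))\<^sup>2"
  \<comment> \<open>Makes the Chebyshev bound \<open>C / K\<^sup>2\<close> at most e / 4; the added
    1 keeps \<open>K\<close> positive. The two other errors get e / 4 each.\<close>
  define K where "K = sqrt (4 * C / e) + 1"
  have C: "C > 0" by (simp add: C_def)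
  have K: "K > 0" "C / K\<^sup>2 \<le> e / 4"
  proof -
    show "K > 0" using C e by (simp add: K_def add_nonneg_pos)
    have "sqrt (4 * C / e) ^ 2 \<le> K\<^sup>2" using C e by (intro power_mono) (auto simp: K_def)
    then have "4 * C / e \<le> K\<^sup>2" using C e by simp
    then show "C / K\<^sup>2 \<le> e / 4" using e \<open>K > 0\<close> by (simp add: field_simps)
  qed
  define e1 where "e1 = e / (4 * (\<beta> + 1))"
  have e1: "e1 > 0" "\<beta> * e1 \<le> e / 4"
    using e \<beta> by (auto simp: e1_def field_simps)
  obtain n0 \<eta> where \<eta>: "\<eta> > 0" and n0: "\<And>n \<omega>. n \<ge> n0 \<Longrightarrow> \<omega> \<in> space M \<Longrightarrow> norm (Z n \<omega>) \<le> K \<Longrightarrow> res n \<omega> \<le> \<eta> \<Longrightarrow>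
      \<bar>stat n \<omega> - Y n \<omega>\<bar> \<le> e1"
    using close[OF K(1) e1(1)] by blast
  note [measurable] = res_measurable Z_measurable stat_measurable Y(1)
  have "(\<lambda>n. expectation (\<lambda>\<omega>. indicator {\<eta><..} (res n \<omega>) :: real)) \<longlonglongrightarrow> expectation (\<lambda>\<omega>. 0)"
  proof (rule integral_dominated_convergence[where w = "\<lambda>_. 1"])
    show "AE \<omega> in M. (\<lambda>n. indicator {\<eta><..} (res n \<omega>) :: real) \<longlonglongrightarrow> 0"
      using res_null
    proof eventually_elim
      case (elim \<omega>)
      then have "\<forall>\<^sub>F n in sequentially. res n \<omega> < \<eta>"
        using \<eta> by (rule order_tendstoD)
      then have "\<forall>\<^sub>F n in sequentially. (indicator {\<eta><..} (res n \<omega>) :: real) = 0"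
        by eventually_elim auto
      then show ?case by (rule tendsto_eventually)
    qed
  qed (auto simp: indicator_def)
  then have "(\<lambda>n. expectation (\<lambda>\<omega>. indicator {\<eta><..} (res n \<omega>) :: real)) \<longlonglongrightarrow> 0" by simp
  then have "\<forall>\<^sub>F n in sequentially. expectation (\<lambda>\<omega>. indicator {\<eta><..} (res n \<omega>) :: real) < e / 4"
    by (rule order_tendstoD(2)) (use e in simp)
  then obtain n1 where n1: "\<And>n. n \<ge> n1 \<Longrightarrow> expectation (\<lambda>\<omega>. indicator {\<eta><..} (res n \<omega>) :: real) < e / 4"
    unfolding eventually_sequentially by blast
  have "\<bar>expectation (\<lambda>\<omega>. exp (- (\<beta> * stat n \<omega>))) - expectation (\<lambda>\<omega>. exp (- (\<beta> * Y n \<omega>)))\<bar> < e"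
    if n: "n \<ge> max 1 (max n0 n1)" for n
  proof -
    let ?IZ = "\<lambda>\<omega>. indicator {K..} (norm (Z n \<omega>)) :: real" and ?IR = "\<lambda>\<omega>. indicator {\<eta><..} (res n \<omega>) :: real"
    have int: "integrable M (\<lambda>\<omega>. exp (- (\<beta> * stat n \<omega>)))" "integrable M (\<lambda>\<omega>. exp (- (\<beta> * Y n \<omega>)))"
      using \<beta> stat_nonneg Y(2) by (auto intro!: integrable_const_bound[where B = 1] AE_I2)
    have intI: "integrable M ?IZ" "integrable M ?IR"
      by (auto intro!: integrable_const_bound[where B = 1] simp: indicator_def)
    have pw: "\<bar>exp (- (\<beta> * stat n \<omega>)) - exp (- (\<beta> * Y n \<omega>))\<bar> \<le> \<beta> * e1 + ?IZ \<omega> + ?IR \<omega>" if \<omega>: "\<omega> \<in> space M" for \<omega>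
    proof (cases "norm (Z n \<omega>) < K \<and> res n \<omega> \<le> \<eta>")
      case True
      then have "\<bar>stat n \<omega> - Y n \<omega>\<bar> \<le> e1" using n0 n \<omega> by simp
      then have "\<beta> * \<bar>stat n \<omega> - Y n \<omega>\<bar> \<le> \<beta> * e1" using \<beta> by (rule mult_left_mono)
      then show ?thesis
        using exp_lip[OF stat_nonneg[OF \<omega>] Y(2), of n n \<omega>] by (auto intro: order_trans add_increasing2)
    next
      case False
      have "exp (- (\<beta> * stat n \<omega>)) \<le> 1" "exp (- (\<beta> * Y n \<omega>)) \<le> 1"
        using \<beta> stat_nonneg[OF \<omega>] Y(2) by simp_all
      moreover have "exp (- (\<beta> * stat n \<omega>)) > 0" "exp (- (\<beta> * Y n \<omega>)) > 0" by simp_all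
      moreover have "1 \<le> ?IZ \<omega> + ?IR \<omega>" using False by (auto simp: indicator_def not_less not_le)
      moreover have "0 \<le> \<beta> * e1" using \<beta> e1 by simp
      ultimately show ?thesis by linarith
    qed
    have "\<bar>expectation (\<lambda>\<omega>. exp (- (\<beta> * stat n \<omega>))) - expectation (\<lambda>\<omega>. exp (- (\<beta> * Y n \<omega>)))\<bar> =
        \<bar>expectation (\<lambda>\<omega>. exp (- (\<beta> * stat n \<omega>)) - exp (- (\<beta> * Y n \<omega>)))\<bar>"
      using int by simp
    also have "\<dots> \<le> expectation (\<lambda>\<omega>. \<bar>exp (- (\<beta> * stat n \<omega>)) - exp (- (\<beta> * Y n \<omega>))\<bar>)"
      by (rule integral_abs_bound)
    also have "\<dots> \<le> expectation (\<lambda>\<omega>. \<beta> * e1 + ?IZ \<omega> + ?IR \<omega>)"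
      using int intI pw by (intro integral_mono) auto
    also have "\<dots> = \<beta> * e1 + expectation ?IZ + expectation ?IR"
      using intI by (simp add: prob_space)
    also have "expectation ?IZ = prob {\<omega> \<in> space M. K \<le> norm (Z n \<omega>)}"
    proof -
      have "expectation ?IZ = expectation (indicator {\<omega> \<in> space M. K \<le> norm (Z n \<omega>)})"
        by (intro Bochner_Integration.integral_cong) (auto simp: indicator_def)
      then show ?thesis by simp
    qed
    also have "\<dots> \<le> C / K\<^sup>2" unfolding C_def using n by (intro Z_tight K(1)) auto
    finally have "\<bar>expectation (\<lambda>\<omega>. exp (- (\<beta> * stat n \<omega>))) - expectation (\<lambda>\<omega>. exp (- (\<beta> * Y n \<omega>)))\<bar> \<le>
        \<beta> * e1 + C / K\<^sup>2 + expectation ?IR" by simp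
    moreover have "expectation ?IR < e / 4" using n by (intro n1) simp
    ultimately show ?thesis using K(2) e1(2) e by linarith
  qed
  then show "\<exists>n0. \<forall>n\<ge>n0. norm (expectation (\<lambda>\<omega>. exp (- (\<beta> * stat n \<omega>))) - expectation (\<lambda>\<omega>. exp (- (\<beta> * Y n \<omega>))) - 0) < e"
    by (intro exI[of _ "max 1 (max n0 n1)"]) simp
qed

lemma inner_Z: "C \<bullet> Z n \<omega> = (\<Sum>k<n. gquad C (($) (w n k \<omega>))) / sqrt (real n)"
proof -
  have "C \<bullet> Z n \<omega> = (\<Sum>i\<in>UNIV. \<Sum>j\<in>UNIV. \<Sum>k<n. C $ i $ j * wick i j (($) (w n k \<omega>))) / sqrt (real n)"
    by (simp add: inner_vec_def Z_def sum_divide_distrib sum_distrib_left)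
  also have "(\<Sum>i\<in>UNIV. \<Sum>j\<in>UNIV. \<Sum>k<n. C $ i $ j * wick i j (($) (w n k \<omega>))) =
      (\<Sum>i\<in>UNIV. \<Sum>k<n. \<Sum>j\<in>UNIV. C $ i $ j * wick i j (($) (w n k \<omega>)))"
    by (intro sum.cong refl sum.swap)
  also have "\<dots> = (\<Sum>k<n. gquad C (($) (w n k \<omega>)))"
    unfolding gquad_def by (rule sum.swap)
  finally show ?thesis .
qed

theorem stat_weak_limit:
  "weak_conv_m (\<lambda>n. distr M borel (stat n)) (chi_squared (CARD('p uprod) - CARD('s)))"
proof -
  obtain B where B: "finite B" "B \<subseteq> range \<Phi>" "card B = CARD('p uprod) - CARD('s)"
    "pairwise orthogonal B" "\<And>c. c \<in> B \<Longrightarrow> norm c = 1"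
    and expansion: "expands B"
    using contrast_expansion by blast
  define r where "r = CARD('p uprod) - CARD('s)"
  obtain c where c: "bij_betw c {..<r} B"
    using ex_bij_betw_nat_finite[OF B(1)] B(3) by (auto simp: r_def atLeast0LessThan)
  have cB: "c j \<in> B" if "j < r" for j using c that by (auto simp: bij_betw_def)
  \<comment> \<open>The factor 1/2 of the contrast is absorbed here and cancels the factor 2 of the
    variance, leaving standard normal coordinates.\<close>
  define Y where "Y n j \<omega> = (c j \<bullet> Z n \<omega>) / sqrt 2" for n j \<omega>
  have Ym: "Y n j \<in> borel_measurable M" for n j
    unfolding Y_def using Z_measurable[of n] by measurable
  have sumY: "(\<Sum>j<r. (Y n j \<omega>)\<^sup>2) = (\<Sum>c\<in>B. (c \<bullet> Z n \<omega>)\<^sup>2) / 2" for n \<omega>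
    unfolding sum.reindex_bij_betw[OF c, symmetric] by (simp add: Y_def power_divide sum_divide_distrib)
  \<comment> \<open>The idea of Cramer and Wold: a combination of the \<open>Y\<close> is again a
    single quadratic form. Orthonormality gives its matrix the squared norm of x, and membership in
    the range of \<Phi> the symmetry that the variance formula needs.\<close>
  have lim: "(\<lambda>n. LINT \<omega>|M. iexp (\<Sum>j<r. x j * Y n j \<omega>)) \<longlonglongrightarrow> exp (- (\<Sum>j<r. (x j)\<^sup>2) / 2)" for x
  proof -
    define C where "C = (\<Sum>j<r. x j *\<^sub>R c j)"
    have "(norm C)\<^sup>2 = (\<Sum>j<r. (norm (x j *\<^sub>R c j))\<^sup>2)"
      unfolding C_def
    proof (rule norm_sum_Pythagorean)
      show "pairwise (\<lambda>i j. orthogonal (x i *\<^sub>R c i) (x j *\<^sub>R c j)) {..<r}"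
      proof (rule pairwiseI)
        fix i j assume ij: "i \<in> {..<r}" "j \<in> {..<r}" "i \<noteq> j"
        then have "c i \<noteq> c j" using bij_betw_imp_inj_on[OF c] by (auto dest: inj_onD)
        then have "orthogonal (c i) (c j)" using pairwiseD[OF B(4)] cB ij by auto
        then show "orthogonal (x i *\<^sub>R c i) (x j *\<^sub>R c j)" by (simp add: orthogonal_def)
      qed
    qed simp
    also have "\<dots> = (\<Sum>j<r. (x j)\<^sup>2)"
      using B(5) cB by (intro sum.cong) (simp_all add: power_mult_distrib)
    finally have normC: "(norm C)\<^sup>2 = (\<Sum>j<r. (x j)\<^sup>2)" .
    have "transpose (c j) = c j" if "j < r" for j
      using cB[OF that] B(2) transpose_\<Phi> by auto
    then have "transpose C = C"
      unfolding C_def by (simp add: transpose_sum transpose_scaleR)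
    from quadratic_char_limit[OF this, of "1 / sqrt 2"]
    have lim: "(\<lambda>n. LINT \<omega>|M. iexp (1 / sqrt 2 * (C \<bullet> Z n \<omega>))) \<longlonglongrightarrow> exp (- (\<Sum>j<r. (x j)\<^sup>2) / 2)"
      by (simp add: inner_Z normC power_divide)
    have eq: "1 / sqrt 2 * (C \<bullet> Z n \<omega>) = (\<Sum>j<r. x j * Y n j \<omega>)" for n \<omega>
      by (simp add: C_def Y_def inner_sum_left sum_divide_distrib)
    show ?thesis using lim unfolding eq .
  qed
  show ?thesis
    unfolding r_def[symmetric]
  proof (rule laplace_imp_weak_conv[OF prob_space_axioms stat_measurable stat_nonneg real_distribution_chi_squared AE_chi_squared])
    fix k :: nat
    have "(\<lambda>n. LINT \<omega>|M. exp (- (real k * (\<Sum>j<r. (Y n j \<omega>)\<^sup>2)))) \<longlonglongrightarrow> (LINT t|chi_squared r. exp (- (real k * t)))"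
      by (rule laplace_sum_squares[OF prob_space_axioms Ym lim]) simp
    moreover have "(\<lambda>n. (LINT \<omega>|M. exp (- (real k * stat n \<omega>))) -
        (LINT \<omega>|M. exp (- (real k * (\<Sum>j<r. (Y n j \<omega>)\<^sup>2))))) \<longlonglongrightarrow> 0"
    proof (rule laplace_stat_close)
      show "(\<lambda>\<omega>. \<Sum>j<r. (Y n j \<omega>)\<^sup>2) \<in> borel_measurable M" for n
        using Ym by measurable
      show "0 \<le> (\<Sum>j<r. (Y n j \<omega>)\<^sup>2)" for n \<omega> by (rule sum_nonneg) simp
      show "\<exists>n0. \<exists>\<eta>>0. \<forall>n\<ge>n0. \<forall>\<omega>\<in>space M. norm (Z n \<omega>) \<le> K \<and> res n \<omega> \<le> \<eta> \<longrightarrow>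
        \<bar>stat n \<omega> - (\<Sum>j<r. (Y n j \<omega>)\<^sup>2)\<bar> \<le> e" if "K > 0" "e > 0" for K e
        unfolding sumY by (rule stat_close[OF B(1,2) expansion that])
    qed simp
    ultimately have "(\<lambda>n. (LINT \<omega>|M. exp (- (real k * (\<Sum>j<r. (Y n j \<omega>)\<^sup>2)))) +
        ((LINT \<omega>|M. exp (- (real k * stat n \<omega>))) - (LINT \<omega>|M. exp (- (real k * (\<Sum>j<r. (Y n j \<omega>)\<^sup>2))))))
        \<longlonglongrightarrow> (LINT t|chi_squared r. exp (- (real k * t))) + 0"
      by (rule tendsto_add)
    then show "(\<lambda>n. LINT \<omega>|M. exp (- (real k * stat n \<omega>))) \<longlonglongrightarrow> (LINT t|chi_squared r. exp (- (real k * t)))"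
      by simp
  qed
qed

end

section \<open>Covariance structures\<close>

lemma sum_UNIV_sum: "(\<Sum>i\<in>(UNIV::('a::finite + 'b::finite) set). f i) = (\<Sum>a\<in>UNIV. f (Inl a)) + (\<Sum>b\<in>UNIV. f (Inr b))"
  unfolding UNIV_Plus_UNIV[symmetric] by (subst sum.Plus) auto

lemma all_sum_iff: "(\<forall>i. Pr i) \<longleftrightarrow> (\<forall>a. Pr (Inl a)) \<and> (\<forall>b. Pr (Inr b))"
  by (metis sumE)

lemma stack_nth [simp]: "stack v w $ Inl a = v $ a" "stack v w $ Inr b = w $ b"
  by (simp_all add: stack_def)

definition stack4 where "stack4 a b c d = stack (stack a b) (stack c d)"

lemma stack_exhaust: "\<exists>v w. z = stack v w"
proof
  show "\<exists>w. z = stack (\<chi> a. z $ Inl a) w"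
    by (rule exI[of _ "\<chi> b. z $ Inr b"]) (simp add: vec_eq_iff all_sum_iff)
qed

lemma stack4_exhaust: "\<exists>a b c d. z = stack4 a b c d"
  using stack_exhaust unfolding stack4_def by metis

lemma inner_stack: "stack a b \<bullet> stack c d = a \<bullet> c + b \<bullet> d"
  by (simp add: inner_vec_def sum_UNIV_sum)

lemma stack_add: "stack a b + stack c d = stack (a + c) (b + d)"
  by (simp add: vec_eq_iff all_sum_iff)

lemma stack_scaleR: "r *\<^sub>R stack a b = stack (r *\<^sub>R a) (r *\<^sub>R b)"
  by (simp add: vec_eq_iff all_sum_iff)

lemma stack_eq_0_iff: "stack a b = 0 \<longleftrightarrow> a = 0 \<and> b = 0"
  by (simp add: vec_eq_iff all_sum_iff)

lemma block_matrix_mult_stack: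
  "block_matrix A B C D *v stack x y = stack (A *v x + B *v y) (C *v x + D *v y)"
  by (simp add: vec_eq_iff all_sum_iff block_matrix_def matrix_vector_mult_def sum_UNIV_sum)

text \<open>Solving the structural equation for \<open>\<eta>\<close> gives \<open>X = load1 \<xi> + load2 \<delta> + load3 \<epsilon> + load4 \<zeta>\<close>.\<close>

definition load1 where "load1 m \<theta> u = stack (Lx1 m \<theta> *v u) (Lx2 m \<theta> *v (matrix_inv (Psi m \<theta>) *v (Gam m \<theta> *v u)))"
definition load2 :: "real^'a::finite \<Rightarrow> real^('a + 'b::finite)" where "load2 u = stack u 0"
definition load3 :: "real^'b::finite \<Rightarrow> real^('a::finite + 'b)" where "load3 u = stack 0 u"
definition load4 where "load4 m \<theta> u = stack 0 (Lx2 m \<theta> *v (matrix_inv (Psi m \<theta>) *v u))"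

lemma linear_loads: "linear (load1 m \<theta>)" "linear load2" "linear load3" "linear (load4 m \<theta>)"
  by (auto intro!: linearI simp: load1_def load2_def load3_def load4_def stack_add stack_scaleR
      matrix_vector_right_distrib matrix_vector_mult_scaleR)

text \<open>Sends the four stacked Wiener vectors to the noise part of \<open>X\<close>. Its matrix
  \<open>factor\<close> becomes the factor \<open>A\<close> of the covariance.\<close>

definition factor_map where
  "factor_map m \<theta> S1 S2 S3 S4 u =
     load1 m \<theta> (S1 *v (\<chi> a. u $ Inl (Inl a))) + load2 (S2 *v (\<chi> a. u $ Inl (Inr a))) +
     load3 (S3 *v (\<chi> a. u $ Inr (Inl a))) + load4 m \<theta> (S4 *v (\<chi> a. u $ Inr (Inr a)))"

lemma factor_map_stack4:
  "factor_map m \<theta> S1 S2 S3 S4 (stack4 a b c d) =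
     load1 m \<theta> (S1 *v a) + load2 (S2 *v b) + load3 (S3 *v c) + load4 m \<theta> (S4 *v d)"
  by (simp add: factor_map_def stack4_def vec_lambda_eta)

lemma linear_load_coordinates:
  fixes S :: "real^'i::finite^'k::finite" and f :: "'i \<Rightarrow> 'j::finite"
  assumes "linear h"
  shows "linear (\<lambda>u::real^'j. h (S *v (\<chi> a. u $ f a)))"
proof -
  have "linear (\<lambda>u::real^'j. (\<chi> a. u $ f a))" by (rule linearI) (simp_all add: vec_eq_iff)
  from linear_compose[OF linear_compose[OF this matrix_vector_mul_linear[of S]] assms]
  show ?thesis by (simp add: o_def)
qed

lemma linear_factor_map: "linear (factor_map m \<theta> S1 S2 S3 S4)"
  unfolding factor_map_def by (intro linear_compose_add linear_loads linear_load_coordinates)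

definition factor where "factor m \<theta> S1 S2 S3 S4 = matrix (factor_map m \<theta> S1 S2 S3 S4)"

lemma factor_mult: "factor m \<theta> S1 S2 S3 S4 *v u = factor_map m \<theta> S1 S2 S3 S4 u"
  unfolding factor_def by (rule matrix_works[OF linear_factor_map[THEN linear_matrix_vector_mul_eq[THEN iffD2]]])

text \<open>The adjoint is determined by its inner products with stacked vectors. Its second and
  third components are just S2^T y and S3^T z, the fact behind positive definiteness.\<close>

lemma transpose_factor_mult:
  "transpose (factor m \<theta> S1 S2 S3 S4) *v stack y z =
    (let t = transpose (matrix_inv (Psi m \<theta>)) *v (transpose (Lx2 m \<theta>) *v z) in
     stack4 (transpose S1 *v (transpose (Lx1 m \<theta>) *v y + transpose (Gam m \<theta>) *v t))
       (transpose S2 *v y) (transpose S3 *v z) (transpose S4 *v t))" (is "_ = ?r")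
proof -
  have "(transpose (factor m \<theta> S1 S2 S3 S4) *v stack y z) \<bullet> u = ?r \<bullet> u" for u
  proof -
    obtain a b c d where u: "u = stack4 a b c d" using stack4_exhaust by blast
    have "(transpose (factor m \<theta> S1 S2 S3 S4) *v stack y z) \<bullet> u = stack y z \<bullet> (factor m \<theta> S1 S2 S3 S4 *v u)"
      by (rule inner_transpose[symmetric])
    also have "\<dots> = ?r \<bullet> u"
      unfolding factor_mult u factor_map_stack4
      by (simp only: load1_def load2_def load3_def load4_def stack_add inner_stack stack4_def Let_def
          inner_add_left inner_add_right inner_transpose inner_zero_right add_0_left add_0_right
          matrix_vector_right_distrib ac_simps)
    finally show ?thesis .
  qed
  then show ?thesis by (metis vector_eq_ldot inner_commute)
qed

lemma Sigma_cov_factor: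
  assumes "Sxi m \<theta> = S1 ** transpose S1" "Sdelta m \<theta> = S2 ** transpose S2"
    "Seps m \<theta> = S3 ** transpose S3" "Szeta m \<theta> = S4 ** transpose S4"
  shows "factor m \<theta> S1 S2 S3 S4 ** transpose (factor m \<theta> S1 S2 S3 S4) = Sigma_cov m \<theta>"
proof -
  have "(factor m \<theta> S1 S2 S3 S4 ** transpose (factor m \<theta> S1 S2 S3 S4)) *v x = Sigma_cov m \<theta> *v x" for x
  proof -
    obtain y z where x: "x = stack y z" using stack_exhaust by blast
    show ?thesis
      unfolding x matrix_vector_mul_assoc[symmetric] transpose_factor_mult Let_def factor_mult factor_map_stack4
        Sigma_cov_def block_matrix_mult_stack load1_def load2_def load3_def load4_def stack_add assms
      by (simp add: matrix_transpose_mul matrix_vector_mult_add_rdistrib matrix_vector_right_distrib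
          matrix_vector_mul_assoc[symmetric] add_ac del: transpose_matrix_vector)
  qed
  then show ?thesis by (simp add: matrix_eq)
qed

text \<open>The form at x is |A^T x|^2. Its components S2^T y and S3^T z vanish only for y = 0 and z
  = 0, since the covariances of \<delta> and \<epsilon> are definite.\<close>

lemma Sigma_cov_pos_def:
  fixes m :: "('q::finite,'p1::finite,'p2::finite,'k1::finite,'k2::finite) sem"
  assumes "gram (Sxi m \<theta>)" "gram (Sdelta m \<theta>)" "gram (Seps m \<theta>)" "gram (Szeta m \<theta>)"
    and pd: "pos_def (Sdelta m \<theta>)" "pos_def (Seps m \<theta>)"
  shows "pos_def (Sigma_cov m \<theta>)"
proof -
  obtain S1 :: "real^'k1^'k1" and S2 :: "real^'p1^'p1" and S3 :: "real^'p2^'p2" and S4 :: "real^'k2^'k2" where S: "Sxi m \<theta> = S1 ** transpose S1" "Sdelta m \<theta> = S2 ** transpose S2"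
    "Seps m \<theta> = S3 ** transpose S3" "Szeta m \<theta> = S4 ** transpose S4"
    using assms(1-4) unfolding gram_def by blast
  let ?A = "factor m \<theta> S1 S2 S3 S4"
  have eq: "Sigma_cov m \<theta> = ?A ** transpose ?A" using Sigma_cov_factor[OF S] by simp
  have quad: "x \<bullet> (Sigma_cov m \<theta> *v x) = (norm (transpose ?A *v x))\<^sup>2" for x
    unfolding eq by (simp add: matrix_vector_mul_assoc[symmetric] inner_transpose[of x] power2_norm_eq_inner
        del: transpose_matrix_vector)
  have inj: "v = 0" if "pos_def D" "D = U ** transpose U" "transpose U *v v = 0" for D U :: "real^'n^'n" and v
  proof (rule ccontr)
    assume "v \<noteq> 0"
    then have "0 < v \<bullet> (D *v v)" using that by (simp add: pos_def_def)
    then show False using that(3) by (simp add: that(2) matrix_vector_mul_assoc[symmetric] del: transpose_matrix_vector)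
  qed
  have "0 < x \<bullet> (Sigma_cov m \<theta> *v x)" if "x \<noteq> 0" for x
  proof -
    obtain y z where x: "x = stack y z" using stack_exhaust by blast
    have "transpose ?A *v x \<noteq> 0"
    proof
      assume "transpose ?A *v x = 0"
      then have "transpose S2 *v y = 0" "transpose S3 *v z = 0"
        unfolding x transpose_factor_mult Let_def stack4_def stack_eq_0_iff by auto
      then show False
        using inj[OF pd(1) S(2)] inj[OF pd(2) S(3)] that by (simp add: x stack_eq_0_iff del: transpose_matrix_vector)
    qed
    then show ?thesis by (simp add: quad del: transpose_matrix_vector)
  qed
  moreover have "transpose (Sigma_cov m \<theta>) = Sigma_cov m \<theta>"
    by (simp add: eq matrix_transpose_mul)
  ultimately show ?thesis by (simp add: pos_def_def)
qed

lemma entries_differentiable: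
  fixes A :: "real^'q::finite \<Rightarrow> real^'b::finite^'a::finite"
  assumes "entries A \<subseteq> {\<lambda>\<theta>. c | c. True} \<union> {\<lambda>\<theta>. \<theta> $ k | k. True}"
  shows "A differentiable (at \<theta> within S)"
proof (intro differentiable_vec)
  fix i j
  have "(\<lambda>\<theta>. A \<theta> $ i $ j) \<in> entries A" by (auto simp: entries_def)
  then consider c where "(\<lambda>\<theta>. A \<theta> $ i $ j) = (\<lambda>\<theta>. c)" | k where "(\<lambda>\<theta>. A \<theta> $ i $ j) = (\<lambda>\<theta>. \<theta> $ k)"
    using assms by blast
  then show "(\<lambda>\<theta>. A \<theta> $ i $ j) differentiable (at \<theta> within S)"
    by cases (auto intro!: differentiable_nth simp del: One_nat_def)
qed

lemma Sigma_cov_differentiable: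
  fixes m :: "('q::finite,'p1::finite,'p2::finite,'k1::finite,'k2::finite) sem"
  assumes m: "sem_model m" and "\<theta> \<in> S" and inv: "\<And>\<theta>. \<theta> \<in> S \<Longrightarrow> invertible (Psi m \<theta>)"
  shows "Sigma_cov m differentiable (at \<theta> within S)"
proof -
  have "sem_entries m \<subseteq> {\<lambda>\<theta>. c | c. True} \<union> {\<lambda>\<theta>. \<theta> $ k | k. True}"
    using m by (simp add: sem_model_def)
  then have d: "Lx1 m differentiable (at \<theta> within S)" "Lx2 m differentiable (at \<theta> within S)"
    "Gam m differentiable (at \<theta> within S)" "Psi m differentiable (at \<theta> within S)"
    "Sxi m differentiable (at \<theta> within S)" "Sdelta m differentiable (at \<theta> within S)"
    "Seps m differentiable (at \<theta> within S)" "Szeta m differentiable (at \<theta> within S)"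
    unfolding sem_entries_def by (auto intro!: entries_differentiable)
  have i: "(\<lambda>\<theta>. matrix_inv (Psi m \<theta>)) differentiable (at \<theta> within S)"
    by (rule differentiable_matrix_inv[OF d(4) \<open>\<theta> \<in> S\<close> inv])
  have block: "(\<lambda>\<theta>. block_matrix (A \<theta>) (B \<theta>) (C \<theta>) (D \<theta>)) differentiable (at \<theta> within S)"
    if "A differentiable (at \<theta> within S)" "B differentiable (at \<theta> within S)"
      "C differentiable (at \<theta> within S)" "D differentiable (at \<theta> within S)"
    for A :: "real^'q \<Rightarrow> real^'p1^'p1" and B :: "real^'q \<Rightarrow> real^'p2^'p1" and C :: "real^'q \<Rightarrow> real^'p1^'p2" and D :: "real^'q \<Rightarrow> real^'p2^'p2"
  proof (intro differentiable_vec)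
    fix i j
    show "(\<lambda>\<theta>. block_matrix (A \<theta>) (B \<theta>) (C \<theta>) (D \<theta>) $ i $ j) differentiable (at \<theta> within S)"
      using that by (cases i; cases j) (auto simp: block_matrix_def intro!: differentiable_nth)
  qed
  show ?thesis
    unfolding Sigma_cov_def[abs_def] Let_def using d i
    by (intro block differentiable_add differentiable_matrix_mult differentiable_transpose)
qed

section \<open>Smooth drifts\<close>

text \<open>\<open>f\<close> and \<open>g\<close> differ by a path with a continuous derivative. The
  relation is stable under linear maps and sums, so it passes from the latent processes to
  \<open>X\<close>.\<close>

definition drift_plus :: "real \<Rightarrow> (real \<Rightarrow> 'v::euclidean_space) \<Rightarrow> (real \<Rightarrow> 'v) \<Rightarrow> bool" where
  "drift_plus T f g \<longleftrightarrow> (\<exists>b x0. continuous_on {0..T} b \<and> (\<forall>t\<in>{0..T}. f t = x0 + integral {0..t} b + g t))"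

lemma drift_plus_linear:
  fixes h :: "'v::euclidean_space \<Rightarrow> 'u::euclidean_space"
  assumes "linear h" "drift_plus T f g"
  shows "drift_plus T (\<lambda>t. h (f t)) (\<lambda>t. h (g t))"
proof -
  have bl: "bounded_linear h" using assms(1) by (simp add: linear_conv_bounded_linear)
  obtain b x0 where b: "continuous_on {0..T} b" and f: "\<forall>t\<in>{0..T}. f t = x0 + integral {0..t} b + g t"
    using assms(2) unfolding drift_plus_def by blast
  have "h (f t) = h x0 + integral {0..t} (h \<circ> b) + h (g t)" if "t \<in> {0..T}" for t
  proof -
    have "b integrable_on {0..t}"
      by (rule integrable_continuous_interval[OF continuous_on_subset[OF b]]) (use that in auto)
    then show ?thesis
      using f that by (simp add: linear_add[OF assms(1)] integral_linear[OF _ bl])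
  qed
  moreover have "continuous_on {0..T} (h \<circ> b)"
    unfolding o_def by (rule bounded_linear.continuous_on[OF bl b])
  ultimately show ?thesis unfolding drift_plus_def by blast
qed

lemma drift_plus_add:
  assumes "drift_plus T f g" "drift_plus T f' g'"
  shows "drift_plus T (\<lambda>t. f t + f' t) (\<lambda>t. g t + g' t)"
proof -
  obtain b x0 where b: "continuous_on {0..T} b" and f: "\<forall>t\<in>{0..T}. f t = x0 + integral {0..t} b + g t"
    using assms(1) unfolding drift_plus_def by blast
  obtain b' x0' where b': "continuous_on {0..T} b'" and f': "\<forall>t\<in>{0..T}. f' t = x0' + integral {0..t} b' + g' t"
    using assms(2) unfolding drift_plus_def by blast
  have "f t + f' t = (x0 + x0') + integral {0..t} (\<lambda>s. b s + b' s) + (g t + g' t)" if t: "t \<in> {0..T}" for t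
  proof -
    have "b integrable_on {0..t}" "b' integrable_on {0..t}"
      using t by (auto intro!: integrable_continuous_interval continuous_on_subset[OF b] continuous_on_subset[OF b'])
    then show ?thesis
      using f f' t by (simp add: Henstock_Kurzweil_Integration.integral_add)
  qed
  moreover have "continuous_on {0..T} (\<lambda>s. b s + b' s)" by (intro continuous_on_add b b')
  ultimately show ?thesis unfolding drift_plus_def by blast
qed

lemma sde_solution_drift_plus:
  assumes "sde_solution M T B S W Y" "regular_drift B"
  shows "AE \<omega> in M. drift_plus T (\<lambda>t. Y t \<omega>) (\<lambda>t. S *v W t \<omega>)"
proof -
  obtain L where "L-lipschitz_on UNIV B" using assms(2) by (auto simp: regular_drift_def)
  then have B: "continuous_on UNIV B" by (rule lipschitz_on_continuous_on)
  obtain y0 where "AE \<omega> in M. \<forall>t\<in>{0..T}. Y t \<omega> = y0 + integral {0..t} (\<lambda>s. B (Y s \<omega>)) + S *v W t \<omega>"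
    using assms(1) unfolding sde_solution_def by blast
  moreover have "AE \<omega> in M. continuous_on {0..T} (\<lambda>t. Y t \<omega>)"
    using assms(1) unfolding sde_solution_def by blast
  ultimately show ?thesis
  proof eventually_elim
    case (elim \<omega>)
    have "continuous_on {0..T} (\<lambda>s. B (Y s \<omega>))"
      by (rule continuous_on_compose2[OF B elim(2)]) simp
    then show ?case using elim(1) unfolding drift_plus_def by blast
  qed
qed

section \<open>Independence of Wiener increments\<close>

lemma (in prob_space) indep_vars_from_image:
  assumes indep: "indep_vars (\<lambda>i. M' (f i)) (\<lambda>i. X (f i)) I" and inj: "inj_on f I"
  shows "indep_vars M' X (f ` I)"
proof -
  let ?g = "inv_into I f"
  have "?g ` (f ` I) = I"
    using inj by (simp add: inj_on_def image_image inv_into_f_f[OF inj] cong: image_cong)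
  with indep have "indep_vars (\<lambda>i. M' (f i)) (\<lambda>i. X (f i)) (?g ` (f ` I))" by simp
  then have "indep_vars (\<lambda>j. M' (f (?g j))) (\<lambda>j. X (f (?g j))) (f ` I)"
    by (rule indep_vars_image) (rule inj_on_inv_into[OF order_refl])
  then show ?thesis
    by (rule indep_vars_cong[THEN iffD1, rotated -1]) (simp_all add: f_inv_into_f)
qed

text \<open>Independence between blocks and within each block give joint independence: the product
  formula splits first over blocks, then inside them. The \<open>G j\<close> are sigma algebras so
  that the finite intersections belonging to a block stay in \<open>G j\<close>. Full intersections
  suffice, because every system of events contains the whole space.\<close>

lemma (in prob_space) indep_vars_Union:
  assumes L: "finite L" "L \<noteq> {}" and I: "\<And>j. j \<in> L \<Longrightarrow> finite (I j)" "\<And>j. j \<in> L \<Longrightarrow> I j \<noteq> {}"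
    "disjoint_family_on I L"
    and G: "indep_sets G L" "\<And>j. j \<in> L \<Longrightarrow> sigma_algebra (space M) (G j)"
    and X: "\<And>j. j \<in> L \<Longrightarrow> indep_vars M' X (I j)"
    and XG: "\<And>j i A. j \<in> L \<Longrightarrow> i \<in> I j \<Longrightarrow> A \<in> sets (M' i) \<Longrightarrow> X i -` A \<inter> space M \<in> G j"
  shows "indep_vars M' X (\<Union>j\<in>L. I j)"
  unfolding indep_vars_def2
proof
  let ?F = "\<lambda>i. {X i -` A \<inter> space M |A. A \<in> sets (M' i)}"
  show rv: "\<forall>i\<in>(\<Union>j\<in>L. I j). random_variable (M' i) (X i)"
    using X by (auto simp: indep_vars_def2)
  show "indep_sets ?F (\<Union>j\<in>L. I j)"
  proof (subst indep_sets_finite)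
    show "(\<Union>j\<in>L. I j) \<noteq> {}" "finite (\<Union>j\<in>L. I j)" using L I by auto
    show "?F i \<subseteq> events" if "i \<in> (\<Union>j\<in>L. I j)" for i
      using rv that by (auto intro: measurable_sets)
    show "space M \<in> ?F i" if "i \<in> (\<Union>j\<in>L. I j)" for i
    proof -
      have "X i -` space (M' i) \<inter> space M = space M"
        using rv that by (auto dest: measurable_space)
      then show ?thesis by (metis (mono_tags, lifting) mem_Collect_eq sets.top)
    qed
    show "\<forall>A\<in>Pi (\<Union>j\<in>L. I j) ?F. prob (\<Inter>i\<in>(\<Union>j\<in>L. I j). A i) = (\<Prod>i\<in>(\<Union>j\<in>L. I j). prob (A i))"
    proof
      fix A assume A: "A \<in> Pi (\<Union>j\<in>L. I j) ?F"
      define E where "E j = (\<Inter>i\<in>I j. A i)" for j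
      have AG: "A i \<in> G j" if "j \<in> L" "i \<in> I j" for i j
        using A that XG[OF that] by (fastforce simp: Pi_iff)
      have E: "E j \<in> G j" if "j \<in> L" for j
      proof -
        interpret sigma_algebra "space M" "G j" by (rule G(2)[OF that])
        show ?thesis
          unfolding E_def using that AG I by (intro finite_INT) auto
      qed
      have "prob (\<Inter>i\<in>(\<Union>j\<in>L. I j). A i) = prob (\<Inter>j\<in>L. E j)"
        by (intro arg_cong[where f = prob]) (auto simp: E_def)
      also have "\<dots> = (\<Prod>j\<in>L. prob (E j))"
        using E L by (intro indep_setsD[OF G(1)]) auto
      also have "\<dots> = (\<Prod>j\<in>L. \<Prod>i\<in>I j. prob (A i))"
      proof (intro prod.cong refl)
        fix j assume j: "j \<in> L"
        then have "indep_sets ?F (I j)" using X by (auto simp: indep_vars_def2)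
        then show "prob (E j) = (\<Prod>i\<in>I j. prob (A i))"
          unfolding E_def using I A j by (intro indep_setsD) (auto simp: Pi_iff)
      qed
      also have "\<dots> = (\<Prod>i\<in>(\<Union>j\<in>L. I j). prob (A i))"
        using L I by (intro prod.UNION_disjoint[symmetric]) (auto simp: disjoint_family_on_def)
      finally show "prob (\<Inter>i\<in>(\<Union>j\<in>L. I j). A i) = (\<Prod>i\<in>(\<Union>j\<in>L. I j). prob (A i))" .
    qed
  qed
qed

lemma grid_strict:
  assumes "T > 0" "k < n"
  shows "0 \<le> real k * (T / real n)" "real k * (T / real n) < real (Suc k) * (T / real n)" "real (Suc k) * (T / real n) \<le> T"
    "real (Suc k) * (T / real n) - real k * (T / real n) = T / real n"
proof -
  have "0 < T / real n" using assms by simp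
  then show "real k * (T / real n) < real (Suc k) * (T / real n)" by (intro mult_strict_right_mono) auto
  show "0 \<le> real k * (T / real n)" using grid_in_interval[of T k n] assms by simp
  show "real (Suc k) * (T / real n) \<le> T" using grid_in_interval[of T "Suc k" n] assms by simp
  show "real (Suc k) * (T / real n) - real k * (T / real n) = T / real n"
    by (simp add: algebra_simps add_divide_distrib)
qed

text \<open>The blocks are the time steps: increments are independent as vectors across steps and
  coordinatewise within a step. The injection \<open>c\<close> places the coordinates into the
  larger index type of the stacked process.\<close>

lemma wiener_entries_indep:
  fixes W :: "real \<Rightarrow> 'w \<Rightarrow> real^'r::finite" and c :: "'r \<Rightarrow> 'q"
  assumes M: "prob_space M" and W: "wiener_process M T W" and T: "T > 0" and n: "n \<ge> 1" and c: "inj c"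
    and X: "\<And>k i \<omega>. X (k, c i) \<omega> = s * incr T n (\<lambda>t. W t \<omega>) k $ i"
  shows "prob_space.indep_vars M (\<lambda>_. borel) X ({..<n} \<times> range c)"
proof -
  interpret prob_space M by fact
  have rows: "indep_vars (\<lambda>_. borel) (\<lambda>k \<omega>. incr T n (\<lambda>t. W t \<omega>) k) {..<n}"
  proof -
    let ?s = "\<lambda>k. real k * (T / real n)"
    have "0 \<le> ?s 0 \<and> (\<forall>j<n. ?s j \<le> ?s (Suc j)) \<and> ?s n \<le> T"
      using grid_strict[OF T, of _ n] n T by (auto intro: less_imp_le)
    from wiener_process_def[THEN iffD1, THEN conjunct2, THEN conjunct2, THEN conjunct2, THEN conjunct1,
        THEN spec, THEN spec, THEN mp, OF W this]
    show ?thesis unfolding incr_def .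
  qed
  define G where "G k = sigma_sets (space M) {(\<lambda>\<omega>. incr T n (\<lambda>t. W t \<omega>) k) -` A \<inter> space M |A. A \<in> sets borel}" for k
  have "indep_vars (\<lambda>_. borel) X (\<Union>k\<in>{..<n}. {k} \<times> range c)"
  proof (rule indep_vars_Union[where G = G])
    show "indep_sets G {..<n}"
      using rows unfolding indep_vars_def G_def by blast
    show "sigma_algebra (space M) (G k)" for k
      unfolding G_def by (rule sigma_algebra_sigma_sets) auto
    fix k assume k: "k \<in> {..<n}"
    have "0 \<le> real k * (T / real n) \<and> real k * (T / real n) < real (Suc k) * (T / real n) \<and> real (Suc k) * (T / real n) \<le> T"
      using grid_strict[OF T, of k n] k by simp
    from wiener_process_def[THEN iffD1, THEN conjunct2, THEN conjunct2, THEN conjunct2, THEN conjunct2,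
        THEN spec, THEN spec, THEN mp, OF W this]
    have "indep_vars (\<lambda>_. borel) (\<lambda>i \<omega>. (W (real (Suc k) * (T / real n)) \<omega> - W (real k * (T / real n)) \<omega>) $ i) UNIV"
      by blast
    then have "indep_vars (\<lambda>_. borel) (\<lambda>i \<omega>. s * incr T n (\<lambda>t. W t \<omega>) k $ i) UNIV"
      unfolding incr_def by (rule indep_vars_compose2[where Y = "\<lambda>_ x. s * x"]) auto
    moreover have "(\<lambda>i \<omega>. s * incr T n (\<lambda>t. W t \<omega>) k $ i) = (\<lambda>i. X (k, c i))"
      by (intro ext) (simp only: X)
    ultimately have "indep_vars (\<lambda>_. borel) (\<lambda>i. X (k, c i)) UNIV" by simp
    then have "indep_vars (\<lambda>_. borel) X (range (\<lambda>i. (k, c i)))"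
      by (rule indep_vars_from_image) (use c in \<open>auto simp: inj_on_def\<close>)
    also have "range (\<lambda>i. (k, c i)) = {k} \<times> range c" by auto
    finally show "indep_vars (\<lambda>_. borel) X ({k} \<times> range c)" .
    fix i and A :: "real set" assume i: "i \<in> {k} \<times> range c" and A: "A \<in> sets borel"
    then obtain \<rho> where \<rho>: "i = (k, c \<rho>)" by auto
    have "(\<lambda>v::real^'r. s * v $ \<rho>) \<in> borel_measurable borel"
      by (intro borel_measurable_times borel_measurable_const borel_measurable_nth) simp
    from measurable_sets[OF this A] have "(\<lambda>v::real^'r. s * v $ \<rho>) -` A \<in> sets borel" by simp
    then have "(\<lambda>\<omega>. incr T n (\<lambda>t. W t \<omega>) k) -` ((\<lambda>v. s * v $ \<rho>) -` A) \<inter> space M \<in> G k"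
      unfolding G_def by (intro sigma_sets.Basic) blast
    also have "(\<lambda>\<omega>. incr T n (\<lambda>t. W t \<omega>) k) -` ((\<lambda>v. s * v $ \<rho>) -` A) \<inter> space M = X i -` A \<inter> space M"
      by (auto simp: \<rho> X)
    finally show "X i -` A \<inter> space M \<in> G k" .
  qed (use n in \<open>auto simp: disjoint_family_on_def lessThan_empty_iff\<close>)
  also have "(\<Union>k\<in>{..<n}. {k} \<times> range c) = {..<n} \<times> range c" by auto
  finally show ?thesis .
qed

text \<open>Independence of the four processes is stated for the sigma algebras they generate; this
  puts the events of single increments into them.\<close>

lemma process_events_incr:
  fixes W :: "real \<Rightarrow> 'w \<Rightarrow> real^'r::finite"
  assumes T: "T > 0" and k: "k < n" and A: "A \<in> sets borel"
  shows "(\<lambda>\<omega>. s * incr T n (\<lambda>t. W t \<omega>) k $ i) -` A \<inter> space M \<in> process_events M T W"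
proof -
  let ?gen = "{W t -` A \<inter> space M | t A. t \<in> {0..T} \<and> A \<in> sets borel}"
  let ?N = "sigma (space M) ?gen"
  have gen: "?gen \<subseteq> Pow (space M)" by auto
  have Wm: "W t \<in> borel_measurable ?N" if "t \<in> {0..T}" for t
    using that gen by (intro measurableI) (auto simp: space_measure_of sets_measure_of intro!: sigma_sets.Basic)
  have "(\<lambda>\<omega>. s * incr T n (\<lambda>t. W t \<omega>) k $ i) \<in> borel_measurable ?N"
    unfolding incr_def
    using Wm[OF grid_in_interval[OF T, of k n]] Wm[OF grid_in_interval[OF T, of "Suc k" n]] k
    by (intro borel_measurable_times borel_measurable_const borel_measurable_nth borel_measurable_diff) auto
  from measurable_sets[OF this A] show ?thesis
    using gen by (simp add: process_events_def space_measure_of sets_measure_of)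
qed

lemma wiener_entry_distr:
  fixes W :: "real \<Rightarrow> 'w \<Rightarrow> real^'r::finite"
  assumes M: "prob_space M" and W: "wiener_process M T W" and T: "T > 0" and k: "k < n"
  shows "distr M borel (\<lambda>\<omega>. (1 / sqrt (T / real n)) * incr T n (\<lambda>t. W t \<omega>) k $ i) = std_normal_distribution"
proof -
  interpret prob_space M by fact
  let ?X = "\<lambda>\<omega>. (W (real (Suc k) * (T / real n)) \<omega> - W (real k * (T / real n)) \<omega>) $ i"
  have h: "T / real n > 0" using T k by simp
  have "distributed M lborel ?X (normal_density 0 (sqrt (T / real n)))"
  proof -
    have "0 \<le> real k * (T / real n) \<and> real k * (T / real n) < real (Suc k) * (T / real n) \<and> real (Suc k) * (T / real n) \<le> T"
      using grid_strict[OF T k] by simp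
    from wiener_process_def[THEN iffD1, THEN conjunct2, THEN conjunct2, THEN conjunct2, THEN conjunct2,
        THEN spec, THEN spec, THEN mp, OF W this, THEN conjunct2, THEN spec, of i]
    show ?thesis unfolding grid_strict(4)[OF T k] .
  qed
  then have "distributed M lborel (\<lambda>\<omega>. (?X \<omega> - 0) / sqrt (T / real n)) std_normal_density"
    using h by (subst (asm) normal_standard_normal_convert) auto
  then have "distr M lborel (\<lambda>\<omega>. (1 / sqrt (T / real n)) * incr T n (\<lambda>t. W t \<omega>) k $ i) = std_normal_distribution"
    by (intro distributed_distr_eq_density) (simp add: incr_def)
  then show ?thesis by (simp cong: distr_cong)
qed

text \<open>\<open>indep_vars_Union\<close> once more, one level up: the blocks are now the four
  processes, whose coordinates occupy the ranges \<open>?R\<close>.\<close>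

lemma gauss_array_stack4:
  fixes W1 :: "real \<Rightarrow> 'w \<Rightarrow> real^'r1::finite" and W2 :: "real \<Rightarrow> 'w \<Rightarrow> real^'r2::finite"
    and W3 :: "real \<Rightarrow> 'w \<Rightarrow> real^'r3::finite" and W4 :: "real \<Rightarrow> 'w \<Rightarrow> real^'r4::finite"
  assumes M: "prob_space M" and T: "T > 0"
    and W: "wiener_process M T W1" "wiener_process M T W2" "wiener_process M T W3" "wiener_process M T W4"
    and indep: "indep_processes4 M T W1 W2 W3 W4"
  shows "gauss_array M (\<lambda>n k \<omega>. (1 / sqrt (T / real n)) *\<^sub>R
    incr T n (\<lambda>t. stack4 (W1 t \<omega>) (W2 t \<omega>) (W3 t \<omega>) (W4 t \<omega>)) k)"
proof -
  interpret prob_space M by fact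
  let ?w = "\<lambda>n k \<omega>. (1 / sqrt (T / real n)) *\<^sub>R
    incr T n (\<lambda>t. stack4 (W1 t \<omega>) (W2 t \<omega>) (W3 t \<omega>) (W4 t \<omega>)) k"
  have nth: "incr T n (\<lambda>t. stack4 (W1 t \<omega>) (W2 t \<omega>) (W3 t \<omega>) (W4 t \<omega>)) k $ Inl (Inl i1) = incr T n (\<lambda>t. W1 t \<omega>) k $ i1"
    "incr T n (\<lambda>t. stack4 (W1 t \<omega>) (W2 t \<omega>) (W3 t \<omega>) (W4 t \<omega>)) k $ Inl (Inr i2) = incr T n (\<lambda>t. W2 t \<omega>) k $ i2"
    "incr T n (\<lambda>t. stack4 (W1 t \<omega>) (W2 t \<omega>) (W3 t \<omega>) (W4 t \<omega>)) k $ Inr (Inl i3) = incr T n (\<lambda>t. W3 t \<omega>) k $ i3"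
    "incr T n (\<lambda>t. stack4 (W1 t \<omega>) (W2 t \<omega>) (W3 t \<omega>) (W4 t \<omega>)) k $ Inr (Inr i4) = incr T n (\<lambda>t. W4 t \<omega>) k $ i4"
    for n k \<omega> i1 i2 i3 i4
    by (simp_all add: incr_def stack4_def)
  show ?thesis
  proof (unfold_locales, goal_cases)
    case (1 n)
    let ?X = "\<lambda>(k, \<rho>) \<omega>. ?w n k \<omega> $ \<rho>"
    let ?R = "\<lambda>c::nat. [range (Inl \<circ> Inl), range (Inl \<circ> Inr), range (Inr \<circ> Inl), range (Inr \<circ> Inr)] ! c
      :: (('r1 + 'r2) + ('r3 + 'r4)) set"
    let ?G = "\<lambda>i::nat. [process_events M T W1, process_events M T W2, process_events M T W3, process_events M T W4] ! i"
    have four: "{..<4::nat} = {0, 1, 2, 3}" by auto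
    have "indep_vars (\<lambda>_. borel) ?X (\<Union>c\<in>{..<4::nat}. {..<n} \<times> ?R c)"
    proof (rule indep_vars_Union[where G = ?G])
      show "indep_sets ?G {..<4}" using indep unfolding indep_processes4_def .
      show "finite ({..<n} \<times> ?R j)" for j by simp
      show "{..<n} \<times> ?R j \<noteq> {}" if "j \<in> {..<4}" for j
        using that 1 by (auto simp: four lessThan_empty_iff)
      show "disjoint_family_on (\<lambda>c. {..<n} \<times> ?R c) {..<4}"
        by (auto simp: disjoint_family_on_def four)
      show "sigma_algebra (space M) (?G j)" if "j \<in> {..<4}" for j
        using that by (auto simp: four process_events_def intro!: sigma_algebra_sigma_sets)
      show "indep_vars (\<lambda>_. borel) ?X ({..<n} \<times> ?R j)" if "j \<in> {..<4}" for j
      proof -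
        have "indep_vars (\<lambda>_. borel) ?X ({..<n} \<times> range (Inl \<circ> Inl))"
          by (rule wiener_entries_indep[OF M W(1) T 1, where s = "1 / sqrt (T / real n)"]) (auto simp: inj_on_def nth)
        moreover have "indep_vars (\<lambda>_. borel) ?X ({..<n} \<times> range (Inl \<circ> Inr))"
          by (rule wiener_entries_indep[OF M W(2) T 1, where s = "1 / sqrt (T / real n)"]) (auto simp: inj_on_def nth)
        moreover have "indep_vars (\<lambda>_. borel) ?X ({..<n} \<times> range (Inr \<circ> Inl))"
          by (rule wiener_entries_indep[OF M W(3) T 1, where s = "1 / sqrt (T / real n)"]) (auto simp: inj_on_def nth)
        moreover have "indep_vars (\<lambda>_. borel) ?X ({..<n} \<times> range (Inr \<circ> Inr))"
          by (rule wiener_entries_indep[OF M W(4) T 1, where s = "1 / sqrt (T / real n)"]) (auto simp: inj_on_def nth)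
        ultimately show ?thesis using that by (auto simp: four)
      qed
      show "?X i -` A \<inter> space M \<in> ?G j" if "j \<in> {..<4}" "i \<in> {..<n} \<times> ?R j" "A \<in> sets borel" for j i A
        using that process_events_incr[OF T _ that(3), of _ n "1 / sqrt (T / real n)" W1] 
          process_events_incr[OF T _ that(3), of _ n "1 / sqrt (T / real n)" W2] 
          process_events_incr[OF T _ that(3), of _ n "1 / sqrt (T / real n)" W3] 
          process_events_incr[OF T _ that(3), of _ n "1 / sqrt (T / real n)" W4]
        by (auto simp: four nth)
    qed (auto simp: four)
    also have "(\<Union>c\<in>{..<4::nat}. {..<n} \<times> ?R c) = {..<n} \<times> UNIV"
    proof -
      have "\<exists>c\<in>{..<4::nat}. \<rho> \<in> ?R c" for \<rho> :: "('r1 + 'r2) + ('r3 + 'r4)"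
      proof (cases \<rho>)
        case (Inl a)
        then show ?thesis by (cases a) (auto simp: four)
      next
        case (Inr b)
        then show ?thesis by (cases b) (auto simp: four)
      qed
      then show ?thesis by auto
    qed
    finally show ?case .
  next
    case (2 n k \<rho>)
    show ?case
    proof (cases \<rho>)
      case (Inl a)
      then show ?thesis
        using wiener_entry_distr[OF M W(1) T 2(2)] wiener_entry_distr[OF M W(2) T 2(2)]
        by (cases a) (simp_all add: nth)
    next
      case (Inr b)
      then show ?thesis
        using wiener_entry_distr[OF M W(3) T 2(2)] wiener_entry_distr[OF M W(4) T 2(2)]
        by (cases b) (simp_all add: nth)
    qed
  qed
qed

lemma continuous_on_stack:
  assumes "continuous_on S f" "continuous_on S g"
  shows "continuous_on S (\<lambda>t. stack (f t) (g t))"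
  unfolding stack_def
proof (rule continuous_on_vec_lambda)
  fix i
  show "continuous_on S (\<lambda>t. case i of Inl a \<Rightarrow> f t $ a | Inr b \<Rightarrow> g t $ b)"
    using assms by (cases i) (auto intro: continuous_on_component)
qed

lemma continuous_on_stack4:
  assumes "continuous_on S f1" "continuous_on S f2" "continuous_on S f3" "continuous_on S f4"
  shows "continuous_on S (\<lambda>t. stack4 (f1 t) (f2 t) (f3 t) (f4 t))"
  unfolding stack4_def by (intro continuous_on_stack assms)

theorem theorem7:
  fixes M :: "'w measure"
    and T :: real
    and m :: "('q::finite, 'p1::finite, 'p2::finite, 'k1::finite, 'k2::finite) sem"
    and ms :: "('s::finite, 'p1, 'p2, 'l1::finite, 'l2::finite) sem"
    and \<theta>m0 :: "real^'q" and \<theta>s0 :: "real^'s"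
    and B1 :: "real^'k1 \<Rightarrow> real^'k1" and S1 :: "real^'r1::finite^'k1"
    and B2 :: "real^'p1 \<Rightarrow> real^'p1" and S2 :: "real^'r2::finite^'p1"
    and B3 :: "real^'p2 \<Rightarrow> real^'p2" and S3 :: "real^'r3::finite^'p2"
    and B4 :: "real^'k2 \<Rightarrow> real^'k2" and S4 :: "real^'r4::finite^'k2"
    and W1 :: "real \<Rightarrow> 'w \<Rightarrow> real^'r1" and W2 :: "real \<Rightarrow> 'w \<Rightarrow> real^'r2"
    and W3 :: "real \<Rightarrow> 'w \<Rightarrow> real^'r3" and W4 :: "real \<Rightarrow> 'w \<Rightarrow> real^'r4"
    and \<xi> :: "real \<Rightarrow> 'w \<Rightarrow> real^'k1" and \<delta> :: "real \<Rightarrow> 'w \<Rightarrow> real^'p1"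
    and \<epsilon> :: "real \<Rightarrow> 'w \<Rightarrow> real^'p2" and \<zeta> \<eta> :: "real \<Rightarrow> 'w \<Rightarrow> real^'k2"
    and X1 :: "real \<Rightarrow> 'w \<Rightarrow> real^'p1" and X2 :: "real \<Rightarrow> 'w \<Rightarrow> real^'p2"
    and X :: "real \<Rightarrow> 'w \<Rightarrow> real^('p1+'p2)"
    and \<theta>hat :: "nat \<Rightarrow> 'w \<Rightarrow> real^'s"
  assumes "prob_space M" and "0 < T"
    and models: "sem_model m" "sem_model ms"
    and true_param: "\<theta>m0 \<in> params m"
    (* the observable process, generated by model m *)
    and wiener: "wiener_process M T W1" "wiener_process M T W2"
      "wiener_process M T W3" "wiener_process M T W4" "indep_processes4 M T W1 W2 W3 W4"
    and latent: "sde_solution M T B1 S1 W1 \<xi>" "sde_solution M T B2 S2 W2 \<delta>"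
      "sde_solution M T B3 S3 W3 \<epsilon>" "sde_solution M T B4 S4 W4 \<zeta>"
    and diffusion: "Sxi m \<theta>m0 = S1 ** transpose S1" "Sdelta m \<theta>m0 = S2 ** transpose S2"
      "Seps m \<theta>m0 = S3 ** transpose S3" "Szeta m \<theta>m0 = S4 ** transpose S4"
    and X1: "\<And>t \<omega>. t \<in> {0..T} \<Longrightarrow> \<omega> \<in> space M \<Longrightarrow> X1 t \<omega> = Lx1 m \<theta>m0 *v \<xi> t \<omega> + \<delta> t \<omega>"
    and X2: "\<And>t \<omega>. t \<in> {0..T} \<Longrightarrow> \<omega> \<in> space M \<Longrightarrow> X2 t \<omega> = Lx2 m \<theta>m0 *v \<eta> t \<omega> + \<epsilon> t \<omega>"
    and \<eta>: "\<And>t \<omega>. t \<in> {0..T} \<Longrightarrow> \<omega> \<in> space M \<Longrightarrow>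
      \<eta> t \<omega> = B0 m \<theta>m0 *v \<eta> t \<omega> + Gam m \<theta>m0 *v \<xi> t \<omega> + \<zeta> t \<omega>"
    and X: "\<And>t \<omega>. t \<in> {0..T} \<Longrightarrow> \<omega> \<in> space M \<Longrightarrow> X t \<omega> = stack (X1 t \<omega>) (X2 t \<omega>)"
    (* (a) *)
    and drifts: "regular_drift B1" "regular_drift B2" "regular_drift B3" "regular_drift B4"
    and moments: "bounded_moments M T \<xi>" "bounded_moments M T \<delta>"
      "bounded_moments M T \<epsilon>" "bounded_moments M T \<zeta>"
    (* (b) *)
    and nondegenerate_m: "\<And>\<theta>. \<theta> \<in> params m \<Longrightarrow>
      pos_def (Sdelta m \<theta>) \<and> pos_def (Seps m \<theta>) \<and> invertible (Psi m \<theta>) \<and> rank (Lx1 m \<theta>) = CARD('k1)"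
    and nondegenerate_ms: "\<And>\<theta>. \<theta> \<in> params ms \<Longrightarrow>
      pos_def (Sdelta ms \<theta>) \<and> pos_def (Seps ms \<theta>) \<and> invertible (Psi ms \<theta>) \<and> rank (Lx1 ms \<theta>) = CARD('l1)"
    (* (c) *)
    and identifiable: "\<And>\<theta> \<theta>'. \<theta> \<in> params ms \<Longrightarrow> \<theta>' \<in> params ms \<Longrightarrow>
      Sigma_cov ms \<theta> = Sigma_cov ms \<theta>' \<Longrightarrow> \<theta> = \<theta>'"
    (* (d); the Jacobian in (e) is a two-sided derivative of a map on the parameter set, so it is
       taken at an interior point. At a boundary point the limit is in general not chi-squared. *)
    and null_hypothesis: "\<theta>s0 \<in> params ms" "Sigma_cov m \<theta>m0 = Sigma_cov ms \<theta>s0"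
    and interior_point: "\<theta>s0 \<in> interior (params ms)"
    (* (e) *)
    and full_rank: "rank (jacobian (\<lambda>\<theta>. vech (Sigma_cov ms \<theta>)) (at \<theta>s0)) = CARD('s)"
    (* minimum contrast estimator *)
    and estimator: "\<And>n \<omega>. n \<ge> 1 \<Longrightarrow> \<omega> \<in> space M \<Longrightarrow> \<theta>hat n \<omega> \<in> params ms \<and>
      contrast (realized_cov T X n \<omega>) (Sigma_cov ms (\<theta>hat n \<omega>)) =
      (INF \<theta>\<in>params ms. contrast (realized_cov T X n \<omega>) (Sigma_cov ms \<theta>))"
  shows "weak_conv_m
     (\<lambda>n. distr M borel
        (\<lambda>\<omega>. real n * contrast (realized_cov T X n \<omega>) (Sigma_cov ms (\<theta>hat n \<omega>))))
     (chi_squared ((CARD('p1) + CARD('p2)) * (CARD('p1) + CARD('p2) + 1) div 2 - CARD('s)))"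
proof -
  interpret prob_space M by fact
  note inv_m = nondegenerate_m[OF true_param]
  let ?W = "\<lambda>t \<omega>. stack4 (W1 t \<omega>) (W2 t \<omega>) (W3 t \<omega>) (W4 t \<omega>)"
  let ?A = "factor m \<theta>m0 S1 S2 S3 S4"
  let ?g = "\<lambda>\<theta>. vech (Sigma_cov ms \<theta>)"
  \<comment> \<open>The equation for \<eta> is implicit; inverting \<open>Psi\<close> makes it
    linear in \<xi> and \<zeta>.\<close>
  have X_eq: "X t \<omega> = load1 m \<theta>m0 (\<xi> t \<omega>) + load2 (\<delta> t \<omega>) + load3 (\<epsilon> t \<omega>) + load4 m \<theta>m0 (\<zeta> t \<omega>)"
    if t: "t \<in> {0..T}" and \<omega>: "\<omega> \<in> space M" for t \<omega>
  proof -
    have "Psi m \<theta>m0 *v \<eta> t \<omega> = \<eta> t \<omega> - B0 m \<theta>m0 *v \<eta> t \<omega>"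
      by (simp add: Psi_def matrix_vector_mult_diff_rdistrib)
    also have "\<dots> = Gam m \<theta>m0 *v \<xi> t \<omega> + \<zeta> t \<omega>"
      using \<eta>[OF t \<omega>] by (simp add: algebra_simps)
    finally have "matrix_inv (Psi m \<theta>m0) *v (Psi m \<theta>m0 *v \<eta> t \<omega>) =
        matrix_inv (Psi m \<theta>m0) *v (Gam m \<theta>m0 *v \<xi> t \<omega> + \<zeta> t \<omega>)" by simp
    then have "\<eta> t \<omega> = matrix_inv (Psi m \<theta>m0) *v (Gam m \<theta>m0 *v \<xi> t \<omega> + \<zeta> t \<omega>)"
      using inv_m by (simp add: matrix_vector_mul_assoc matrix_inv_works)
    then have "X2 t \<omega> = Lx2 m \<theta>m0 *v (matrix_inv (Psi m \<theta>m0) *v (Gam m \<theta>m0 *v \<xi> t \<omega>)) +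
        \<epsilon> t \<omega> + Lx2 m \<theta>m0 *v (matrix_inv (Psi m \<theta>m0) *v \<zeta> t \<omega>)"
      using X2[OF t \<omega>] by (simp add: matrix_vector_right_distrib)
    then show ?thesis
      unfolding X[OF t \<omega>] load1_def load2_def load3_def load4_def stack_add
      using X1[OF t \<omega>] by simp
  qed
  have latent_measurable: "Y t \<in> borel_measurable M" if "sde_solution M T B S V Y" "t \<in> {0..T}"
    for B S V and Y :: "real \<Rightarrow> 'w \<Rightarrow> real^'d::finite" and t
    using that unfolding sde_solution_def by blast
  have X_measurable: "X t \<in> borel_measurable M" if t: "t \<in> {0..T}" for t
  proof -
    have "(\<lambda>\<omega>. load1 m \<theta>m0 (\<xi> t \<omega>) + load2 (\<delta> t \<omega>) + load3 (\<epsilon> t \<omega>) + load4 m \<theta>m0 (\<zeta> t \<omega>)) \<in> borel_measurable M"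
      by (intro borel_measurable_add borel_measurable_linear[OF linear_loads(1)] borel_measurable_linear[OF linear_loads(2)]
          borel_measurable_linear[OF linear_loads(3)] borel_measurable_linear[OF linear_loads(4)]
          latent_measurable[OF latent(1) t] latent_measurable[OF latent(2) t] latent_measurable[OF latent(3) t] latent_measurable[OF latent(4) t])
    then show ?thesis
      by (rule measurable_cong[THEN iffD2, rotated]) (rule X_eq[OF t])
  qed
  have repr: "AE \<omega> in M. \<exists>b x0. continuous_on {0..T} b \<and> (\<forall>t\<in>{0..T}. X t \<omega> = x0 + integral {0..t} b + ?A *v ?W t \<omega>)"
    using sde_solution_drift_plus[OF latent(1) drifts(1)] sde_solution_drift_plus[OF latent(2) drifts(2)]
      sde_solution_drift_plus[OF latent(3) drifts(3)] sde_solution_drift_plus[OF latent(4) drifts(4)] AE_space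
  proof eventually_elim
    case (elim \<omega>)
    have "drift_plus T (\<lambda>t. load1 m \<theta>m0 (\<xi> t \<omega>) + load2 (\<delta> t \<omega>) + load3 (\<epsilon> t \<omega>) + load4 m \<theta>m0 (\<zeta> t \<omega>))
        (\<lambda>t. load1 m \<theta>m0 (S1 *v W1 t \<omega>) + load2 (S2 *v W2 t \<omega>) + load3 (S3 *v W3 t \<omega>) + load4 m \<theta>m0 (S4 *v W4 t \<omega>))"
      by (intro drift_plus_add drift_plus_linear[OF linear_loads(1) elim(1)] drift_plus_linear[OF linear_loads(2) elim(2)]
          drift_plus_linear[OF linear_loads(3) elim(3)] drift_plus_linear[OF linear_loads(4) elim(4)])
    then show ?case
      unfolding drift_plus_def factor_mult factor_map_stack4 using X_eq[OF _ elim(5)] by simp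
  qed
  have W_cont: "AE \<omega> in M. continuous_on {0..T} (\<lambda>t. V t \<omega>)" if "wiener_process M T V"
    for V :: "real \<Rightarrow> 'w \<Rightarrow> real^'d::finite"
    using that unfolding wiener_process_def by blast
  have stack_cont: "AE \<omega> in M. continuous_on {0..T} (\<lambda>t. ?W t \<omega>)"
    using W_cont[OF wiener(1)] W_cont[OF wiener(2)] W_cont[OF wiener(3)] W_cont[OF wiener(4)]
    by eventually_elim (intro continuous_on_stack4)
  have AA: "?A ** transpose ?A = Sigma_cov ms \<theta>s0"
    using Sigma_cov_factor[OF diffusion] null_hypothesis(2) by simp
  have pd: "pos_def (Sigma_cov ms \<theta>)" if "\<theta> \<in> params ms" for \<theta>
    using models(2) nondegenerate_ms[OF that] that unfolding sem_model_def by (intro Sigma_cov_pos_def) auto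
  have diff: "?g differentiable (at \<theta> within U)" if "\<theta> \<in> U" "U \<subseteq> params ms" for \<theta> U
  proof (rule differentiable_compose[of vech])
    show "vech differentiable at (Sigma_cov ms \<theta>)" by (rule linear_imp_differentiable[OF linear_vech])
    show "Sigma_cov ms differentiable at \<theta> within U"
      using that nondegenerate_ms by (intro Sigma_cov_differentiable[OF models(2)]) auto
  qed
  have cont: "continuous_on (params ms) ?g"
    by (rule differentiable_imp_continuous_on) (simp add: differentiable_on_def diff)
  \<comment> \<open>Invertibility of \<open>Psi\<close> is known on the parameter set only, so the
    derivative is first taken within its interior, which is open.\<close>
  have "?g differentiable (at \<theta>s0 within interior (params ms))"
    by (rule diff[OF interior_point interior_subset])
  then have "?g differentiable (at \<theta>s0)"
    by (simp add: at_within_open[OF interior_point open_interior])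
  then have deriv: "(?g has_derivative frechet_derivative ?g (at \<theta>s0)) (at \<theta>s0)"
    by (rule frechet_derivative_works[THEN iffD1])
  have "(*v) (jacobian ?g (at \<theta>s0)) = frechet_derivative ?g (at \<theta>s0)"
    unfolding jacobian_def using has_derivative_linear[OF deriv] by (auto simp: matrix_works)
  \<comment> \<open>Full column rank is injectivity of the matrix, and the matrix acts as the
    derivative.\<close>
  then have inj: "inj (frechet_derivative ?g (at \<theta>s0))"
    using full_rank unfolding full_rank_injective by simp
  interpret arr: gauss_array M "\<lambda>n k \<omega>. (1 / sqrt (T / real n)) *\<^sub>R incr T n (\<lambda>t. ?W t \<omega>) k"
    by (rule gauss_array_stack4[OF prob_space_axioms \<open>0 < T\<close> wiener])
  interpret test: covariance_test M "\<lambda>n k \<omega>. (1 / sqrt (T / real n)) *\<^sub>R incr T n (\<lambda>t. ?W t \<omega>) k"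
    T ?W X ?A "Sigma_cov ms" "params ms" \<theta>s0 "frechet_derivative ?g (at \<theta>s0)" \<theta>hat
  proof unfold_locales
    show "incr T n (\<lambda>t. ?W t \<omega>) k = sqrt (T / real n) *\<^sub>R ((1 / sqrt (T / real n)) *\<^sub>R incr T n (\<lambda>t. ?W t \<omega>) k)"
      if "n \<ge> 1" for n k \<omega>
      using that \<open>0 < T\<close> by simp
    show "compact (params ms)" using models(2) by (simp add: sem_model_def)
    show "\<theta> = \<theta>s0" if "\<theta> \<in> params ms" "Sigma_cov ms \<theta> = Sigma_cov ms \<theta>s0" for \<theta>
      by (rule identifiable[OF that(1) null_hypothesis(1) that(2)])
  qed (fact \<open>0 < T\<close> X_measurable stack_cont repr pd interior_point AA cont deriv inj estimator)+
  \<comment> \<open>The subtraction of \<open>CARD('s)\<close> from this number is exact on the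
    naturals, since the Jacobian is injective.\<close>
  have "CARD(('p1 + 'p2) uprod) = (CARD('p1) + CARD('p2)) * (CARD('p1) + CARD('p2) + 1) div 2"
    by (simp add: card_UNIV_uprod)
  then show ?thesis
    using test.stat_weak_limit unfolding test.stat_def[abs_def] test.Q_def by simp
qed

end
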